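(* Let $U\in\mathbb{R}^{d\times d}$ and $V\in\mathbb{R}^{m\times m}$ be contracting, non-singular matrices, let $X=\{X(t)\}_{t\in\mathbb{R}^d}$ be a $(U,V)$-self-affine random field on $\mathbb{R}^m$, and let $\tau_X$ be its occupation measure on $\mathbb{R}^d\times\mathbb{R}^m$. Put $W=U\oplus V\in\mathbb{R}^{(d+m)\times(d+m)}$ (block-diagonal matrix) and $\operatorname{Gr}X([0,1]^d)=\{(t,X(t)):t\in[0,1]^d\}\subset\mathbb{R}^{d+m}$. Suppose that $\dim_{\mathcal H}\operatorname{Gr}X([0,1]^d)$ is almost surely equal to a constant $\delta$, that $$\int_{[-1,1]^d}\mathbb{E}\big[\big(\|t\|+\|X(t)\|\big)^{-\gamma}\big]\,d\boldsymbol{\lambda}_d(t)<\infty\quad\text{for every }0\le\gamma<\delta,$$ and that $\tau_X$ satisfies the b.c.i. condition with respect to $W$. Then with probability one $$\dim_{\mathcal H}\operatorname{Gr}X([0,1]^d)=s(W,|\det U|).$$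
   Context: $\boldsymbol{\lambda}_n$ is Lebesgue measure on $\mathbb{R}^n$, $\|\cdot\|$ is the Euclidean norm, $\dim_{\mathcal H}$ is Hausdorff dimension. A matrix is contracting if every eigenvalue $\rho$ satisfies $|\rho|<1$. A random field $X=\{X(t)\}_{t\in\mathbb{R}^d}$ on $\mathbb{R}^m$ (i.e. with values in $\mathbb{R}^m$), defined on a probability space $(\Omega,\mathcal A,P)$, is $(U,V)$-self-affine if: (i) $\{X(Ut)\}_{t\in\mathbb{R}^d}$ and $\{VX(t)\}_{t\in\mathbb{R}^d}$ have the same finite-dimensional distributions; (ii) $X$ has stationary increments, i.e. $X(t)-X(s)$ and $X(t-s)$ have the same distribution for all $s,t\in\mathbb{R}^d$; (iii) $X$ is proper, i.e. for every $t\neq0$ the distribution of $X(t)$ is not supported on any lower-dimensional hyperplane of $\mathbb{R}^m$; (iv) the mapping $X:\mathbb{R}^d\times\Omega\to\mathbb{R}^m$ is $(\mathcal B(\mathbb{R}^d)\otimes\mathcal A)$-$\mathcal B(\mathbb{R}^m)$-measurable. The occupation measure of a Borel function $f:\mathbb{R}^d\to\mathbb{R}^m$ is the Borel measure $\tau_f$ on $\mathbb{R}^d\times\mathbb{R}^m$ determined by $\tau_f(A\times B)=\boldsymbol{\lambda}_d\{t\in A: f(t)\in B\}$ for Borel $A\subset\mathbb{R}^d$, $B\subset\mathbb{R}^m$; $\tau_X$ is the random measure obtained by applying this to the sample functions of $X$. Its intensity measure is $\mathbb{E}[\tau_X](A)=\mathbb{E}[\tau_X(A)]$ for Borel $A\subset\mathbb{R}^{d+m}$.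 $\tau_X$ satisfies the b.c.i. (boundedly continuous intensity) condition with respect to $W$ if there is a constant $0<C<\infty$ such that $\mathbb{E}[\tau_X](A)\le C\,\boldsymbol{\lambda}_{d+m}(A)$ for every Borel set $A\subset[-1,1]^{d+m}\setminus W([-1,1]^{d+m})$. For a non-singular matrix $M\in\mathbb{R}^{n\times n}$ with singular values $\alpha_1\ge\dots\ge\alpha_n>0$, the singular value function $\phi_M:(0,n]\to(0,\infty)$ is $\phi_M(r)=\alpha_1\alpha_2\cdots\alpha_{j-1}\alpha_j^{\,r-j+1}$, where $j$ is the unique integer with $j-1<r\le j$. For a contracting non-singular $M\in\mathbb{R}^{n\times n}$ and $0<x<1$, $$s(M,x)=\inf\{r\in(0,n]:\lim_{k\to\infty}x^{-k}\phi_{M^k}(r)=0\},\qquad \inf\emptyset=n.$$ *)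

theory Defs
  imports "HOL-Probability.Probability" "HOL-Computational_Algebra.Polynomial"
begin

subsection \<open>The space $R^{d+m}$ and block matrices\<close>

text \<open>$R^{d+m}$ is \<open>real ^ ('d + 'm)\<close>, with \<open>CARD('d) = d\<close> and \<open>CARD('m) = m\<close>.\<close>

definition vec_join :: "'a ^ 'd \<Rightarrow> 'a ^ 'm \<Rightarrow> 'a ^ ('d + 'm)" where
  "vec_join t y = (\<chi> k. case k of Inl i \<Rightarrow> t $ i | Inr j \<Rightarrow> y $ j)"

definition rect :: "('a ^ 'd) set \<Rightarrow> ('a ^ 'm) set \<Rightarrow> ('a ^ ('d + 'm)) set" where
  "rect A B = (\<lambda>(t, y). vec_join t y) ` (A \<times> B)"

definition block_diag :: "'a::zero ^ 'd ^ 'd \<Rightarrow> 'a ^ 'm ^ 'm \<Rightarrow> 'a ^ ('d + 'm) ^ ('d + 'm)" where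
  "block_diag U V = (\<chi> k l. case (k, l) of
      (Inl i, Inl i') \<Rightarrow> U $ i $ i'
    | (Inr j, Inr j') \<Rightarrow> V $ j $ j'
    | _ \<Rightarrow> 0)"

definition cube :: "(real ^ 'n) set" where
  "cube = {x. \<forall>i. -1 \<le> x $ i \<and> x $ i \<le> 1}"

definition unit_cube :: "(real ^ 'n) set" where
  "unit_cube = {x. \<forall>i. 0 \<le> x $ i \<and> x $ i \<le> 1}"

definition graph_over :: "(real ^ 'd) set \<Rightarrow> (real ^ 'd \<Rightarrow> real ^ 'm) \<Rightarrow> (real ^ ('d + 'm)) set" where
  "graph_over T f = (\<lambda>t. vec_join t (f t)) ` T"


subsection \<open>Eigenvalues and singular values\<close>

definition complex_eigenvalue :: "real ^ 'n ^ 'n \<Rightarrow> complex \<Rightarrow> bool" where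
  "complex_eigenvalue M \<rho> \<longleftrightarrow>
     (\<exists>v. v \<noteq> 0 \<and> map_matrix complex_of_real M *v v = \<rho> *s v)"

definition contracting :: "real ^ 'n ^ 'n \<Rightarrow> bool" where
  "contracting M \<longleftrightarrow> (\<forall>\<rho>. complex_eigenvalue M \<rho> \<longrightarrow> norm \<rho> < 1)"

definition charpoly :: "real ^ 'n ^ 'n \<Rightarrow> real poly" where
  "charpoly M = det (\<chi> i j. (if i = j then [:0, 1:] else 0) - [:M $ i $ j:])"

text \<open>The singular values are the square roots of the eigenvalues of \<open>transpose M ** M\<close>, listed in
  descending order with multiplicity. Position \<open>i\<close> of the list (counted from 0) holds
  $\alpha_{i+1}$.\<close>

definition singular_values :: "real ^ 'n ^ 'n \<Rightarrow> real list" where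
  "singular_values M =
     rev (sorted_list_of_multiset (image_mset sqrt (proots (charpoly (transpose M ** M)))))"

text \<open>For \<open>r > 0\<close> the unique integer \<open>j\<close> with \<open>j - 1 < r \<le> j\<close> is the ceiling of \<open>r\<close>.\<close>

definition singular_value_function :: "real ^ 'n ^ 'n \<Rightarrow> real \<Rightarrow> real" where
  "singular_value_function M r =
     (let \<alpha> = (\<lambda>i. singular_values M ! (i - 1)); j = nat \<lceil>r\<rceil>
      in (\<Prod>i = 1..<j. \<alpha> i) * \<alpha> j powr (r - real j + 1))"

text \<open>The power \<open>M ^ k\<close> on the type \<open>real ^ 'n ^ 'n\<close> is the entrywise one.\<close>

definition matrix_power :: "real ^ 'n ^ 'n \<Rightarrow> nat \<Rightarrow> real ^ 'n ^ 'n" where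
  "matrix_power M k = ((\<lambda>A. M ** A) ^^ k) (mat 1)"

definition s_exponent :: "real ^ 'n ^ 'n \<Rightarrow> real \<Rightarrow> real" where
  "s_exponent M x =
     (let R = {r. 0 < r \<and> r \<le> real CARD('n) \<and>
                  (\<lambda>k. singular_value_function (matrix_power M k) r / x ^ k) \<longlonglongrightarrow> 0}
      in if R = {} then real CARD('n) else Inf R)"


subsection \<open>Hausdorff dimension\<close>

text \<open>The conventions are $0^0 = 1$ for nonempty sets and weight 0 for the empty set. In covers,
  boundedness is required because \<open>diameter\<close> is unspecified for unbounded sets.\<close>

definition diam_weight :: "real \<Rightarrow> 'a::metric_space set \<Rightarrow> ennreal" where
  "diam_weight s E =
     (if E = {} then 0 else if s = 0 then 1 else ennreal (diameter E powr s))"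

definition hausdorff_premeasure :: "real \<Rightarrow> real \<Rightarrow> 'a::metric_space set \<Rightarrow> ennreal" where
  "hausdorff_premeasure s \<epsilon> A =
     (INF E \<in> {E :: nat \<Rightarrow> 'a set. A \<subseteq> (\<Union>i. E i) \<and> (\<forall>i. bounded (E i) \<and> diameter (E i) \<le> \<epsilon>)}.
        \<Sum>i. diam_weight s (E i))"

definition hausdorff_measure :: "real \<Rightarrow> 'a::metric_space set \<Rightarrow> ennreal" where
  "hausdorff_measure s A = (SUP \<epsilon> \<in> {0<..}. hausdorff_premeasure s \<epsilon> A)"

definition hausdorff_dim :: "'a::metric_space set \<Rightarrow> ereal" where
  "hausdorff_dim A = (INF s \<in> {s. 0 \<le> s \<and> hausdorff_measure s A = 0}. ereal s)"


subsection \<open>Self-affine random fields\<close>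

definition same_fdd ::
  "'w measure \<Rightarrow> ('t \<Rightarrow> 'w \<Rightarrow> 'b::topological_space) \<Rightarrow> ('t \<Rightarrow> 'w \<Rightarrow> 'b) \<Rightarrow> bool" where
  "same_fdd P X Y \<longleftrightarrow>
     (\<forall>J. finite J \<longrightarrow>
        distr P (\<Pi>\<^sub>M t\<in>J. borel) (\<lambda>\<omega>. \<lambda>t\<in>J. X t \<omega>) = distr P (\<Pi>\<^sub>M t\<in>J. borel) (\<lambda>\<omega>. \<lambda>t\<in>J. Y t \<omega>))"

definition stationary_increments :: "'w measure \<Rightarrow> (real ^ 'd \<Rightarrow> 'w \<Rightarrow> real ^ 'm) \<Rightarrow> bool" where
  "stationary_increments P X \<longleftrightarrow>
     (\<forall>s t. distr P borel (\<lambda>\<omega>. X t \<omega> - X s \<omega>) = distr P borel (X (t - s)))"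

text \<open>Hyperplanes are affine, that is, they need not contain the origin.\<close>

definition proper_field :: "'w measure \<Rightarrow> (real ^ 'd \<Rightarrow> 'w \<Rightarrow> real ^ 'm) \<Rightarrow> bool" where
  "proper_field P X \<longleftrightarrow>
     (\<forall>t. t \<noteq> 0 \<longrightarrow>
        \<not> (\<exists>H. affine H \<and> aff_dim H < int CARD('m) \<and> (AE y in distr P borel (X t). y \<in> H)))"

definition self_affine_field ::
  "'w measure \<Rightarrow> real ^ 'd ^ 'd \<Rightarrow> real ^ 'm ^ 'm \<Rightarrow> (real ^ 'd \<Rightarrow> 'w \<Rightarrow> real ^ 'm) \<Rightarrow> bool" where
  "self_affine_field P U V X \<longleftrightarrow>
     same_fdd P (\<lambda>t. X (U *v t)) (\<lambda>t \<omega>. V *v X t \<omega>) \<and>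
     stationary_increments P X \<and>
     proper_field P X \<and>
     (\<lambda>(t, \<omega>). X t \<omega>) \<in> borel_measurable (borel \<Otimes>\<^sub>M P)"


subsection \<open>Occupation measure\<close>

definition is_occupation_measure ::
  "(real ^ 'd \<Rightarrow> real ^ 'm) \<Rightarrow> (real ^ ('d + 'm)) measure \<Rightarrow> bool" where
  "is_occupation_measure f \<tau> \<longleftrightarrow>
     sets \<tau> = sets borel \<and>
     (\<forall>A \<in> sets borel. \<forall>B \<in> sets borel.
        emeasure \<tau> (rect A B) = emeasure lborel {t \<in> A. f t \<in> B})"

text \<open>Existence and uniqueness for Borel \<open>f\<close> are proved in \<open>occupation_measure_eq_distr\<close> below.\<close>

definition occupation_measure ::
  "(real ^ 'd \<Rightarrow> real ^ 'm) \<Rightarrow> (real ^ ('d + 'm)) measure" where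
  "occupation_measure f = (THE \<tau>. is_occupation_measure f \<tau>)"

definition occupation_intensity ::
  "'w measure \<Rightarrow> (real ^ 'd \<Rightarrow> 'w \<Rightarrow> real ^ 'm) \<Rightarrow> (real ^ ('d + 'm)) set \<Rightarrow> ennreal" where
  "occupation_intensity P X A = (\<integral>\<^sup>+ \<omega>. emeasure (occupation_measure (\<lambda>t. X t \<omega>)) A \<partial>P)"

definition bci_condition ::
  "'w measure \<Rightarrow> (real ^ 'd \<Rightarrow> 'w \<Rightarrow> real ^ 'm) \<Rightarrow> real ^ ('d + 'm) ^ ('d + 'm) \<Rightarrow> bool" where
  "bci_condition P X W \<longleftrightarrow>
     (\<exists>C::real. 0 < C \<and>
        (\<forall>A \<in> sets borel. A \<subseteq> cube - (\<lambda>x. W *v x) ` cube \<longrightarrow>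
           occupation_intensity P X A \<le> ennreal C * emeasure lborel A))"

lemma split_sum_all: "(\<forall>k. Q k) \<longleftrightarrow> (\<forall>i. Q (Inl i)) \<and> (\<forall>j. Q (Inr j))"
  by (metis obj_sumE)

lemma vec_join_inject [simp]: "vec_join t y = vec_join t' y' \<longleftrightarrow> t = t' \<and> y = y'"
proof
  assume eq: "vec_join t y = vec_join t' y'"
  have "t $ i = t' $ i" for i
    using arg_cong[OF eq, of "\<lambda>v. v $ Inl i"] by (simp add: vec_join_def)
  moreover have "y $ j = y' $ j" for j
    using arg_cong[OF eq, of "\<lambda>v. v $ Inr j"] by (simp add: vec_join_def)
  ultimately show "t = t' \<and> y = y'" by (simp add: vec_eq_iff)
qed auto

lemma rect_alt:
  fixes A :: "('a ^ 'd) set" and B :: "('a ^ 'm) set"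
  shows "rect A B = {z. (\<chi> i. z $ Inl i) \<in> A \<and> (\<chi> j. z $ Inr j) \<in> B}"
proof -
  have "z = vec_join (\<chi> i. z $ Inl i) (\<chi> j. z $ Inr j)" for z :: "'a ^ ('d + 'm)"
    by (simp add: vec_join_def vec_eq_iff split: sum.split)
  then show ?thesis
    by (force simp: rect_def vec_join_def)
qed

lemma rect_Int: "rect A B \<inter> rect A' B' = rect (A \<inter> A') (B \<inter> B')"
  by (auto simp: rect_alt)

lemma rect_borel:
  fixes A :: "(real ^ 'd) set" and B :: "(real ^ 'm) set"
  assumes [measurable]: "A \<in> sets borel" "B \<in> sets borel"
  shows "rect A B \<in> sets borel"
proof -
  have [measurable]: "(\<lambda>z::real ^ ('d + 'm). \<chi> i. z $ Inl i) \<in> borel_measurable borel"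
    "(\<lambda>z::real ^ ('d + 'm). \<chi> j. z $ Inr j) \<in> borel_measurable borel"
    by (intro borel_measurable_continuous_onI continuous_intros)+
  show ?thesis unfolding rect_alt by measurable
qed

lemma vec_join_measurable [measurable]:
  fixes f :: "real ^ 'd \<Rightarrow> real ^ 'm"
  assumes "f \<in> borel_measurable borel"
  shows "(\<lambda>t. vec_join t (f t)) \<in> borel_measurable borel"
proof -
  have c: "continuous_on UNIV (\<lambda>p::(real^'d) \<times> (real^'m). vec_join (fst p) (snd p))"
    unfolding vec_join_def
  proof (intro continuous_on_vec_lambda)
    fix k :: "'d + 'm"
    show "continuous_on UNIV
      (\<lambda>p::(real^'d) \<times> (real^'m). case k of Inl i \<Rightarrow> fst p $ i | Inr j \<Rightarrow> snd p $ j)"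
      by (cases k) (auto intro!: continuous_intros)
  qed
  have "(\<lambda>t. (t, f t)) \<in> borel_measurable borel"
    using assms by (auto intro!: borel_measurable_Pair)
  from measurable_compose[OF this borel_measurable_continuous_onI[OF c]] show ?thesis by simp
qed

lemma sets_borel_eq_rect:
  "sets (borel :: (real ^ ('d + 'm)) measure) =
     sigma_sets UNIV {rect A B | (A :: (real ^ 'd) set) (B :: (real ^ 'm) set).
       A \<in> sets borel \<and> B \<in> sets borel}" (is "_ = sigma_sets UNIV ?R")
proof
  show "sigma_sets UNIV ?R \<subseteq> sets borel"
    using sigma_sets_le_sets_iff[of "borel :: (real ^ ('d + 'm)) measure" ?R]
    by (auto intro: rect_borel)
  have box: "box a b \<in> ?R" for a b :: "real ^ ('d + 'm)"
  proof -
    have "box a b = rect (box (\<chi> i. a $ Inl i) (\<chi> i. b $ Inl i)) (box (\<chi> i. a $ Inr i) (\<chi> i. b $ Inr i))"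
      unfolding rect_alt by (simp add: set_eq_iff mem_box_cart split_sum_all)
    then show ?thesis by (auto intro!: exI)
  qed
  have "sets (borel :: (real ^ ('d + 'm)) measure) = sigma_sets UNIV (range (\<lambda>(a, b). box a b))"
    by (subst borel_eq_box) simp
  also have "\<dots> \<subseteq> sigma_sets UNIV ?R"
    using box by (intro sigma_sets_subseteq) auto
  finally show "sets (borel :: (real ^ ('d + 'm)) measure) \<subseteq> sigma_sets UNIV ?R" .
qed

lemma is_occupation_measure_distr:
  fixes f :: "real ^ 'd \<Rightarrow> real ^ 'm"
  assumes [measurable]: "f \<in> borel_measurable borel"
  shows "is_occupation_measure f (distr lborel borel (\<lambda>t. vec_join t (f t)))"
proof -
  have "emeasure (distr lborel borel (\<lambda>t. vec_join t (f t))) (rect A B) =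
      emeasure lborel {t \<in> A. f t \<in> B}" if "A \<in> sets borel" "B \<in> sets borel" for A B
  proof -
    have "(\<lambda>t. vec_join t (f t)) -` rect A B = {t \<in> A. f t \<in> B}"
      by (auto simp: rect_def)
    then show ?thesis
      using that by (simp add: emeasure_distr rect_borel)
  qed
  then show ?thesis by (simp add: is_occupation_measure_def)
qed

lemma is_occupation_measure_unique:
  fixes f :: "real ^ 'd \<Rightarrow> real ^ 'm"
  assumes \<tau>: "is_occupation_measure f \<tau>" and \<sigma>: "is_occupation_measure f \<sigma>"
  shows "\<tau> = \<sigma>"
proof (rule measure_eqI_generator_eq)
  let ?R = "{rect A B | (A :: (real ^ 'd) set) (B :: (real ^ 'm) set).
       A \<in> sets borel \<and> B \<in> sets borel}"
  let ?E = "\<lambda>n::nat. rect (ball 0 (real n) :: (real ^ 'd) set) (UNIV :: (real ^ 'm) set)"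
  show "Int_stable ?R"
    unfolding Int_stable_def
  proof (intro ballI)
    fix S T assume "S \<in> ?R" "T \<in> ?R"
    then obtain A B A' B' where "S = rect A B" "T = rect A' B'"
      "A \<in> sets borel" "B \<in> sets borel" "A' \<in> sets borel" "B' \<in> sets borel"
      by auto
    then show "S \<inter> T \<in> ?R" by (auto simp: rect_Int intro!: exI)
  qed
  show "?R \<subseteq> Pow UNIV" by simp
  show "sets \<tau> = sigma_sets UNIV ?R" "sets \<sigma> = sigma_sets UNIV ?R"
    using \<tau> \<sigma> by (simp_all add: is_occupation_measure_def sets_borel_eq_rect)
  show "emeasure \<tau> S = emeasure \<sigma> S" if "S \<in> ?R" for S
    using that \<tau> \<sigma> by (auto simp: is_occupation_measure_def)
  show "range ?E \<subseteq> ?R" by (auto intro!: exI)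
  show "(\<Union>n. ?E n) = UNIV"
    by (auto simp: rect_alt intro: reals_Archimedean2)
  show "emeasure \<tau> (?E n) \<noteq> \<infinity>" for n
  proof -
    have "emeasure \<tau> (?E n) = emeasure lborel (ball 0 (real n) :: (real ^ 'd) set)"
      using \<tau> by (simp add: is_occupation_measure_def del: mem_ball) (simp add: ball_def)
    also have "\<dots> < \<infinity>" by (intro emeasure_bounded_finite) simp
    finally show ?thesis by simp
  qed
qed

theorem occupation_measure_eq_distr:
  assumes "f \<in> borel_measurable borel"
  shows "occupation_measure f = distr lborel borel (\<lambda>t. vec_join t (f t))"
  unfolding occupation_measure_def
  using is_occupation_measure_distr[OF assms] is_occupation_measure_unique by blast

end

(* Write n = d + m and x = |det U|, and let v_M(r) be the volume of {z. |z| <= 1, |M z| <= r}.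
   Up to constants depending only on n, the singular value function phi_M(g) is the minimum over r > 0
   of r^g / v_M(r), attained at a singular value of M. Both inequalities are therefore
   statements about v_{W^k}.

   delta <= s: let pi(D) be the expected mass of the pairs of times in the unit cube whose graph
   points have a difference in D. By stationary increments pi is comparable near 0 with the
   intensity of the occupation measure, which W scales by x, so pi(W^k B) >= c x^k for a ball B.
   Smoothing with {z. |z| <= 1, |W^k z| <= r} gives pi(W^k B) v_{W^k}(r) <= C pi(B_{2r}), and the
   integrability hypothesis gives pi(B_{2r}) <= C r^g for g < delta. Hence phi_{W^k}(g) >= c x^k.

   s <= delta: if phi_{W^k}(g) / x^k does not tend to 0, submultiplicativity of v gives
   v_{W^k}(r) <= C r^g / x^k for all k and r. By b.c.i. and self-affinity the part of the
   intensity of B_r on W^k(cube) - W^{k+1}(cube) is at most C x^k min(1, r^g / x^k), and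
   interpolating the minimum and summing over k gives pi(B_r) <= C r^b for every b < g. A Frostman
   argument bounds the dimension of the graph from below by every such b. *)

theory Submission
  imports Defs "HOL-Computational_Algebra.Fundamental_Theorem_Algebra"
begin

subsection \<open>Singular values\<close>

text \<open>Volumes replace singular values because v_M is defined without singular vectors:
  estimating it takes only the triangle inequality, Fubini and scaling. The same inequality,
  \<open>autocorrelation_le\<close>, is used twice. Applied path by path to the graph it is the
  smoothing step; applied to Lebesgue measure on a flattened ball it gives the submultiplicativity
  of v.

  A contracting matrix can enlarge some vectors, so W need not map the cube into itself. Every use
  of contraction therefore goes through powers with large exponent, and the pieces of the cube are
  treated one at a time rather than as a nested sequence.

  In the second inequality the exponent is lowered twice. Summing over the pieces requires that a
  positive power of x^k survive the interpolation, and the Frostman argument needs room to sum over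
  dyadic radii. Assuming delta < s for contradiction leaves room for both losses.\<close>

lemma norm_add_scaleR_power2:
  fixes a b :: "'a::real_inner"
  shows "(norm (a + t *\<^sub>R b))\<^sup>2 = (norm a)\<^sup>2 + 2 * t * (a \<bullet> b) + t\<^sup>2 * (norm b)\<^sup>2"
  unfolding power2_norm_eq_inner
  by (simp add: inner_left_distrib inner_right_distrib inner_commute power2_eq_square algebra_simps)

text \<open>Right singular vectors without the spectral theorem. If a unit vector \<open>e\<close>
  of \<open>S\<close> maximises \<open>norm (f e)\<close>, then \<open>f e\<close> is orthogonal to
  \<open>f u\<close> for all \<open>u\<close> in \<open>S\<close> orthogonal to \<open>e\<close>,
  and the orthogonal complement of \<open>e\<close> in \<open>S\<close> has smaller dimension.
  Subspaces appear for the sake of this induction.\<close>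

lemma orthonormal_basis_orthogonal_images_subspace:
  fixes f :: "'a::euclidean_space \<Rightarrow> 'b::euclidean_space"
  assumes f: "linear f" and S: "subspace S"
  shows "\<exists>B\<subseteq>S. finite B \<and> card B = dim S \<and> (\<forall>b\<in>B. norm b = 1) \<and>
    pairwise (\<lambda>b c. b \<bullet> c = 0 \<and> f b \<bullet> f c = 0) B"
  using S
proof (induction "dim S" arbitrary: S)
  case 0
  then show ?case by (intro exI[of _ "{}"]) auto
next
  case (Suc k)
  define K where "K = S \<inter> sphere 0 1"
  have "\<exists>x\<in>S. x \<noteq> 0"
    using Suc(2) by (metis dim_eq_0 insertI1 nat.distinct(1) subsetI)
  then obtain x where x: "x \<in> S" "x \<noteq> 0" by blast
  have "x /\<^sub>R norm x \<in> K"
    using x Suc.prems by (auto simp: K_def subspace_scale)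
  moreover have "compact K"
    unfolding K_def using closed_subspace[OF Suc.prems] compact_sphere
    by (metis closed_Int_compact)
  moreover have "continuous_on K (\<lambda>x. norm (f x))"
    using linear_continuous_on[OF linear_conv_bounded_linear[THEN iffD1, OF f]]
    by (intro continuous_on_norm) 
  ultimately obtain e where e: "e \<in> K" and max: "\<And>y. y \<in> K \<Longrightarrow> norm (f y) \<le> norm (f e)"
    using continuous_attains_sup[of K "\<lambda>x. norm (f x)"] by blast
  have e1: "norm e = 1" "e \<in> S" using e by (auto simp: K_def)
  have max': "norm (f y) \<le> norm (f e) * norm y" if "y \<in> S" for y
  proof (cases "y = 0")
    case True
    then show ?thesis using linear_0[OF f] by simp
  next
    case False
    then have "y /\<^sub>R norm y \<in> K" using that Suc.prems by (auto simp: K_def subspace_scale)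
    from max[OF this] show ?thesis using False
      by (simp add: linear_cmul[OF f] field_simps)
  qed
  \<comment> \<open>First variation at the maximiser: a quadratic polynomial in \<open>t\<close> without constant term that
    is nowhere positive has no linear term.\<close>
  have orth: "f e \<bullet> f u = 0" if u: "u \<in> S" "e \<bullet> u = 0" for u
  proof (rule ccontr)
    assume nz: "f e \<bullet> f u \<noteq> 0"
    define q where "q = f e \<bullet> f u"
    \<comment> \<open>The summand 1 keeps \<open>c\<close> positive, so that
      \<open>t = q / c\<close> can be put into \<open>quad\<close>. The left side becomes 2 q^2 / c
      and the right side at most q^2 / c.\<close>
    define c where "c = (norm (f e))\<^sup>2 * (norm u)\<^sup>2 + 1"
    have "c > 0" by (auto simp: c_def intro: add_nonneg_pos)
    have quad: "2 * t * q \<le> t\<^sup>2 * (c - 1)" for t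
    proof -
      have "e + t *\<^sub>R u \<in> S" using e1 u Suc.prems by (simp add: subspace_add subspace_scale)
      from max'[OF this] have "(norm (f (e + t *\<^sub>R u)))\<^sup>2 \<le> (norm (f e) * norm (e + t *\<^sub>R u))\<^sup>2"
        by (intro power_mono) auto
      moreover have "(norm (f (e + t *\<^sub>R u)))\<^sup>2 = (norm (f e))\<^sup>2 + 2 * t * q + t\<^sup>2 * (norm (f u))\<^sup>2"
        by (simp add: linear_add[OF f] linear_cmul[OF f] norm_add_scaleR_power2 q_def)
      moreover have "(norm (e + t *\<^sub>R u))\<^sup>2 = 1 + t\<^sup>2 * (norm u)\<^sup>2"
        using u e1 by (simp add: norm_add_scaleR_power2)
      ultimately have "2 * t * q + t\<^sup>2 * (norm (f u))\<^sup>2 \<le> t\<^sup>2 * (c - 1)"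
        by (simp add: power_mult_distrib c_def algebra_simps)
      then show ?thesis by (smt (verit) zero_le_power2 mult_nonneg_nonneg)
    qed
    have "2 * (q / c) * q \<le> (q / c)\<^sup>2 * (c - 1)" by (rule quad)
    also have "\<dots> \<le> (q / c)\<^sup>2 * c" by (intro mult_left_mono) auto
    also have "\<dots> = q\<^sup>2 / c" using \<open>c > 0\<close> by (simp add: power2_eq_square field_simps)
    finally have "q\<^sup>2 / c \<le> 0" by (simp add: power2_eq_square)
    then show False using nz \<open>c > 0\<close> by (simp add: q_def divide_le_0_iff)
  qed
  define T where "T = {u \<in> S. e \<bullet> u = 0}"
  have T: "subspace T" using Suc.prems
    by (auto simp: T_def subspace_def inner_right_distrib)
  have "dim T = k"
  proof -
    have "dim {y \<in> S. \<forall>x \<in> span {e}. orthogonal x y} + dim (span {e}) = dim S"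
      by (intro dim_subspace_orthogonal_to_vectors) (use e1 Suc.prems in \<open>auto simp: span_minimal\<close>)
    moreover have "{y \<in> S. \<forall>x \<in> span {e}. orthogonal x y} = T"
      by (auto simp: T_def orthogonal_def span_singleton)
    moreover have "e \<noteq> 0" using e1 by auto
    ultimately show ?thesis using Suc(2) by (simp add: dim_span)
  qed
  from Suc(1)[OF this[symmetric] T] obtain B where B: "B \<subseteq> T" "finite B" "card B = k"
      "\<forall>b\<in>B. norm b = 1" "pairwise (\<lambda>b c. b \<bullet> c = 0 \<and> f b \<bullet> f c = 0) B"
    using \<open>dim T = k\<close> by auto
  have "e \<notin> B"
    using B(1) e1 by (auto simp: T_def norm_eq_1)
  have "e \<bullet> b = 0 \<and> f e \<bullet> f b = 0" if "b \<in> B" for b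
    using that B(1) orth by (auto simp: T_def)
  then show ?case
    using B \<open>e \<notin> B\<close> e1 Suc(2)
    by (intro exI[of _ "insert e B"]) (auto simp: pairwise_insert T_def inner_commute)
qed

text \<open>For square \<open>M\<close> the numbers \<open>norm (M *v e i)\<close> are the singular
  values, unsorted. Indexing the basis by \<open>'n\<close> allows products over \<open>UNIV\<close>
  wherever the order does not matter.\<close>

lemma orthonormal_basis_orthogonal_images:
  fixes M :: "real ^ 'n ^ 'm"
  obtains e :: "'n \<Rightarrow> real ^ 'n" where "\<And>i j. e i \<bullet> e j = (if i = j then 1 else 0)"
    "\<And>i j. i \<noteq> j \<Longrightarrow> (M *v e i) \<bullet> (M *v e j) = 0"
proof -
  obtain B :: "(real ^ 'n) set" where B: "finite B" "card B = CARD('n)" "\<forall>b\<in>B. norm b = 1"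
      "pairwise (\<lambda>b c. b \<bullet> c = 0 \<and> (M *v b) \<bullet> (M *v c) = 0) B"
    using orthonormal_basis_orthogonal_images_subspace[of "(*v) M" UNIV] by auto
  then obtain e where e: "bij_betw e (UNIV :: 'n set) B"
    using finite_same_card_bij[of "UNIV :: 'n set" B] by auto
  have in_B: "e i \<in> B" for i using e by (auto simp: bij_betw_def)
  have "e i \<noteq> e j" if "i \<noteq> j" for i j using e that by (auto simp: bij_betw_def inj_on_def)
  then have "e i \<bullet> e j = 0 \<and> (M *v e i) \<bullet> (M *v e j) = 0" if "i \<noteq> j" for i j
    using B(4) in_B that by (auto simp: pairwise_def)
  moreover have "e i \<bullet> e i = 1" for i using B(3) in_B by (simp add: norm_eq_1[symmetric])
  ultimately show ?thesis by (intro that[of e]) auto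
qed

section \<open>Characteristic polynomial of the Gram matrix\<close>

lemma rows_orthonormal:
  fixes e :: "'n \<Rightarrow> real ^ 'n"
  assumes "\<And>i j. e i \<bullet> e j = (if i = j then 1 else (0::real))"
  shows "(\<chi> i. e i) ** transpose (\<chi> i. e i) = mat 1"
proof -
  have "(\<Sum>k\<in>UNIV. e i $ k * e j $ k) = (if i = j then 1 else 0)" for i j
    using assms[of i j] by (simp only: inner_vec_def inner_real_def)
  then show ?thesis
    by (simp add: matrix_matrix_mult_def transpose_def vec_eq_iff mat_def)
qed

lemma map_matrix_mult:
  assumes "\<And>a b. h (a * b) = h a * h b" "\<And>a b. h (a + b) = h a + h b" "h 0 = (0 :: 'b::semiring_1)"
  shows "map_matrix h (A ** B) = map_matrix h A ** map_matrix h (B :: 'a::semiring_1 ^ 'm ^ 'n)"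
proof -
  have "h (sum g S) = (\<Sum>i\<in>S. h (g i))" for g and S :: "'n set"
    using assms by (induction S rule: infinite_finite_induct) auto
  then show ?thesis using assms by (simp add: matrix_matrix_mult_def vec_eq_iff)
qed

lemma map_matrix_const_poly_mult:
  "map_matrix (\<lambda>c. [:c:]) (A ** B) =
    map_matrix (\<lambda>c. [:c:]) A ** map_matrix (\<lambda>c. [:c:]) (B :: real ^ 'm ^ 'n)"
  by (rule map_matrix_mult) auto

lemma charpoly_eq_det:
  "charpoly M = det (mat [:0, 1:] - map_matrix (\<lambda>c. [:c:]) M)"
  unfolding charpoly_def by (rule arg_cong[where f=det]) (simp add: vec_eq_iff mat_def)

text \<open>Conjugation by the orthogonal matrix \<open>Q\<close> with rows \<open>e i\<close> makes
  \<open>transpose M ** M\<close> diagonal. It is carried out over the polynomials, where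
  \<open>?X\<close> commutes with \<open>?c Q\<close> and the determinants of \<open>?c Q\<close>
  and its transpose cancel.\<close>

lemma charpoly_gram:
  fixes M :: "real ^ 'n ^ 'n" and e :: "'n \<Rightarrow> real ^ 'n"
  assumes e: "\<And>i j. e i \<bullet> e j = (if i = j then 1 else 0)"
    and Me: "\<And>i j. i \<noteq> j \<Longrightarrow> (M *v e i) \<bullet> (M *v e j) = 0"
  shows "charpoly (transpose M ** M) = (\<Prod>i\<in>UNIV. [:- (norm (M *v e i))\<^sup>2, 1:])"
proof -
  define Q :: "real ^ 'n ^ 'n" where "Q = (\<chi> i. e i)"
  let ?c = "map_matrix (\<lambda>c. [:c:]) :: real ^ 'n ^ 'n \<Rightarrow> _"
  let ?X = "mat [:0, 1:] :: real poly ^ 'n ^ 'n"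
  let ?A = "transpose M ** M"
  have QQ: "Q ** transpose Q = mat 1" unfolding Q_def by (rule rows_orthonormal[OF e])
  have c1: "?c (mat 1) = mat 1" by (simp add: vec_eq_iff mat_def one_pCons)
  have X: "?c Q ** ?X = ?X ** ?c Q"
    by (simp add: matrix_matrix_mult_def vec_eq_iff mat_def if_distrib if_distribR sum.delta cong: if_cong)
  have eq: "?c Q ** (?X - ?c ?A) ** ?c (transpose Q) = ?X - ?c (Q ** ?A ** transpose Q)"
  proof -
    have "?c Q ** (?X - ?c ?A) ** ?c (transpose Q)
       = ?c Q ** ?X ** ?c (transpose Q) - ?c Q ** ?c ?A ** ?c (transpose Q)"
      by (simp add: vec_eq_iff matrix_matrix_mult_def algebra_simps sum_subtractf)
    also have "?c Q ** ?X ** ?c (transpose Q) = ?X"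
      by (simp add: X matrix_mul_assoc[symmetric] map_matrix_const_poly_mult[symmetric] QQ c1)
    also have "?c Q ** ?c ?A ** ?c (transpose Q) = ?c (Q ** ?A ** transpose Q)"
      by (simp add: map_matrix_const_poly_mult)
    finally show ?thesis .
  qed
  have entry: "(Q ** ?A ** transpose Q) $ i $ j = (M *v e i) \<bullet> (M *v e j)" for i j
  proof -
    \<comment> \<open>Row \<open>i\<close> of \<open>Q ** transpose M\<close> is the image of
      \<open>e i\<close>; multiplied by its own transpose, the matrix collects the inner products of
      the images.\<close>
    have "Q ** ?A ** transpose Q = (Q ** transpose M) ** transpose (Q ** transpose M)"
      by (simp add: matrix_transpose_mul matrix_mul_assoc)
    moreover have "(Q ** transpose M) $ i $ k = (M *v e i) $ k" for i k
      by (simp add: Q_def matrix_matrix_mult_def transpose_def matrix_vector_mult_def mult.commute)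
    ultimately show ?thesis
      by (subst (asm) matrix_matrix_mult_def[of "Q ** transpose M" "transpose (Q ** transpose M)"])
        (simp add: transpose_def[of "Q ** transpose M"] inner_vec_def)
  qed
  have "det (?c Q) * det (?c (transpose Q)) = 1"
    by (simp add: det_mul[symmetric] map_matrix_const_poly_mult[symmetric] QQ c1)
  then have "charpoly ?A = det (?X - ?c (Q ** ?A ** transpose Q))"
    by (simp add: charpoly_eq_det eq[symmetric] det_mul algebra_simps)
  also have "\<dots> = (\<Prod>i\<in>UNIV. (?X - ?c (Q ** ?A ** transpose Q)) $ i $ i)"
    by (rule det_diagonal) (auto simp: entry Me mat_def)
  also have "\<dots> = (\<Prod>i\<in>UNIV. [:- (norm (M *v e i))\<^sup>2, 1:])"
    by (simp add: entry mat_def power2_norm_eq_inner)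
  finally show ?thesis .
qed

lemma singular_values_eq:
  fixes M :: "real ^ 'n ^ 'n" and e :: "'n \<Rightarrow> real ^ 'n"
  assumes e: "\<And>i j. e i \<bullet> e j = (if i = j then 1 else 0)"
    and Me: "\<And>i j. i \<noteq> j \<Longrightarrow> (M *v e i) \<bullet> (M *v e j) = 0"
  shows "singular_values M =
    rev (sorted_list_of_multiset (image_mset (\<lambda>i. norm (M *v e i)) (mset_set UNIV)))"
proof -
  have "proots (charpoly (transpose M ** M)) = (\<Sum>i\<in>UNIV. {#(norm (M *v e i))\<^sup>2#})"
    by (simp add: charpoly_gram[OF e Me] proots_prod)
  also have "\<dots> = image_mset (\<lambda>i. (norm (M *v e i))\<^sup>2) (mset_set UNIV)"
    by (simp add: sum_unfold_sum_mset)
  finally show ?thesis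
    by (simp add: singular_values_def image_mset.compositionality o_def)
qed

subsection \<open>Lebesgue measure under linear maps\<close>

text \<open>The change of variables formula of HOL-Analysis is stated for index types of class
  \<open>wellorder\<close>. The following copy of an arbitrary finite type has such an order.\<close>

typedef (overloaded) 'a idx = "{..<CARD('a::finite)}"
  by (intro exI[of _ 0]) auto

setup_lifting type_definition_idx

instantiation idx :: (finite) wellorder
begin

lift_definition less_eq_idx :: "'a idx \<Rightarrow> 'a idx \<Rightarrow> bool" is "(\<le>)" .

lift_definition less_idx :: "'a idx \<Rightarrow> 'a idx \<Rightarrow> bool" is "(<)" .

instance
proof
  fix Q :: "'a idx \<Rightarrow> bool" and a :: "'a idx"
  assume *: "\<And>x. (\<And>y. y < x \<Longrightarrow> Q y) \<Longrightarrow> Q x"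
  show "Q a"
    by (rule measure_induct_rule[of Rep_idx]) (auto intro: * simp: less_idx.rep_eq)
qed (transfer; force)+

end

instance idx :: (finite) finite
  by standard (metis (mono_tags) type_definition.univ[OF type_definition_idx] finite_imageI finite_lessThan)

lemma card_idx: "CARD('a idx) = CARD('a::finite)"
  by (metis card_lessThan type_definition.card[OF type_definition_idx])

section \<open>Boxes under permutation and scaling of coordinates\<close>

lemma Basis_cart: "(Basis :: (real ^ 'n) set) = range (\<lambda>i. axis i 1)"
  by (auto simp: Basis_vec_def)

lemma inj_axis_1: "inj (\<lambda>i. axis i 1 :: real ^ 'n)"
  by (simp add: inj_def axis_eq_axis)

lemma sum_Basis_cart: "(\<Sum>b\<in>Basis. g b) = (\<Sum>i\<in>UNIV. g (axis i 1 :: real ^ 'n))"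
  by (simp add: Basis_cart sum.reindex[OF inj_axis_1] o_def)

lemma prod_Basis_cart: "(\<Prod>b\<in>Basis. g b) = (\<Prod>i\<in>UNIV. g (axis i 1 :: real ^ 'n))"
  by (simp add: Basis_cart prod.reindex[OF inj_axis_1] o_def)

lemma emeasure_lborel_box_cart:
  fixes l u :: "real ^ 'n"
  assumes "\<And>i. l $ i \<le> u $ i"
  shows "emeasure lborel (box l u) = ennreal (\<Prod>i\<in>UNIV. u $ i - l $ i)"
proof -
  have "emeasure lborel (box l u) = ennreal (\<Prod>b\<in>Basis. (u - l) \<bullet> b)"
    using assms by (intro emeasure_lborel_box) (auto simp: Basis_cart inner_axis)
  also have "(\<Prod>b\<in>Basis. (u - l) \<bullet> b) = (\<Prod>i\<in>UNIV. u $ i - l $ i)"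
    by (simp add: prod_Basis_cart inner_axis)
  finally show ?thesis .
qed

text \<open>Carries Lebesgue measure between \<open>'n\<close> and its ordered copy
  \<open>'n idx\<close>: the preimage of a box is the box with permuted sides.\<close>

lemma distr_lborel_reindex:
  fixes \<pi> :: "'b::finite \<Rightarrow> 'a::finite"
  assumes \<pi>: "bij \<pi>"
  shows "distr lborel borel (\<lambda>x::real ^ 'a. \<chi> i::'b. x $ \<pi> i) = lborel"
proof (rule lborel_eqI[symmetric])
  let ?R = "\<lambda>x::real ^ 'a. \<chi> i::'b. x $ \<pi> i"
  have [measurable]: "?R \<in> borel_measurable borel"
    by (intro borel_measurable_continuous_onI continuous_intros)
  fix l u :: "real ^ 'b"
  assume le: "\<And>b. b \<in> Basis \<Longrightarrow> l \<bullet> b \<le> u \<bullet> b"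
  have le': "l $ i \<le> u $ i" for i using le[of "axis i 1"] by (simp add: inner_axis Basis_cart)
  let ?l = "\<chi> i. l $ inv \<pi> i" and ?u = "\<chi> i. u $ inv \<pi> i"
  have "?R -` box l u = box ?l ?u"
    using \<pi> by (auto simp: mem_box_cart bij_is_inj bij_is_surj surj_f_inv_f)
      (metis \<pi> bij_inv_eq_iff)+
  then have "emeasure (distr lborel borel ?R) (box l u) = emeasure lborel (box ?l ?u)"
    by (simp add: emeasure_distr)
  also have "\<dots> = ennreal (\<Prod>i\<in>UNIV. u $ inv \<pi> i - l $ inv \<pi> i)"
    using le' by (subst emeasure_lborel_box_cart) auto
  also have "(\<Prod>i\<in>UNIV. u $ inv \<pi> i - l $ inv \<pi> i) = (\<Prod>i\<in>UNIV. u $ i - l $ i)"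
    using prod.reindex_bij_betw[OF bij_imp_bij_inv[OF \<pi>], of "\<lambda>i. u $ i - l $ i"] by simp
  also have "\<dots> = (\<Prod>b\<in>Basis. (u - l) \<bullet> b)"
    by (simp add: prod_Basis_cart inner_axis)
  finally show "emeasure (distr lborel borel ?R) (box l u) = ennreal (\<Prod>b\<in>Basis. (u - l) \<bullet> b)" .
qed simp

lemma distr_lborel_orthogonal_wellorder:
  fixes f :: "real ^ 'n::{finite,wellorder} \<Rightarrow> real ^ 'n::_"
  assumes f: "orthogonal_transformation f"
  shows "distr lborel borel f = lborel"
proof (rule lborel_eqI[symmetric])
  obtain g where g: "orthogonal_transformation g" "\<And>x. f (g x) = x" "\<And>x. g (f x) = x"
    using f by (metis orthogonal_transformation_inv orthogonal_transformation_surj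
      orthogonal_transformation_inj inv_f_f surj_f_inv_f)
  have [measurable]: "f \<in> borel_measurable borel"
    using f by (intro borel_measurable_continuous_onI linear_continuous_on)
      (simp add: orthogonal_transformation_linear linear_conv_bounded_linear[symmetric])
  fix l u :: "real ^ 'n::_"
  assume le: "\<And>b. b \<in> Basis \<Longrightarrow> l \<bullet> b \<le> u \<bullet> b"
  \<comment> \<open>\<open>measure_orthogonal_image\<close> speaks of images, so the preimage under
    \<open>f\<close> becomes an image under the inverse \<open>g\<close>.\<close>
  have im: "f -` box l u = g ` box l u"
  proof (intro set_eqI iffI)
    show "x \<in> g ` box l u" if "x \<in> f -` box l u" for x
      using that g(3)[of x] by (intro image_eqI[of _ g "f x"]) auto
    show "x \<in> f -` box l u" if "x \<in> g ` box l u" for x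
      using that g(2) by auto
  qed
  have m: "f -` box l u \<in> sets borel" by (rule measurable_sets_borel) measurable
  have "emeasure (distr lborel borel f) (box l u) = emeasure lborel (g ` box l u)"
    by (simp add: emeasure_distr im)
  also have "\<dots> = emeasure lebesgue (g ` box l u)"
    using m im by (simp add: main_part_sets)
  also have "\<dots> = ennreal (measure lebesgue (g ` box l u))"
    using measurable_orthogonal_image[OF g(1), of "box l u"] by (simp add: emeasure_eq_measure2)
  also have "\<dots> = measure lebesgue (box l u)"
    by (subst measure_orthogonal_image[OF g(1)]) auto
  also have "\<dots> = ennreal (\<Prod>b\<in>Basis. (u - l) \<bullet> b)"
    using le by simp
  finally show "emeasure (distr lborel borel f) (box l u) = ennreal (\<Prod>b\<in>Basis. (u - l) \<bullet> b)" .
qed simp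

lemma distr_lborel_orthogonal:
  fixes f :: "real ^ 'n \<Rightarrow> real ^ 'n"
  assumes f: "orthogonal_transformation f"
  shows "distr lborel borel f = lborel"
proof -
  obtain \<pi> :: "'n idx \<Rightarrow> 'n" where \<pi>: "bij \<pi>"
    using finite_same_card_bij[of "UNIV :: 'n idx set" "UNIV :: 'n set"] by (auto simp: card_idx)
  let ?R = "\<lambda>x::real ^ 'n. \<chi> i::'n idx. x $ \<pi> i"
  let ?S = "\<lambda>x::real ^ 'n idx. \<chi> i. x $ inv \<pi> i"
  have RS: "?R (?S x) = x" for x using \<pi> by (simp add: vec_eq_iff bij_is_inj)
  have SR: "?S (?R x) = x" for x using \<pi> by (simp add: vec_eq_iff bij_is_surj surj_f_inv_f)
  have inner: "?S x \<bullet> ?S y = x \<bullet> y" for x y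
    using sum.reindex_bij_betw[OF bij_imp_bij_inv[OF \<pi>], of "\<lambda>i. x $ i * y $ i"] by (simp add: inner_vec_def)
  have inner': "?R x \<bullet> ?R y = x \<bullet> y" for x y using inner[of "?R x" "?R y"] by (simp only: SR)
  have lin: "linear ?R" "linear ?S" by (auto intro!: linearI simp: vec_eq_iff)
  have [measurable]: "f \<in> borel_measurable borel" "?R \<in> borel_measurable borel" "?S \<in> borel_measurable borel"
    using f lin by (auto intro!: borel_measurable_continuous_onI linear_continuous_on
      simp: orthogonal_transformation_linear linear_conv_bounded_linear[symmetric])
  have "orthogonal_transformation (?R \<circ> f \<circ> ?S)"
    using f lin inner inner' unfolding orthogonal_transformation_def
    by (auto intro!: linear_compose)
  then have "lborel = distr lborel borel (?R \<circ> f \<circ> ?S)"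
    by (simp add: distr_lborel_orthogonal_wellorder)
  also have "\<dots> = distr (distr (distr lborel borel ?S) borel f) borel ?R"
    by (simp add: distr_distr o_def)
  also have "distr lborel borel ?S = lborel"
    by (rule distr_lborel_reindex[OF bij_imp_bij_inv[OF \<pi>]])
  \<comment> \<open>At this point \<open>lborel\<close> on the copied index type is the image of
    \<open>lborel\<close> under \<open>f\<close> followed by \<open>?R\<close>. Pushing forward by
    \<open>?S\<close>, the inverse of \<open>?R\<close>, isolates \<open>f\<close>.\<close>
  finally have "distr lborel borel ?S = distr (distr (distr lborel borel f) borel ?R) borel ?S"
    by simp
  also have "\<dots> = distr lborel borel f"
    by (simp add: distr_distr o_def bij_is_surj[OF \<pi>] surj_f_inv_f)
  also have "distr lborel borel ?S = lborel"
    by (rule distr_lborel_reindex[OF bij_imp_bij_inv[OF \<pi>]])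
  finally show ?thesis by simp
qed

lemma distr_lborel_orthogonal_matrix:
  fixes Q :: "real ^ 'n ^ 'n"
  assumes "orthogonal_matrix Q"
  shows "distr lborel borel ((*v) Q) = lborel"
  using assms by (intro distr_lborel_orthogonal) (simp add: orthogonal_transformation_matrix)

lemma nn_integral_lborel_scale_cart:
  fixes a :: "'n::finite \<Rightarrow> real"
  assumes a: "\<And>i. 0 < a i" and [measurable]: "f \<in> borel_measurable borel"
  shows "(\<integral>\<^sup>+x. f x \<partial>lborel) = ennreal (\<Prod>i\<in>UNIV. a i) * (\<integral>\<^sup>+x. f (\<chi> i. a i * x $ i) \<partial>lborel)"
proof -
  \<comment> \<open>\<open>lborel_affine_euclidean\<close> wants a factor for each basis vector;
    \<open>c\<close> recovers \<open>a i\<close> from \<open>axis i 1\<close>.\<close>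
  define c where "c b = (\<Sum>i\<in>UNIV. a i * b $ i)" for b :: "real ^ 'n"
  have c: "c (axis i 1) = a i" for i
    by (simp add: c_def axis_def if_distrib cong: if_cong)
  have "(\<Sum>j\<in>Basis. (c j * (x \<bullet> j)) *\<^sub>R j) = (\<chi> i. a i * x $ i)" for x
    by (simp add: sum_Basis_cart c inner_axis vec_eq_iff) (simp add: axis_def if_distrib cong: if_cong)
  moreover have "(\<Prod>j\<in>Basis. \<bar>c j\<bar>) = (\<Prod>i\<in>UNIV. a i)"
    using a by (simp add: prod_Basis_cart c less_imp_le)
  moreover have "c j \<noteq> 0" if "j \<in> Basis" for j
    using that a by (auto simp: Basis_cart c) (metis less_irrefl)
  ultimately have eq: "(lborel :: (real ^ 'n) measure) =
      density (distr lborel borel (\<lambda>x. \<chi> i. a i * x $ i)) (\<lambda>_. ennreal (\<Prod>i\<in>UNIV. a i))"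
    using lborel_affine_euclidean[of c "0 :: real ^ 'n"] by simp
  have [measurable]: "(\<lambda>x::real^'n. \<chi> i. a i * x $ i) \<in> borel_measurable borel"
    by (intro borel_measurable_continuous_onI continuous_intros)
  show ?thesis
    by (subst eq) (simp add: nn_integral_density nn_integral_distr nn_integral_cmult)
qed

text \<open>Singular value decomposition: the rows of \<open>R\<close> are right singular vectors,
  and the columns of \<open>Q\<close> are their normalised images.\<close>

lemma matrix_times_orthonormal_rows:
  fixes M :: "real ^ 'n ^ 'n" and e :: "'n \<Rightarrow> real ^ 'n"
  assumes e: "\<And>i j. e i \<bullet> e j = (if i = j then 1 else 0)"
    and Me: "\<And>i j. i \<noteq> j \<Longrightarrow> (M *v e i) \<bullet> (M *v e j) = 0"
    and pos: "\<And>i. M *v e i \<noteq> 0"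
  obtains Q R :: "real ^ 'n ^ 'n" where "orthogonal_matrix Q" "orthogonal_matrix R"
    "M = Q ** (\<chi> i j. if i = j then norm (M *v e i) else 0) ** R"
proof -
  define R :: "real ^ 'n ^ 'n" where "R = (\<chi> i. e i)"
  define Q :: "real ^ 'n ^ 'n" where "Q = transpose (\<chi> i. (M *v e i) /\<^sub>R norm (M *v e i))"
  let ?D = "(\<chi> i j. if i = j then norm (M *v e i) else 0) :: real ^ 'n ^ 'n"
  have R: "R ** transpose R = mat 1" unfolding R_def by (rule rows_orthonormal[OF e])
  then have oR: "orthogonal_matrix R"
    by (metis orthogonal_matrix_def matrix_left_right_inverse)
  have "transpose Q ** transpose (transpose Q) = mat 1"
    unfolding Q_def transpose_transpose
  proof (rule rows_orthonormal)
    show "(M *v e i /\<^sub>R norm (M *v e i)) \<bullet> (M *v e j /\<^sub>R norm (M *v e j)) = (if i = j then 1 else 0)" for i j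
      using Me[of i j] pos[of i] by (auto simp: dot_square_norm power2_eq_square field_simps)
  qed
  then have oQ: "orthogonal_matrix Q"
    by (simp add: orthogonal_matrix)
  have "M ** transpose R = Q ** ?D"
  proof -
    have "(M ** transpose R) $ i $ j = (M *v e j) $ i" for i j
      by (simp add: R_def matrix_matrix_mult_def transpose_def matrix_vector_mult_def)
    moreover have "(Q ** ?D) $ i $ j = (M *v e j) $ i" for i j
      using pos[of j] by (simp add: Q_def matrix_matrix_mult_def transpose_def if_distrib cong: if_cong)
    ultimately show ?thesis by (simp add: vec_eq_iff)
  qed
  then have "M = Q ** ?D ** R"
    using oR by (metis matrix_mul_assoc matrix_mul_rid orthogonal_matrix_def)
  then show ?thesis using oQ oR by (intro that)
qed

lemma borel_measurable_matrix_vector_mult [measurable]: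
  "(*v) (M :: real ^ 'n ^ 'm) \<in> borel_measurable borel"
  by (intro borel_measurable_continuous_onI linear_continuous_on) (simp add: linear_conv_bounded_linear[symmetric])

text \<open>The orthogonal factors of the singular value decomposition preserve
  \<open>lborel\<close>; the diagonal factor contributes the product of the singular values, which
  is the absolute determinant.\<close>

lemma nn_integral_lborel_matrix:
  fixes M :: "real ^ 'n ^ 'n"
  assumes M: "invertible M" and [measurable]: "f \<in> borel_measurable borel"
  shows "(\<integral>\<^sup>+x. f x \<partial>lborel) = ennreal \<bar>det M\<bar> * (\<integral>\<^sup>+x. f (M *v x) \<partial>lborel)"
proof -
  obtain e :: "'n \<Rightarrow> real ^ 'n" where e: "\<And>i j. e i \<bullet> e j = (if i = j then 1 else 0)"
      "\<And>i j. i \<noteq> j \<Longrightarrow> (M *v e i) \<bullet> (M *v e j) = 0"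
    by (rule orthonormal_basis_orthogonal_images[of M]) blast
  have pos: "M *v e i \<noteq> 0" for i
    using M e(1)[of i i] by (metis inner_zero_left invertible_def matrix_vector_mul_assoc
      matrix_vector_mul_lid matrix_vector_mult_0_right zero_neq_one)
  define a where "a i = norm (M *v e i)" for i
  have a: "0 < a i" for i using pos by (simp add: a_def)
  define D :: "real ^ 'n ^ 'n" where "D = (\<chi> i j. if i = j then a i else 0)"
  obtain Q R where QR: "orthogonal_matrix Q" "orthogonal_matrix R" "M = Q ** D ** R"
    unfolding D_def a_def by (rule matrix_times_orthonormal_rows[OF e pos])
  have D: "D *v x = (\<chi> i. a i * x $ i)" for x
    by (simp add: D_def matrix_vector_mult_def vec_eq_iff if_distrib if_distribR cong: if_cong)
  have "det D = (\<Prod>i\<in>UNIV. a i)" by (subst det_diagonal) (auto simp: D_def)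
  moreover have "\<bar>det Q\<bar> = 1" "\<bar>det R\<bar> = 1"
    using det_orthogonal_matrix QR by fastforce+
  ultimately have det: "\<bar>det M\<bar> = (\<Prod>i\<in>UNIV. a i)"
    using a by (simp add: QR(3) det_mul abs_mult prod_nonneg less_imp_le)
  have "(\<integral>\<^sup>+x. f x \<partial>lborel) = (\<integral>\<^sup>+x. f (Q *v x) \<partial>lborel)"
    by (subst distr_lborel_orthogonal_matrix[OF QR(1), symmetric]) (simp add: nn_integral_distr)
  also have "\<dots> = ennreal (\<Prod>i\<in>UNIV. a i) * (\<integral>\<^sup>+x. f (Q *v (D *v x)) \<partial>lborel)"
    by (subst nn_integral_lborel_scale_cart[OF a]) (auto simp: D)
  also have "(\<integral>\<^sup>+x. f (Q *v (D *v x)) \<partial>lborel) = (\<integral>\<^sup>+x. f (Q *v (D *v (R *v x))) \<partial>lborel)"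
    by (subst distr_lborel_orthogonal_matrix[OF QR(2), symmetric]) (simp add: nn_integral_distr)
  also have "(\<lambda>x. Q *v (D *v (R *v x))) = (*v) M"
    by (intro ext) (simp add: QR(3) matrix_vector_mul_assoc matrix_mul_assoc)
  finally show ?thesis by (simp only: det)
qed

subsection \<open>Volumes of flattened balls\<close>

text \<open>Up to constants, an ellipsoid with semi-axes min(1, r / \<alpha>_i), where the
  \<alpha>_i are the singular values of \<open>M\<close>. In this form, differences of two of its
  points are controlled by the triangle inequality alone.\<close>

definition flat_set :: "real ^ 'n ^ 'n \<Rightarrow> real \<Rightarrow> (real ^ 'n) set" where
  "flat_set M r = {z. norm z \<le> 1 \<and> norm (M *v z) \<le> r}"

definition flat_vol :: "real ^ 'n ^ 'n \<Rightarrow> real \<Rightarrow> real" where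
  "flat_vol M r = measure lborel (flat_set M r)"

lemma flat_set_borel [measurable]: "flat_set M r \<in> sets borel"
  unfolding flat_set_def by measurable

lemma emeasure_flat_set: "emeasure lborel (flat_set M r) = ennreal (flat_vol M r)"
proof -
  have "bounded (flat_set M r)" unfolding flat_set_def bounded_iff by auto
  then show ?thesis unfolding flat_vol_def
    by (intro emeasure_eq_ennreal_measure) (use emeasure_bounded_finite in force)
qed

lemma flat_vol_nonneg [simp]: "0 \<le> flat_vol M r"
  by (simp add: flat_vol_def)

lemma flat_vol_le_ball: "flat_vol M r \<le> measure lborel (cball (0 :: real ^ 'n) 1)"
  for M :: "real ^ 'n ^ 'n"
proof -
  have "emeasure lborel (flat_set M r) \<le> emeasure lborel (cball (0 :: real ^ 'n) 1)"
    by (intro emeasure_mono) (auto simp: flat_set_def)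
  also have "\<dots> = ennreal (measure lborel (cball (0 :: real ^ 'n) 1))"
    by (intro emeasure_eq_ennreal_measure) (use emeasure_bounded_finite[of "cball (0 :: real ^ 'n) 1"] in force)
  finally show ?thesis by (simp add: emeasure_flat_set)
qed

lemma emeasure_cbox_cart_sym:
  fixes b :: "'n::finite \<Rightarrow> real"
  assumes "\<And>i. 0 \<le> b i"
  shows "emeasure lborel (cbox (\<chi> i. - b i) (\<chi> i. b i)) = ennreal (2 ^ CARD('n) * (\<Prod>i\<in>UNIV. b i))"
proof -
  have "emeasure lborel (cbox (\<chi> i. - b i) (\<chi> i. b i)) = ennreal (\<Prod>i\<in>UNIV. 2 * b i)"
    using assms by (subst emeasure_lborel_cbox; simp add: prod_Basis_cart) (auto simp: Basis_cart inner_axis)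
  then show ?thesis by (simp add: prod.distrib)
qed

text \<open>In singular coordinates the set lies between two boxes, with half-sides
  \<open>b i / s\<close> and \<open>b i\<close>. The loss \<open>s = sqrt n\<close> is the ratio
  between the Euclidean norm and the largest coordinate, and explains the two constants.\<close>

lemma flat_vol_bounds_axes:
  fixes M :: "real ^ 'n ^ 'n" and e :: "'n \<Rightarrow> real ^ 'n"
  assumes e: "\<And>i j. e i \<bullet> e j = (if i = j then 1 else 0)"
    and Me: "\<And>i j. i \<noteq> j \<Longrightarrow> (M *v e i) \<bullet> (M *v e j) = 0"
    and pos: "\<And>i. M *v e i \<noteq> 0" and r: "0 < r"
  defines "p \<equiv> (\<Prod>i\<in>UNIV. min 1 (r / norm (M *v e i)))"
  shows "flat_vol M r \<le> 2 ^ CARD('n) * p"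
    and "(2 / sqrt CARD('n)) ^ CARD('n) * p \<le> flat_vol M r"
proof -
  define a where "a i = norm (M *v e i)" for i
  have a: "0 < a i" for i using pos by (simp add: a_def)
  define D :: "real ^ 'n ^ 'n" where "D = (\<chi> i j. if i = j then a i else 0)"
  obtain Q R where QR: "orthogonal_matrix Q" "orthogonal_matrix R" "M = Q ** D ** R"
    unfolding D_def a_def by (rule matrix_times_orthonormal_rows[OF e Me pos])
  have D: "D *v x = (\<chi> i. a i * x $ i)" for x
    by (simp add: D_def matrix_vector_mult_def vec_eq_iff if_distrib if_distribR cong: if_cong)
  have norm_orth: "norm (T *v x) = norm x" if "orthogonal_matrix T" for T :: "real ^ 'n ^ 'n" and x
    using that orthogonal_transformation_norm[of "(*v) T"] by (simp add: orthogonal_transformation_matrix)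
  define T where "T = {y. norm y \<le> 1 \<and> norm (D *v y) \<le> r}"
  have [measurable]: "T \<in> sets borel" unfolding T_def by measurable
  have "emeasure lborel T = emeasure (distr lborel borel ((*v) R)) T"
    by (simp add: distr_lborel_orthogonal_matrix[OF QR(2)])
  also have "\<dots> = emeasure lborel ((*v) R -` T)" by (simp add: emeasure_distr)
  also have "(*v) R -` T = flat_set M r"
    by (auto simp: T_def flat_set_def QR(3) matrix_vector_mul_assoc[symmetric] norm_orth QR(1,2))
  finally have T: "emeasure lborel T = ennreal (flat_vol M r)" by (simp add: emeasure_flat_set)
  define b where "b i = min 1 (r / a i)" for i
  have b: "0 \<le> b i" "b i \<le> 1" "a i * b i \<le> r" for i
    using a[of i] r by (auto simp: b_def min_def field_simps)
  have p: "p = (\<Prod>i\<in>UNIV. b i)" by (simp add: p_def b_def a_def)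
  have p0: "0 \<le> p" unfolding p using b by (intro prod_nonneg) auto
  have "T \<subseteq> cbox (\<chi> i. - b i) (\<chi> i. b i)"
  proof
    fix y assume y: "y \<in> T"
    have "\<bar>y $ i\<bar> \<le> b i" for i
    proof -
      have "\<bar>y $ i\<bar> \<le> 1" using y component_le_norm_cart[of y i] by (auto simp: T_def)
      moreover have "\<bar>a i * y $ i\<bar> \<le> r"
        using y component_le_norm_cart[of "D *v y" i] by (auto simp: T_def D)
      ultimately show ?thesis using a[of i] by (simp add: b_def abs_mult field_simps)
    qed
    then show "y \<in> cbox (\<chi> i. - b i) (\<chi> i. b i)" by (auto simp: mem_box_cart abs_le_iff) (metis minus_le_iff)
  qed
  then have "emeasure lborel T \<le> ennreal (2 ^ CARD('n) * p)"
    using emeasure_cbox_cart_sym[of b] b by (metis emeasure_mono p cbox_borel sets_lborel)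
  then show "flat_vol M r \<le> 2 ^ CARD('n) * p"
    using p0 by (simp add: T)
  define s where "s = sqrt CARD('n)"
  have s: "s > 0" "s\<^sup>2 = CARD('n)" by (simp_all add: s_def)
  have norm_le: "norm y \<le> t" if "\<And>i. \<bar>y $ i\<bar> \<le> t / s" "0 \<le> t" for y :: "real ^ 'n" and t
  proof -
    have "(y $ i)\<^sup>2 \<le> (t / s)\<^sup>2" for i
      using that(1)[of i] by (metis abs_ge_zero power2_abs power_mono)
    then have "(\<Sum>i\<in>UNIV. (y $ i)\<^sup>2) \<le> (\<Sum>i\<in>(UNIV :: 'n set). (t / s)\<^sup>2)" by (intro sum_mono) auto
    also have "\<dots> = t\<^sup>2" using s by (simp add: power_divide)
    finally have "(norm y)\<^sup>2 \<le> t\<^sup>2" by (simp add: norm_vec_def L2_set_def sum_nonneg)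
    then show ?thesis using that(2) by (simp add: power2_le_iff_abs_le)
  qed
  have "cbox (\<chi> i. - (b i / s)) (\<chi> i. b i / s) \<subseteq> T"
  proof
    fix y assume "y \<in> cbox (\<chi> i. - (b i / s)) (\<chi> i. b i / s)"
    then have y: "\<bar>y $ i\<bar> \<le> b i / s" for i by (simp add: mem_box_cart abs_le_iff minus_le_iff)
    have "b i / s \<le> 1 / s" for i using b(2)[of i] s by (simp add: divide_right_mono)
    then have "norm y \<le> 1"
      by (intro norm_le) (use y in \<open>auto intro: order.trans\<close>)
    moreover have "norm (D *v y) \<le> r"
    proof (rule norm_le)
      show "\<bar>(D *v y) $ i\<bar> \<le> r / s" for i
      proof -
        have "\<bar>(D *v y) $ i\<bar> = a i * \<bar>y $ i\<bar>" using a[of i] by (simp add: D abs_mult)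
        also have "\<dots> \<le> a i * (b i / s)" using a[of i] y by (intro mult_left_mono) auto
        also have "\<dots> \<le> r / s" using b(3)[of i] s by (simp add: divide_right_mono)
        finally show ?thesis .
      qed
    qed (use r in auto)
    ultimately show "y \<in> T" by (simp add: T_def)
  qed
  then have "ennreal (2 ^ CARD('n) * (\<Prod>i\<in>UNIV. b i / s)) \<le> emeasure lborel T"
    using emeasure_cbox_cart_sym[of "\<lambda>i. b i / s"] b s
    by (metis (no_types, lifting) emeasure_mono divide_nonneg_pos \<open>T \<in> sets borel\<close> sets_lborel)
  then have "2 ^ CARD('n) * (\<Prod>i\<in>UNIV. b i / s) \<le> flat_vol M r"
    by (simp add: T)
  then show "(2 / sqrt CARD('n)) ^ CARD('n) * p \<le> flat_vol M r"
    by (simp add: prod_dividef p s_def power_divide)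
qed

lemma singular_values_decreasing:
  assumes "i \<le> j" "j < length (singular_values M)"
  shows "singular_values M ! j \<le> singular_values M ! i"
proof -
  define S where "S = sorted_list_of_multiset (image_mset sqrt (proots (charpoly (transpose M ** M))))"
  have "sorted S" by (simp add: S_def)
  moreover have "singular_values M = rev S" by (simp add: singular_values_def S_def)
  ultimately show ?thesis using assms
    by (auto simp: rev_nth intro!: sorted_nth_mono)
qed

text \<open>The product in the volume bounds depends only on the multiset of values, so it can be
  moved from the basis \<open>e\<close> to the sorted list.\<close>

lemma singular_values_invertible:
  fixes M :: "real ^ 'n ^ 'n"
  assumes M: "invertible M"
  shows length_singular_values: "length (singular_values M) = CARD('n)"
    and singular_values_pos: "k < CARD('n) \<Longrightarrow> 0 < singular_values M ! k"
    and flat_vol_le_singular: "0 < r \<Longrightarrow> flat_vol M r \<le> 2 ^ CARD('n) * (\<Prod>k<CARD('n). min 1 (r / singular_values M ! k))"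
    and flat_vol_ge_singular: "0 < r \<Longrightarrow> (2 / sqrt CARD('n)) ^ CARD('n) * (\<Prod>k<CARD('n). min 1 (r / singular_values M ! k)) \<le> flat_vol M r"
proof -
  obtain e :: "'n \<Rightarrow> real ^ 'n" where e: "\<And>i j. e i \<bullet> e j = (if i = j then 1 else 0)"
      "\<And>i j. i \<noteq> j \<Longrightarrow> (M *v e i) \<bullet> (M *v e j) = 0"
    by (rule orthonormal_basis_orthogonal_images[of M]) blast
  have pos: "M *v e i \<noteq> 0" for i
    using M e(1)[of i i] by (metis inner_zero_left invertible_def matrix_vector_mul_assoc
      matrix_vector_mul_lid matrix_vector_mult_0_right zero_neq_one)
  define A where "A = image_mset (\<lambda>i. norm (M *v e i)) (mset_set UNIV)"
  have L: "singular_values M = rev (sorted_list_of_multiset A)"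
    unfolding A_def by (rule singular_values_eq[OF e])
  have mL: "mset (singular_values M) = A" by (simp add: L)
  show len: "length (singular_values M) = CARD('n)"
    by (metis A_def mL size_mset size_image_mset size_mset_set)
  have "set (singular_values M) = range (\<lambda>i. norm (M *v e i))"
    by (metis A_def mL set_mset_mset set_image_mset finite_set_mset_mset_set finite)
  then show "0 < singular_values M ! k" if "k < CARD('n)"
    using nth_mem[of k "singular_values M"] that len pos by auto
  have "(\<Prod>k<CARD('n). g (singular_values M ! k)) = (\<Prod>i\<in>UNIV. g (norm (M *v e i)))" for g :: "real \<Rightarrow> real"
  proof -
    have "(\<Prod>k<CARD('n). g (singular_values M ! k)) = prod_list (map g (singular_values M))"
      by (simp add: prod.list_conv_set_nth len atLeast0LessThan)
    also have "\<dots> = prod_mset (image_mset g A)"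
      by (metis mL mset_map prod_mset_prod_list)
    also have "\<dots> = (\<Prod>i\<in>UNIV. g (norm (M *v e i)))"
      by (simp add: A_def image_mset.compositionality o_def prod_unfold_prod_mset)
    finally show ?thesis .
  qed
  from this[of "\<lambda>x. min 1 (r / x)"] show
    "0 < r \<Longrightarrow> flat_vol M r \<le> 2 ^ CARD('n) * (\<Prod>k<CARD('n). min 1 (r / singular_values M ! k))"
    "0 < r \<Longrightarrow> (2 / sqrt CARD('n)) ^ CARD('n) * (\<Prod>k<CARD('n). min 1 (r / singular_values M ! k)) \<le> flat_vol M r"
    using flat_vol_bounds_axes[OF e pos] by simp_all
qed

lemma singular_value_function_pos:
  fixes M :: "real ^ 'n ^ 'n" and \<gamma> :: real
  assumes M: "invertible M" and \<gamma>: "0 < \<gamma>" "\<gamma> \<le> CARD('n)"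
  shows "0 < singular_value_function M \<gamma>"
proof -
  define j where "j = nat \<lceil>\<gamma>\<rceil>"
  have j: "1 \<le> j" "j \<le> CARD('n)" using \<gamma> by (auto simp: j_def le_nat_iff nat_le_iff ceiling_le_iff Suc_le_eq)
  have "0 < singular_values M ! (i - 1)" if "1 \<le> i" "i \<le> j" for i
    using that j by (intro singular_values_pos[OF M]) auto
  then show ?thesis using j unfolding singular_value_function_def Let_def j_def[symmetric]
    using less_imp_neq by (intro mult_pos_pos prod_pos) (auto, fastforce)
qed

text \<open>Write the volume as the product of the factors min(1, r / L k). The factors before
  position \<open>l\<close> are at most r / L k, those after it at most 1, and the factor at
  \<open>l\<close> is at most (r / L l)^(\<gamma> - l) because the exponent lies in (0, 1].
  Multiplied by the singular value function, these bounds leave exactly r^\<gamma>.\<close>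

lemma singular_value_function_flat_vol:
  fixes M :: "real ^ 'n ^ 'n" and \<gamma> :: real
  assumes M: "invertible M" and \<gamma>: "0 < \<gamma>" "\<gamma> \<le> CARD('n)"
  shows "0 < r \<Longrightarrow> singular_value_function M \<gamma> * flat_vol M r \<le> 2 ^ CARD('n) * r powr \<gamma>"
    and "\<exists>r>0. (2 / sqrt CARD('n)) ^ CARD('n) * r powr \<gamma> \<le> singular_value_function M \<gamma> * flat_vol M r"
proof -
  define L where "L k = singular_values M ! k" for k
  define j where "j = nat \<lceil>\<gamma>\<rceil>"
  have j: "1 \<le> j" "j \<le> CARD('n)" using \<gamma> by (auto simp: j_def le_nat_iff nat_le_iff ceiling_le_iff Suc_le_eq)
  have j\<gamma>: "real j - 1 < \<gamma>" "\<gamma> \<le> real j" using \<gamma> unfolding j_def by linarith+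
  \<comment> \<open>List positions start at 0, so \<alpha>_j is found at position
    \<open>l = j - 1\<close>.\<close>
  then obtain l where l: "j = Suc l" using j by (cases j) auto
  have Lpos: "0 < L k" if "k < CARD('n)" for k using singular_values_pos[OF M that] by (simp add: L_def)
  have Lmono: "L k \<le> L i" if "i \<le> k" "k < CARD('n)" for i k
    using singular_values_decreasing[of i k M] that by (simp add: L_def length_singular_values[OF M])
  have ln: "l < CARD('n)" using j l by simp
  have "(\<Prod>i = 1..<j. singular_values M ! (i - 1)) = (\<Prod>k<l. L k)"
    unfolding L_def l using prod.shift_bounds_Suc_ivl[of "\<lambda>i. singular_values M ! (i - 1)" 0 l]
    by (simp add: atLeast0LessThan)
  then have phi: "singular_value_function M \<gamma> = (\<Prod>k<l. L k) * L l powr (\<gamma> - real l)"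
    unfolding singular_value_function_def Let_def j_def[symmetric] by (simp add: l L_def)
  have split: "(\<Prod>k<CARD('n). g k) = (\<Prod>k<l. g k) * g l * (\<Prod>k\<in>{Suc l..<CARD('n)}. g k)" for g :: "nat \<Rightarrow> real"
  proof -
    have "{..<CARD('n)} = {..<l} \<union> {l} \<union> {Suc l..<CARD('n)}" using ln by auto
    moreover have "({..<l} \<union> {l}) \<inter> {Suc l..<CARD('n)} = {}" by auto
    ultimately show ?thesis by (simp only: prod.union_disjoint finite_lessThan finite_atLeastLessThan finite.intros finite_Un) simp
  qed
  have prodL: "(\<Prod>k<l. L k) * (\<Prod>k<l. r / L k) = r ^ l" for r
  proof -
    have "L k * (r / L k) = r" if "k \<in> {..<l}" for k using Lpos[of k] that ln by simp
    then show ?thesis by (simp add: prod.distrib[symmetric])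
  qed
  have combine: "r ^ l * r powr (\<gamma> - real l) = r powr \<gamma>" if "0 < r" for r :: real
    using that by (simp add: powr_realpow[symmetric] powr_add[symmetric])
  show "singular_value_function M \<gamma> * flat_vol M r \<le> 2 ^ CARD('n) * r powr \<gamma>" if r: "0 < r"
  proof -
    let ?g = "\<lambda>k. min 1 (r / L k)"
    have g0: "0 \<le> ?g k" if "k < CARD('n)" for k using r Lpos[OF that] by simp
    have "?g l \<le> (r / L l) powr (\<gamma> - real l)"
    proof (cases "r \<le> L l")
      case True
      then have "r / L l \<le> 1" using Lpos[OF ln] by simp
      have "(r / L l) powr 1 \<le> (r / L l) powr (\<gamma> - real l)"
        using j\<gamma> l \<open>r / L l \<le> 1\<close> r Lpos[OF ln] by (intro powr_mono') auto
      then show ?thesis using \<open>r / L l \<le> 1\<close> r Lpos[OF ln] by simp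
    next
      case False
      then have "1 \<le> (r / L l) powr (\<gamma> - real l)"
        using j\<gamma> l Lpos[OF ln] by (intro ge_one_powr_ge_zero) auto
      then show ?thesis by simp
    qed
    moreover have "(\<Prod>k<l. ?g k) \<le> (\<Prod>k<l. r / L k)"
      using g0 ln by (intro prod_mono) auto
    moreover have "(\<Prod>k\<in>{Suc l..<CARD('n)}. ?g k) \<le> 1"
      using g0 by (intro prod_le_1) auto
    moreover have "0 \<le> (\<Prod>k<l. r / L k)" "0 \<le> (\<Prod>k\<in>{Suc l..<CARD('n)}. ?g k)"
      using g0 ln r Lpos by (auto intro!: prod_nonneg divide_nonneg_pos)
    ultimately have "(\<Prod>k<CARD('n). ?g k) \<le> (\<Prod>k<l. r / L k) * (r / L l) powr (\<gamma> - real l) * 1"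
      unfolding split using g0 ln by (intro mult_mono mult_nonneg_nonneg) auto
    moreover have "flat_vol M r \<le> 2 ^ CARD('n) * (\<Prod>k<CARD('n). ?g k)"
      using flat_vol_le_singular[OF M r] by (simp add: L_def)
    ultimately have "flat_vol M r \<le> 2 ^ CARD('n) * ((\<Prod>k<l. r / L k) * (r / L l) powr (\<gamma> - real l))"
      by (smt (verit) mult_left_mono zero_le_power)
    then have "singular_value_function M \<gamma> * flat_vol M r \<le>
        singular_value_function M \<gamma> * (2 ^ CARD('n) * ((\<Prod>k<l. r / L k) * (r / L l) powr (\<gamma> - real l)))"
      using singular_value_function_pos[OF M \<gamma>] by (intro mult_left_mono) auto
    also have "\<dots> = 2 ^ CARD('n) * (((\<Prod>k<l. L k) * (\<Prod>k<l. r / L k)) * (L l powr (\<gamma> - real l) * (r / L l) powr (\<gamma> - real l)))"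
      by (simp add: phi)
    also have "L l powr (\<gamma> - real l) * (r / L l) powr (\<gamma> - real l) = r powr (\<gamma> - real l)"
      using Lpos[OF ln] r by (simp add: powr_divide)
    finally show ?thesis by (simp add: prodL combine[OF r])
  qed
  show "\<exists>r>0. (2 / sqrt CARD('n)) ^ CARD('n) * r powr \<gamma> \<le> singular_value_function M \<gamma> * flat_vol M r"
  proof (intro exI conjI)
    \<comment> \<open>As \<open>L\<close> is decreasing, the choice r = \<alpha>_j turns all three
      bounds on the factors into equalities.\<close>
    let ?r = "L l"
    show r: "0 < ?r" by (rule Lpos[OF ln])
    let ?g = "\<lambda>k. min 1 (?r / L k)"
    have "?g k = ?r / L k" if "k < l" for k
      using Lmono[of k l] ln that Lpos[of k] by (simp add: min_def)
    moreover have "?g l = 1" using r by simp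
    moreover have "?g k = 1" if "k \<in> {Suc l..<CARD('n)}" for k
      using Lmono[of l k] that Lpos[of k] by (simp add: min_def field_simps)
    ultimately have eq: "(\<Prod>k<CARD('n). ?g k) = (\<Prod>k<l. ?r / L k)"
      unfolding split by simp
    have "(2 / sqrt CARD('n)) ^ CARD('n) * ?r powr \<gamma> = singular_value_function M \<gamma> * ((2 / sqrt CARD('n)) ^ CARD('n) * (\<Prod>k<l. ?r / L k))"
      by (simp add: phi combine[OF r, symmetric] prodL[of ?r, symmetric])
    also have "\<dots> \<le> singular_value_function M \<gamma> * flat_vol M ?r"
      using flat_vol_ge_singular[OF M r] singular_value_function_pos[OF M \<gamma>] eq
      by (intro mult_left_mono) (auto simp: L_def)
    finally show "(2 / sqrt CARD('n)) ^ CARD('n) * ?r powr \<gamma> \<le> singular_value_function M \<gamma> * flat_vol M ?r" .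
  qed
qed

subsection \<open>Autocorrelation and submultiplicativity\<close>

lemma nn_integral_lborel_reflect:
  fixes f :: "'a::euclidean_space \<Rightarrow> ennreal"
  assumes [measurable]: "f \<in> borel_measurable borel"
  shows "(\<integral>\<^sup>+w. f (z - w) \<partial>lborel) = (\<integral>\<^sup>+w. f w \<partial>lborel)"
proof -
  have "(lborel :: 'a measure) = distr lborel borel (\<lambda>x. z - x)"
    using lborel_affine[of "-1" z] by (simp add: density_1)
  then have "(\<integral>\<^sup>+w. f w \<partial>lborel) = (\<integral>\<^sup>+w. f w \<partial>distr lborel borel (\<lambda>x. z - x))" by simp
  then show ?thesis by (simp add: nn_integral_distr)
qed

lemma nn_integral_lborel_translate:
  fixes f :: "'a::euclidean_space \<Rightarrow> ennreal"
  assumes [measurable]: "f \<in> borel_measurable borel"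
  shows "(\<integral>\<^sup>+w. f (w - z) \<partial>lborel) = (\<integral>\<^sup>+w. f w \<partial>lborel)"
proof -
  have "(\<integral>\<^sup>+w. f (w - z) \<partial>lborel) = (\<integral>\<^sup>+w. f (- (z - w)) \<partial>lborel)" by simp
  also have "\<dots> = (\<integral>\<^sup>+w. f (- w) \<partial>lborel)"
    by (rule nn_integral_lborel_reflect[of "\<lambda>w. f (- w)"]) measurable
  also have "\<dots> = (\<integral>\<^sup>+w. f w \<partial>lborel)"
    using nn_integral_lborel_reflect[of f 0] by simp
  finally show ?thesis .
qed

lemma two_mult_le_squares_ennreal: "2 * (x * y) \<le> x * x + y * (y :: ennreal)"
proof (cases "x = \<top> \<or> y = \<top>")
  case True
  then show ?thesis by (auto simp: ennreal_top_mult)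
next
  case False
  then obtain a b where "x = ennreal a" "y = ennreal b" "0 \<le> a" "0 \<le> b"
    by (metis ennreal_cases)
  moreover have "2 * (a * b) \<le> a * a + b * b"
    using sum_squares_bound[of a b] by (simp add: power2_eq_square)
  ultimately show ?thesis
    by (simp add: ennreal_mult[symmetric] ennreal_plus[symmetric] ennreal_numeral[symmetric] del: ennreal_plus ennreal_numeral)
qed

text \<open>Both sides are smoothed with the indicator of \<open>K\<close>; the rest is \<open>2 a b \<le> a\<^sup>2 + b\<^sup>2\<close>.\<close>

lemma autocorrelation_le:
  fixes g :: "'a \<Rightarrow> 'b::euclidean_space"
  assumes "finite_measure N" and [measurable]: "g \<in> borel_measurable N"
    and [measurable]: "D \<in> sets borel" "K \<in> sets borel" "E \<in> sets borel" "F \<in> sets borel"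
    and E: "\<And>d k l. d \<in> D \<Longrightarrow> k \<in> K \<Longrightarrow> l \<in> K \<Longrightarrow> d - k + l \<in> E"
    and F: "\<And>k l. k \<in> K \<Longrightarrow> l \<in> K \<Longrightarrow> k - l \<in> F"
    and K: "emeasure lborel K \<noteq> 0" "emeasure lborel K \<noteq> \<top>"
  shows "emeasure lborel K * (\<integral>\<^sup>+a. \<integral>\<^sup>+b. indicator D (g a - g b) \<partial>N \<partial>N) \<le>
    emeasure lborel E * (\<integral>\<^sup>+a. \<integral>\<^sup>+b. indicator F (g a - g b) \<partial>N \<partial>N)"
proof -
  interpret N: finite_measure N by fact
  interpret NL: pair_sigma_finite N "lborel :: 'b measure" ..
  let ?iK = "indicator K :: 'b \<Rightarrow> ennreal" and ?iE = "indicator E :: 'b \<Rightarrow> ennreal"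
  let ?iD = "indicator D :: 'b \<Rightarrow> ennreal" and ?iF = "indicator F :: 'b \<Rightarrow> ennreal"
  let ?k = "emeasure lborel K"
  \<comment> \<open>\<open>G\<close> is the image of \<open>N\<close> under \<open>g\<close>,
    smoothed by \<open>K\<close>; \<open>Q\<close> is the convolution of \<open>G\<close> with the
    indicator of \<open>E\<close>.\<close>
  define G where "G w = (\<integral>\<^sup>+a. ?iK (g a - w) \<partial>N)" for w
  have [measurable]: "G \<in> borel_measurable borel" unfolding G_def by measurable
  define Q where "Q w = (\<integral>\<^sup>+w'. ?iE (w - w') * G w' \<partial>lborel)" for w
  have [measurable]: "Q \<in> borel_measurable borel" unfolding Q_def by measurable
  have refl: "(\<integral>\<^sup>+w. indicator S (z - w) \<partial>lborel) = emeasure lborel S" if "S \<in> sets borel" for S and z :: 'b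
    using that by (subst nn_integral_lborel_reflect) auto
  have tr: "(\<integral>\<^sup>+w. indicator S (w - z) \<partial>lborel) = emeasure lborel S" if "S \<in> sets borel" for S and z :: 'b
    using that by (subst nn_integral_lborel_translate) auto
  \<comment> \<open>For z - w and g b - w' in \<open>K\<close>, the difference w - w' equals (z - g
    b) - (z - w) + (g b - w'). This explains the form d - k + l of the assumption on
    \<open>E\<close>. Averaging over w' and then over w produces one factor \<open>?k\<close>
    each.\<close>
  have 1: "?k * (\<integral>\<^sup>+b. ?iD (z - g b) \<partial>N) \<le> Q w" if zw: "z - w \<in> K" for z w
  proof -
    have "?k * (\<integral>\<^sup>+b. ?iD (z - g b) \<partial>N) = (\<integral>\<^sup>+b. ?iD (z - g b) * ?k \<partial>N)"
      by (simp add: nn_integral_cmult[symmetric] mult.commute)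
    also have "\<dots> = (\<integral>\<^sup>+b. \<integral>\<^sup>+w'. ?iD (z - g b) * ?iK (g b - w') \<partial>lborel \<partial>N)"
      by (simp add: nn_integral_cmult refl)
    also have "\<dots> \<le> (\<integral>\<^sup>+b. \<integral>\<^sup>+w'. ?iE (w - w') * ?iK (g b - w') \<partial>lborel \<partial>N)"
    proof (intro nn_integral_mono)
      show "?iD (z - g b) * ?iK (g b - w') \<le> ?iE (w - w') * ?iK (g b - w')" for b w'
        using E[of "z - g b" "z - w" "g b - w'"] zw by (auto simp: indicator_def)
    qed
    also have "\<dots> = (\<integral>\<^sup>+w'. \<integral>\<^sup>+b. ?iE (w - w') * ?iK (g b - w') \<partial>N \<partial>lborel)"
      by (rule NL.Fubini'[symmetric]) measurable
    also have "\<dots> = Q w" by (simp add: Q_def G_def nn_integral_cmult)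
    finally show ?thesis .
  qed
  have "?k * (?k * (\<integral>\<^sup>+a. \<integral>\<^sup>+b. ?iD (g a - g b) \<partial>N \<partial>N)) =
      (\<integral>\<^sup>+a. (?k * (\<integral>\<^sup>+b. ?iD (g a - g b) \<partial>N)) * ?k \<partial>N)"
    by (simp add: nn_integral_cmult nn_integral_multc mult_ac)
  also have "\<dots> = (\<integral>\<^sup>+a. \<integral>\<^sup>+w. (?k * (\<integral>\<^sup>+b. ?iD (g a - g b) \<partial>N)) * ?iK (g a - w) \<partial>lborel \<partial>N)"
    by (simp add: nn_integral_cmult refl)
  also have "\<dots> \<le> (\<integral>\<^sup>+a. \<integral>\<^sup>+w. Q w * ?iK (g a - w) \<partial>lborel \<partial>N)"
  proof (intro nn_integral_mono)
    show "?k * (\<integral>\<^sup>+b. ?iD (g a - g b) \<partial>N) * ?iK (g a - w) \<le> Q w * ?iK (g a - w)" for a w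
      using 1[of "g a" w] by (auto simp: indicator_def)
  qed
  also have "\<dots> = (\<integral>\<^sup>+w. \<integral>\<^sup>+a. Q w * ?iK (g a - w) \<partial>N \<partial>lborel)"
    by (rule NL.Fubini'[symmetric]) measurable
  also have "\<dots> = (\<integral>\<^sup>+w. Q w * G w \<partial>lborel)" by (simp add: nn_integral_cmult G_def)
  finally have A: "?k * (?k * (\<integral>\<^sup>+a. \<integral>\<^sup>+b. ?iD (g a - g b) \<partial>N \<partial>N)) \<le> (\<integral>\<^sup>+w. Q w * G w \<partial>lborel)" .
  let ?G2 = "\<integral>\<^sup>+w. G w * G w \<partial>lborel"
  \<comment> \<open>After the product is replaced by squares, each term depends on only one of w and
    w' besides the indicator of \<open>E\<close>; integrating out the other variable gives the
    volume of \<open>E\<close>.\<close>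
  have "2 * (\<integral>\<^sup>+w. Q w * G w \<partial>lborel) = (\<integral>\<^sup>+w. \<integral>\<^sup>+w'. ?iE (w - w') * (2 * (G w' * G w)) \<partial>lborel \<partial>lborel)"
    unfolding Q_def by (simp add: nn_integral_cmult[symmetric] nn_integral_multc[symmetric] mult_ac)
  also have "\<dots> \<le> (\<integral>\<^sup>+w. \<integral>\<^sup>+w'. ?iE (w - w') * (G w' * G w' + G w * G w) \<partial>lborel \<partial>lborel)"
    by (intro nn_integral_mono mult_left_mono two_mult_le_squares_ennreal) auto
  also have "\<dots> = (\<integral>\<^sup>+w. \<integral>\<^sup>+w'. ?iE (w - w') * (G w' * G w') \<partial>lborel \<partial>lborel) +
      (\<integral>\<^sup>+w. \<integral>\<^sup>+w'. ?iE (w - w') * (G w * G w) \<partial>lborel \<partial>lborel)"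
    by (simp add: distrib_left nn_integral_add)
  also have "(\<integral>\<^sup>+w. \<integral>\<^sup>+w'. ?iE (w - w') * (G w * G w) \<partial>lborel \<partial>lborel) = emeasure lborel E * ?G2"
    by (simp add: nn_integral_multc refl nn_integral_cmult)
  also have "(\<integral>\<^sup>+w. \<integral>\<^sup>+w'. ?iE (w - w') * (G w' * G w') \<partial>lborel \<partial>lborel) =
      (\<integral>\<^sup>+w'. \<integral>\<^sup>+w. ?iE (w - w') * (G w' * G w') \<partial>lborel \<partial>lborel)"
    by (rule lborel_pair.Fubini') measurable
  also have "\<dots> = emeasure lborel E * ?G2"
    by (simp add: nn_integral_multc tr nn_integral_cmult)
  finally have "2 * (\<integral>\<^sup>+w. Q w * G w \<partial>lborel) \<le> 2 * (emeasure lborel E * ?G2)"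
    by (simp add: mult_2)
  then have B: "(\<integral>\<^sup>+w. Q w * G w \<partial>lborel) \<le> emeasure lborel E * ?G2"
    by (simp add: ennreal_mult_le_mult_iff)
  \<comment> \<open>Two points within \<open>K\<close> of the same w differ by an element of
    \<open>F\<close>. This bounds the integral of G^2 with a single factor \<open>?k\<close>, so one
    \<open>?k\<close> remains on the left at the end.\<close>
  have 2: "(\<integral>\<^sup>+w. ?iK (z - w) * G w \<partial>lborel) \<le> ?k * (\<integral>\<^sup>+b. ?iF (z - g b) \<partial>N)" for z
  proof -
    have "(\<integral>\<^sup>+w. ?iK (z - w) * G w \<partial>lborel) = (\<integral>\<^sup>+w. \<integral>\<^sup>+b. ?iK (z - w) * ?iK (g b - w) \<partial>N \<partial>lborel)"
      by (simp add: G_def nn_integral_cmult)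
    also have "\<dots> = (\<integral>\<^sup>+b. \<integral>\<^sup>+w. ?iK (z - w) * ?iK (g b - w) \<partial>lborel \<partial>N)"
      by (rule NL.Fubini') measurable
    also have "\<dots> \<le> (\<integral>\<^sup>+b. \<integral>\<^sup>+w. ?iK (z - w) * ?iF (z - g b) \<partial>lborel \<partial>N)"
    proof (intro nn_integral_mono)
      show "?iK (z - w) * ?iK (g b - w) \<le> ?iK (z - w) * ?iF (z - g b)" for b w
        using F[of "z - w" "g b - w"] by (auto simp: indicator_def)
    qed
    also have "\<dots> = ?k * (\<integral>\<^sup>+b. ?iF (z - g b) \<partial>N)"
      by (simp add: nn_integral_multc refl nn_integral_cmult)
    finally show ?thesis .
  qed
  have "?G2 = (\<integral>\<^sup>+w. \<integral>\<^sup>+a. ?iK (g a - w) * G w \<partial>N \<partial>lborel)"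
    by (simp add: G_def nn_integral_multc)
  also have "\<dots> = (\<integral>\<^sup>+a. \<integral>\<^sup>+w. ?iK (g a - w) * G w \<partial>lborel \<partial>N)"
    by (rule NL.Fubini') measurable
  also have "\<dots> \<le> (\<integral>\<^sup>+a. ?k * (\<integral>\<^sup>+b. ?iF (g a - g b) \<partial>N) \<partial>N)"
    by (intro nn_integral_mono 2)
  also have "\<dots> = ?k * (\<integral>\<^sup>+a. \<integral>\<^sup>+b. ?iF (g a - g b) \<partial>N \<partial>N)"
    by (simp add: nn_integral_cmult)
  finally have "?G2 \<le> ?k * (\<integral>\<^sup>+a. \<integral>\<^sup>+b. ?iF (g a - g b) \<partial>N \<partial>N)" .
  with A B have "?k * (?k * (\<integral>\<^sup>+a. \<integral>\<^sup>+b. ?iD (g a - g b) \<partial>N \<partial>N)) \<le>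
      ?k * (emeasure lborel E * (\<integral>\<^sup>+a. \<integral>\<^sup>+b. ?iF (g a - g b) \<partial>N \<partial>N))"
    by (metis (no_types, lifting) mult.left_commute mult_left_mono order_trans zero_le)
  then show ?thesis
    using K by (simp add: ennreal_mult_le_mult_iff)
qed

text \<open>Homogeneity. With \<open>M = mat 1\<close> it also yields the volumes of balls of
  arbitrary radius.\<close>

lemma emeasure_flat_set_scaled:
  fixes M :: "real ^ 'n ^ 'n"
  assumes c: "0 < c"
  shows "emeasure lborel {z. norm z \<le> c \<and> norm (M *v z) \<le> c * r} = ennreal (c ^ CARD('n) * flat_vol M r)"
proof -
  let ?S = "{z :: real ^ 'n. norm z \<le> c \<and> norm (M *v z) \<le> c * r}"
  have [measurable]: "?S \<in> sets borel" by measurable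
  have scale: "(\<chi> i. c * x $ i) = c *\<^sub>R x" for x :: "real ^ 'n" by (simp add: vec_eq_iff)
  have "c *\<^sub>R x \<in> ?S \<longleftrightarrow> x \<in> flat_set M r" for x
    using c by (auto simp: flat_set_def matrix_vector_mult_scaleR)
  then have ind: "indicator ?S (c *\<^sub>R x) = (indicator (flat_set M r) x :: ennreal)" for x
    by (simp add: indicator_def)
  have "emeasure lborel ?S = (\<integral>\<^sup>+x. indicator ?S x \<partial>lborel)" by simp
  also have "\<dots> = ennreal (\<Prod>i\<in>(UNIV :: 'n set). c) * (\<integral>\<^sup>+x. indicator ?S (c *\<^sub>R x) \<partial>lborel)"
    using nn_integral_lborel_scale_cart[of "\<lambda>_. c" "indicator ?S"] c by (simp only: scale) measurable
  also have "\<dots> = ennreal (c ^ CARD('n)) * ennreal (flat_vol M r)"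
    by (simp only: ind nn_integral_indicator flat_set_borel sets_lborel emeasure_flat_set) simp
  finally show ?thesis using c by (simp add: ennreal_mult)
qed

text \<open>\<open>autocorrelation_le\<close> for Lebesgue measure on
  \<open>S = flat_set B \<rho>\<close> and the map \<open>B\<close>. All differences of images lie
  in the ball of radius 2 \<rho>, so the left double integral is the full square of v_B(\<rho>). On
  the right, a - b lies in twice a flattened ball of \<open>A ** B\<close>. One factor v_B(\<rho>)
  cancels, and 8^n is 4^n from the ball of radius 2 \<rho> + \<rho> + \<rho> times 2^n from the
  doubling.\<close>

lemma flat_vol_mult:
  fixes A B :: "real ^ 'n ^ 'n"
  assumes \<sigma>: "0 < \<sigma>" and \<rho>: "0 < \<rho>"
  shows "flat_vol A \<sigma> * flat_vol B \<rho> \<le>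
    8 ^ CARD('n) * measure lborel (cball (0 :: real ^ 'n) 1) * flat_vol (A ** B) (\<sigma> * \<rho>)"
proof (cases "flat_vol A \<sigma> = 0 \<or> flat_vol B \<rho> = 0")
  case True
  then show ?thesis by (auto intro!: mult_nonneg_nonneg)
next
  case False
  then have pos: "0 < flat_vol A \<sigma>" "0 < flat_vol B \<rho>"
    using flat_vol_nonneg by (simp_all add: order.strict_iff_order)
  define S where "S = flat_set B \<rho>"
  have [measurable]: "S \<in> sets borel" by (simp add: S_def)
  define N where "N = density lborel (indicator S)"
  define K where "K = {y :: real ^ 'n. norm y \<le> \<rho> \<and> norm (A *v y) \<le> \<rho> * \<sigma>}"
  define F where "F = {y :: real ^ 'n. norm (A *v y) \<le> 2 * (\<sigma> * \<rho>)}"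
  have [measurable]: "K \<in> sets borel" "F \<in> sets borel" unfolding K_def F_def by measurable
  have eK: "emeasure lborel K = ennreal (\<rho> ^ CARD('n) * flat_vol A \<sigma>)"
    unfolding K_def by (rule emeasure_flat_set_scaled[OF \<rho>])
  have eS: "emeasure lborel S = ennreal (flat_vol B \<rho>)" by (simp add: S_def emeasure_flat_set)
  have fin: "finite_measure N"
    by (rule finite_measureI) (simp add: N_def emeasure_density eS)
  interpret N: finite_measure N by fact
  have [measurable_cong]: "sets N = sets borel" by (simp add: N_def)
  have N: "(\<integral>\<^sup>+a. \<integral>\<^sup>+b. indicator T (B *v a - B *v b) \<partial>N \<partial>N) =
      (\<integral>\<^sup>+a. \<integral>\<^sup>+b. indicator S a * (indicator S b * indicator T (B *v a - B *v b)) \<partial>lborel \<partial>lborel)"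
    if [measurable]: "T \<in> sets borel" for T
  proof -
    have "(\<lambda>a. \<integral>\<^sup>+b. indicator T (B *v a - B *v b) \<partial>N) \<in> borel_measurable borel"
      by measurable
    then have outer: "(\<integral>\<^sup>+a. \<integral>\<^sup>+b. indicator T (B *v a - B *v b) \<partial>N \<partial>N) =
        (\<integral>\<^sup>+a. indicator S a * (\<integral>\<^sup>+b. indicator T (B *v a - B *v b) \<partial>N) \<partial>lborel)"
      by (subst (1) N_def) (rule nn_integral_density, auto)
    have "(\<integral>\<^sup>+b. indicator T (B *v a - B *v b) \<partial>N) =
        (\<integral>\<^sup>+b. indicator S b * indicator T (B *v a - B *v b) \<partial>lborel)" for a
      unfolding N_def by (rule nn_integral_density) measurable
    then show ?thesis unfolding outer by (simp add: nn_integral_cmult[symmetric])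
  qed
  have "emeasure lborel K * (\<integral>\<^sup>+a. \<integral>\<^sup>+b. indicator (cball 0 (2 * \<rho>)) (B *v a - B *v b) \<partial>N \<partial>N) \<le>
    emeasure lborel (cball (0 :: real ^ 'n) (4 * \<rho>)) * (\<integral>\<^sup>+a. \<integral>\<^sup>+b. indicator F (B *v a - B *v b) \<partial>N \<partial>N)"
  proof (rule autocorrelation_le[OF fin])
    show "(*v) B \<in> borel_measurable N" by (simp add: N_def)
    show "d - k + l \<in> cball 0 (4 * \<rho>)" if "d \<in> cball 0 (2 * \<rho>)" "k \<in> K" "l \<in> K" for d k l
      using that norm_triangle_ineq[of "d - k" l] norm_triangle_ineq4[of d k] by (simp add: K_def)
    show "k - l \<in> F" if "k \<in> K" "l \<in> K" for k l
      using that norm_triangle_ineq4[of "A *v k" "A *v l"]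
      by (simp add: K_def F_def matrix_vector_mult_diff_distrib mult.commute)
  qed (use pos \<rho> in \<open>auto simp: eK\<close>)
  moreover have "(\<integral>\<^sup>+a. \<integral>\<^sup>+b. indicator (cball 0 (2 * \<rho>)) (B *v a - B *v b) \<partial>N \<partial>N) =
      ennreal (flat_vol B \<rho> * flat_vol B \<rho>)"
  proof -
    have "indicator S a * (indicator S b * indicator (cball 0 (2 * \<rho>)) (B *v a - B *v b)) =
        (indicator S a * indicator S b :: ennreal)" for a b
    proof (cases "a \<in> S \<and> b \<in> S")
      case True
      then have "norm (B *v a - B *v b) \<le> 2 * \<rho>"
        using norm_triangle_ineq4[of "B *v a" "B *v b"] by (simp add: S_def flat_set_def)
      then show ?thesis by (simp add: indicator_def)
    qed (auto simp: indicator_def)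
    then show ?thesis
      by (simp add: N nn_integral_cmult nn_integral_multc eS ennreal_mult)
  qed
  moreover have "(\<integral>\<^sup>+a. \<integral>\<^sup>+b. indicator F (B *v a - B *v b) \<partial>N \<partial>N) \<le>
      ennreal (flat_vol B \<rho> * (2 ^ CARD('n) * flat_vol (A ** B) (\<sigma> * \<rho>)))"
  proof -
    let ?T = "{z. norm z \<le> 2 \<and> norm ((A ** B) *v z) \<le> 2 * (\<sigma> * \<rho>)}"
    have [measurable]: "?T \<in> sets borel" by measurable
    have "indicator S a * (indicator S b * indicator F (B *v a - B *v b)) \<le>
        (indicator S a * indicator ?T (a - b) :: ennreal)" for a b
    proof (cases "a \<in> S \<and> b \<in> S \<and> B *v a - B *v b \<in> F")
      case True
      then have "norm (a - b) \<le> 2" using norm_triangle_ineq4[of a b] by (simp add: S_def flat_set_def)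
      then show ?thesis using True
        by (simp add: F_def indicator_def matrix_vector_mul_assoc[symmetric] matrix_vector_mult_diff_distrib)
    qed (auto simp: indicator_def)
    then have "(\<integral>\<^sup>+a. \<integral>\<^sup>+b. indicator F (B *v a - B *v b) \<partial>N \<partial>N) \<le>
        (\<integral>\<^sup>+a. \<integral>\<^sup>+b. indicator S a * indicator ?T (a - b) \<partial>lborel \<partial>lborel)"
      by (subst N) (measurable, intro nn_integral_mono)
    also have "\<dots> = emeasure lborel S * (\<integral>\<^sup>+b. indicator ?T b \<partial>lborel)"
      by (simp add: nn_integral_cmult nn_integral_lborel_reflect nn_integral_multc)
    also have "\<dots> = ennreal (flat_vol B \<rho>) * ennreal (2 ^ CARD('n) * flat_vol (A ** B) (\<sigma> * \<rho>))"
      using emeasure_flat_set_scaled[of 2 "A ** B" "\<sigma> * \<rho>"] by (simp add: eS)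
    finally show ?thesis using pos by (simp add: ennreal_mult)
  qed
  ultimately have "ennreal (\<rho> ^ CARD('n) * flat_vol A \<sigma>) * ennreal (flat_vol B \<rho> * flat_vol B \<rho>) \<le>
      emeasure lborel (cball (0 :: real ^ 'n) (4 * \<rho>)) *
      ennreal (flat_vol B \<rho> * (2 ^ CARD('n) * flat_vol (A ** B) (\<sigma> * \<rho>)))"
    unfolding eK by (auto intro: order_trans[OF _ mult_left_mono])
  also have "emeasure lborel (cball (0 :: real ^ 'n) (4 * \<rho>)) =
      ennreal ((4 * \<rho>) ^ CARD('n) * measure lborel (cball (0 :: real ^ 'n) 1))"
  proof -
    have "{z :: real ^ 'n. norm z \<le> 4 * \<rho> \<and> norm (mat 1 *v z) \<le> 4 * \<rho> * 1} = cball 0 (4 * \<rho>)"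
      "flat_set (mat 1 :: real ^ 'n ^ 'n) 1 = cball 0 1"
      by (auto simp: flat_set_def)
    then show ?thesis
      using emeasure_flat_set_scaled[of "4 * \<rho>" "mat 1 :: real ^ 'n ^ 'n" 1] \<rho> by (simp add: flat_vol_def)
  qed
  finally have "(\<rho> ^ CARD('n) * flat_vol A \<sigma>) * (flat_vol B \<rho> * flat_vol B \<rho>) \<le>
      ((4 * \<rho>) ^ CARD('n) * measure lborel (cball (0 :: real ^ 'n) 1)) *
      (flat_vol B \<rho> * (2 ^ CARD('n) * flat_vol (A ** B) (\<sigma> * \<rho>)))"
    using \<rho> pos by (simp add: ennreal_mult[symmetric])
  then have "(\<rho> ^ CARD('n) * flat_vol B \<rho>) * (flat_vol A \<sigma> * flat_vol B \<rho>) \<le>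
     (\<rho> ^ CARD('n) * flat_vol B \<rho>) * ((4 ^ CARD('n) * 2 ^ CARD('n)) * measure lborel (cball (0 :: real ^ 'n) 1) * flat_vol (A ** B) (\<sigma> * \<rho>))"
    by (simp add: power_mult_distrib mult_ac)
  then have "flat_vol A \<sigma> * flat_vol B \<rho> \<le>
      (4 ^ CARD('n) * 2 ^ CARD('n)) * measure lborel (cball (0 :: real ^ 'n) 1) * flat_vol (A ** B) (\<sigma> * \<rho>)"
    using \<rho> pos by (subst (asm) mult_le_cancel_left_pos) auto
  then show ?thesis by (simp add: power_mult_distrib[symmetric])
qed

subsection \<open>Powers of contracting matrices\<close>

lemma contraction_perturbed_tendsto_0:
  fixes x y :: "nat \<Rightarrow> real"
  assumes x: "\<And>k. 0 \<le> x k" and step: "\<And>k. x (Suc k) \<le> r * x k + y k"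
    and r: "0 \<le> r" "r < 1" and y: "y \<longlonglongrightarrow> 0"
  shows "x \<longlonglongrightarrow> 0"
proof (rule LIMSEQ_I)
  fix \<epsilon> :: real
  assume \<epsilon>: "0 < \<epsilon>"
  \<comment> \<open>Chosen so that r (\<epsilon> / 2) + \<eta> = \<epsilon> / 2: the error term in
    \<open>bound\<close> then reproduces itself.\<close>
  define \<eta> where "\<eta> = \<epsilon> / 2 * (1 - r)"
  have "0 < \<eta>" using \<epsilon> r by (simp add: \<eta>_def)
  then obtain K where K: "\<And>k. k \<ge> K \<Longrightarrow> y k \<le> \<eta>"
    using LIMSEQ_D[OF y, of \<eta>] by fastforce
  have bound: "x (K + j) \<le> r ^ j * x K + \<epsilon> / 2" for j
  proof (induction j)
    case 0
    then show ?case using \<epsilon> by simp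
  next
    case (Suc j)
    have "x (K + Suc j) \<le> r * x (K + j) + \<eta>"
      using step[of "K + j"] K[of "K + j"] by simp
    also have "\<dots> \<le> r * (r ^ j * x K + \<epsilon> / 2) + \<eta>"
      using Suc r by (intro add_right_mono mult_left_mono) auto
    also have "\<dots> = r ^ Suc j * x K + \<epsilon> / 2"
      by (simp add: \<eta>_def field_simps)
    finally show ?case .
  qed
  have "(\<lambda>j. r ^ j * x K) \<longlonglongrightarrow> 0"
    using r by (intro tendsto_mult_left_zero LIMSEQ_power_zero) auto
  then have "\<exists>J. \<forall>j\<ge>J. norm (r ^ j * x K - 0) < \<epsilon> / 2" using \<epsilon> by (intro LIMSEQ_D) auto
  then obtain J where J: "\<And>j. j \<ge> J \<Longrightarrow> norm (r ^ j * x K) < \<epsilon> / 2" by auto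
  have "norm (x k - 0) < \<epsilon>" if "k \<ge> K + J" for k
  proof -
    have "norm (r ^ (k - K) * x K) < \<epsilon> / 2" using that by (intro J) auto
    then have "r ^ (k - K) * x K < \<epsilon> / 2" unfolding real_norm_def by linarith
    then show ?thesis using bound[of "k - K"] that x[of k] by simp
  qed
  then show "\<exists>no. \<forall>n\<ge>no. norm (x n - 0) < \<epsilon>" by blast
qed

lemma norm_smult_vec_complex: "norm (c *s v) = norm c * norm (v :: complex ^ 'n)"
  by (simp add: norm_vec_def L2_set_def norm_mult power_mult_distrib sum_distrib_left[symmetric] real_sqrt_mult)

text \<open>A substitute for the Jordan form, by induction on an annihilating polynomial p = (X -
  \<rho>) q. If q(T) v is not 0, it is an eigenvector for \<rho>, whence |\<rho>| < 1. The vector w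
  = T v - \<rho> v is annihilated by q, so its iterates tend to 0, and those of v satisfy a
  contracting recursion perturbed by them.\<close>

lemma annihilated_iterates_tendsto_0:
  fixes T :: "complex ^ 'n \<Rightarrow> complex ^ 'n" and v :: "complex ^ 'n"
  assumes T: "\<And>u v. T (u + v) = T u + T v" "\<And>c v. T (c *s v) = c *s T v"
    and eig: "\<And>\<rho> v. v \<noteq> 0 \<Longrightarrow> T v = \<rho> *s v \<Longrightarrow> norm \<rho> < 1"
    and p: "p \<noteq> 0" "degree p \<le> N" "(\<Sum>i\<le>N. coeff p i *s (T ^^ i) v) = 0"
  shows "(\<lambda>k. (T ^^ k) v) \<longlonglongrightarrow> 0"
  using p
proof (induction N arbitrary: p v)
  case 0
  then have "coeff p 0 \<noteq> 0" by (metis le_zero_eq leading_coeff_0_iff)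
  then have "v = 0" using 0 by (simp add: vec_eq_iff)
  have "T 0 = 0" using T(2)[of 0 0] by simp
  then have "(T ^^ k) 0 = 0" for k by (induction k) auto
  then show ?case using \<open>v = 0\<close> by simp
next
  case (Suc N)
  have T0: "T 0 = 0" using T(2)[of 0 0] by simp
  have Tk: "(T ^^ k) (u + w) = (T ^^ k) u + (T ^^ k) w" "(T ^^ k) (c *s u) = c *s (T ^^ k) u" for k c u w
    by (induction k) (auto simp: T)
  have Tsum: "T (\<Sum>i\<in>I. f i) = (\<Sum>i\<in>I. T (f i))" for f and I :: "nat set"
    by (induction I rule: infinite_finite_induct) (auto simp: T T0)
  show ?case
  proof (cases "degree p \<le> N")
    case True
    then have "coeff p (Suc N) = 0" by (intro coeff_eq_0) auto
    then show ?thesis using Suc.IH[of p v] Suc.prems True by simp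
  next
    case False
    then have "\<not> constant (poly p)" by (simp add: constant_degree)
    then obtain \<rho> where "poly p \<rho> = 0" using fundamental_theorem_of_algebra by blast
    then obtain q where q: "p = [:-\<rho>, 1:] * q" by (auto simp: poly_eq_0_iff_dvd)
    have "q \<noteq> 0" using q Suc.prems by auto
    then have "degree p = Suc (degree q)" unfolding q by (subst degree_mult_eq) auto
    then have dq: "degree q \<le> N" using Suc.prems by simp
    define E where "E u = (\<Sum>i\<le>N. coeff q i *s (T ^^ i) u)" for u
    have E_lin: "E (u + w) = E u + E w" "E (c *s u) = c *s E u" for u w c
      by (auto simp: E_def Tk vec.scale_right_distrib sum.distrib vec.scale_sum_right mult.commute)
    have TE: "T (E u) = E (T u)" for u
      by (simp add: E_def Tsum T funpow_swap1)
    \<comment> \<open>The top term vanishes, so the sum up to \<open>Suc N\<close> for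
      \<open>p\<close> reduces to \<open>E\<close>, which stops at \<open>N\<close>.\<close>
    have cq: "coeff q (Suc N) = 0" using dq by (intro coeff_eq_0) auto
    have "(\<Sum>i\<le>Suc N. coeff p i *s (T ^^ i) v) =
        (\<Sum>i\<le>Suc N. coeff (pCons 0 q) i *s (T ^^ i) v) + (\<Sum>i\<le>Suc N. (- \<rho> * coeff q i) *s (T ^^ i) v)"
      by (simp add: q vec.scale_left_distrib[symmetric] sum.distrib[symmetric] del: sum.atMost_Suc)
    also have "(\<Sum>i\<le>Suc N. coeff (pCons 0 q) i *s (T ^^ i) v) = T (E v)"
      by (subst sum.atMost_Suc_shift) (simp add: E_def Tsum T)
    also have "(\<Sum>i\<le>Suc N. (- \<rho> * coeff q i) *s (T ^^ i) v) = (- \<rho>) *s E v"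
      by (simp add: cq E_def vec.scale_sum_right)
    finally have 0: "T (E v) + (- \<rho>) *s E v = 0" using Suc.prems by simp
    show ?thesis
    proof (cases "E v = 0")
      case True
      then show ?thesis using Suc.IH[of q v] \<open>q \<noteq> 0\<close> dq by (simp add: E_def)
    next
      case False
      have "T (E v) = \<rho> *s E v" using 0 by (simp add: vec.scale_minus_left)
      then have \<rho>: "norm \<rho> < 1" using eig False by blast
      define w where "w = T v + (- \<rho>) *s v"
      have "E w = 0" using 0 by (simp only: w_def E_lin TE)
      then have w: "(\<lambda>k. (T ^^ k) w) \<longlonglongrightarrow> 0"
        using Suc.IH[of q w] \<open>q \<noteq> 0\<close> dq by (simp add: E_def)
      have "(T ^^ Suc k) v = \<rho> *s (T ^^ k) v + (T ^^ k) w" for k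
      proof -
        have "(T ^^ k) w = (T ^^ k) (T v) + (- \<rho>) *s (T ^^ k) v" by (simp only: w_def Tk)
        then show ?thesis by (simp add: funpow_swap1)
      qed
      then have st: "norm ((T ^^ Suc k) v) \<le> norm \<rho> * norm ((T ^^ k) v) + norm ((T ^^ k) w)" for k
        by (metis norm_smult_vec_complex norm_triangle_ineq)
      have "(\<lambda>k. norm ((T ^^ k) v)) \<longlonglongrightarrow> 0"
        by (rule contraction_perturbed_tendsto_0[OF norm_ge_zero st norm_ge_zero \<rho> tendsto_norm_zero[OF w]])
      then show ?thesis by (rule tendsto_norm_zero_cancel)
    qed
  qed
qed

text \<open>DIM + 1 vectors are linearly dependent. Repeated iterates need their own case, because
  the set of iterates then has too few elements; there the difference of two equal iterates is the
  relation.\<close>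

lemma iterates_annihilated:
  fixes f :: "'a::euclidean_space \<Rightarrow> 'a"
  obtains c :: "nat \<Rightarrow> real" and j where "j \<le> DIM('a)" "c j \<noteq> 0"
    "(\<Sum>i\<le>DIM('a). c i *\<^sub>R (f ^^ i) v) = 0"
proof (cases "inj_on (\<lambda>i. (f ^^ i) v) {..DIM('a)}")
  case True
  let ?S = "(\<lambda>i. (f ^^ i) v) ` {..DIM('a)}"
  have "card ?S = Suc (DIM('a))" using True by (simp add: card_image)
  then have "dependent ?S" by (intro dependent_biggerset) auto
  then obtain u where u: "\<exists>w\<in>?S. u w \<noteq> 0" "(\<Sum>w\<in>?S. u w *\<^sub>R w) = 0"
    by (auto simp: dependent_finite)
  then obtain j where "j \<le> DIM('a)" "u ((f ^^ j) v) \<noteq> 0" by auto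
  moreover have "(\<Sum>i\<le>DIM('a). u ((f ^^ i) v) *\<^sub>R (f ^^ i) v) = 0"
    using u(2) True by (simp add: sum.reindex)
  ultimately show ?thesis by (rule that)
next
  case False
  then obtain i j where ij: "i \<le> DIM('a)" "j \<le> DIM('a)" "i \<noteq> j" "(f ^^ i) v = (f ^^ j) v"
    by (auto simp: inj_on_def)
  define c where "c k = (if k = i then 1 else 0) - (if k = j then 1 else (0 :: real))" for k
  have "(\<Sum>k\<le>DIM('a). c k *\<^sub>R (f ^^ k) v) =
      (\<Sum>k\<le>DIM('a). (if k = i then (f ^^ k) v else 0)) - (\<Sum>k\<le>DIM('a). (if k = j then (f ^^ k) v else 0))"
    unfolding sum_subtractf[symmetric] by (intro sum.cong) (auto simp: c_def)
  also have "\<dots> = 0" using ij by simp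
  finally show ?thesis using ij by (intro that[of i c]) (auto simp: c_def)
qed

section \<open>Matrix powers and their convergence\<close>

lemma matrix_power_Suc: "matrix_power M (Suc k) = M ** matrix_power M k"
  by (simp add: matrix_power_def)

lemma matrix_power_0: "matrix_power M 0 = mat 1"
  by (simp add: matrix_power_def)

lemma matrix_power_vec: "matrix_power M k *v v = ((*v) M ^^ k) v"
  by (induction k) (auto simp: matrix_power_0 matrix_power_Suc matrix_vector_mul_assoc[symmetric])

lemma matrix_power_add: "matrix_power M (k + l) = matrix_power M k ** matrix_power M l"
  by (induction k) (auto simp: matrix_power_0 matrix_power_Suc matrix_mul_assoc)

lemma matrix_power_Suc2: "matrix_power M (Suc k) = matrix_power M k ** M"
  using matrix_power_add[of M k 1] by (simp add: matrix_power_0 matrix_power_Suc)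

lemma invertible_mat_1: "invertible (mat 1 :: real ^ 'n ^ 'n)"
  unfolding invertible_def by (intro exI[of _ "mat 1"]) simp

lemma invertible_matrix_power: "invertible M \<Longrightarrow> invertible (matrix_power (M :: real ^ 'n ^ 'n) k)"
  by (induction k) (auto simp: matrix_power_0 matrix_power_Suc invertible_mult invertible_mat_1)

text \<open>Eigenvalues are complex, so the real linear relation between the iterates of
  \<open>v\<close> is read as a complex polynomial annihilating the embedded vector.\<close>

lemma contracting_powers_tendsto_0:
  fixes M :: "real ^ 'n ^ 'n"
  assumes M: "contracting M"
  shows "(\<lambda>k. matrix_power M k *v v) \<longlonglongrightarrow> 0"
proof -
  define C :: "complex ^ 'n ^ 'n" where "C = map_matrix complex_of_real M"
  define emb :: "real ^ 'n \<Rightarrow> complex ^ 'n" where "emb v = (\<chi> i. complex_of_real (v $ i))" for v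
  have emb: "C *v emb v = emb (M *v v)" for v
    by (simp add: C_def emb_def matrix_vector_mult_def vec_eq_iff)
  have emb_pow: "((*v) C ^^ k) (emb v) = emb (((*v) M ^^ k) v)" for k v
    by (induction k) (auto simp: emb)
  have emb_norm: "norm (emb v) = norm v" for v
    by (simp add: emb_def norm_vec_def L2_set_def)
  obtain c :: "nat \<Rightarrow> real" and j where j: "j \<le> DIM(real ^ 'n)" "c j \<noteq> 0"
    and sum0: "(\<Sum>i\<le>DIM(real ^ 'n). c i *\<^sub>R (((*v) M) ^^ i) v) = 0"
    by (rule iterates_annihilated[of "(*v) M" v])
  let ?N = "DIM(real ^ 'n)"
  define p where "p = (\<Sum>i\<le>?N. monom (complex_of_real (c i)) i)"
  have coeff_p: "coeff p i = (if i \<le> ?N then complex_of_real (c i) else 0)" for i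
    by (simp add: p_def coeff_sum)
  have p0: "p \<noteq> 0" using j coeff_p[of j] by (metis coeff_0 of_real_eq_0_iff)
  have dp: "degree p \<le> ?N" by (rule degree_le) (simp add: coeff_p)
  have sump: "(\<Sum>i\<le>?N. coeff p i *s ((*v) C ^^ i) (emb v)) = 0"
  proof -
    have "(\<Sum>i\<le>?N. coeff p i *s ((*v) C ^^ i) (emb v)) = emb (\<Sum>i\<le>?N. c i *\<^sub>R (((*v) M) ^^ i) v)"
      by (simp only: emb_pow) (simp add: coeff_p emb_def vec_eq_iff)
    then show ?thesis by (simp only: sum0) (simp add: emb_def vec_eq_iff)
  qed
  have eig: "norm \<rho> < 1" if "v \<noteq> 0" "C *v v = \<rho> *s v" for \<rho> v
    using M that unfolding contracting_def complex_eigenvalue_def C_def by blast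
  have "(\<lambda>k. ((*v) C ^^ k) (emb v)) \<longlonglongrightarrow> 0"
    by (rule annihilated_iterates_tendsto_0[where T = "(*v) C", OF matrix_vector_right_distrib vector_scalar_commute eig p0 dp sump])
  then have "(\<lambda>k. norm (((*v) M ^^ k) v)) \<longlonglongrightarrow> 0"
    using tendsto_norm_zero unfolding emb_pow emb_norm[symmetric] by blast
  then show ?thesis unfolding matrix_power_vec by (rule tendsto_norm_zero_cancel)
qed

section \<open>Block-diagonal matrices on joined vectors\<close>

lemma sum_UNIV_sum:
  "(\<Sum>k\<in>(UNIV :: ('a::finite + 'b::finite) set). f k) = (\<Sum>i\<in>UNIV. f (Inl i)) + (\<Sum>j\<in>UNIV. f (Inr j))"
  by (simp only: UNIV_Plus_UNIV[symmetric] sum.Plus[OF finite finite] o_def)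

lemma block_diag_vec_join:
  fixes U :: "real ^ 'd ^ 'd" and V :: "real ^ 'm ^ 'm"
  shows "block_diag U V *v vec_join t y = vec_join (U *v t) (V *v y)"
  by (simp add: vec_eq_iff split_sum_all matrix_vector_mult_def block_diag_def vec_join_def sum_UNIV_sum)

lemma matrix_power_block_diag_vec_join:
  fixes U :: "real ^ 'd ^ 'd" and V :: "real ^ 'm ^ 'm"
  shows "matrix_power (block_diag U V) k *v vec_join t y = vec_join (matrix_power U k *v t) (matrix_power V k *v y)"
  by (induction k) (simp_all add: matrix_power_0 matrix_power_Suc matrix_vector_mul_assoc[symmetric] block_diag_vec_join)

lemma vec_join_surj:
  fixes z :: "'a ^ ('d::finite + 'm::finite)"
  shows "\<exists>t y. z = vec_join t y"
  by (intro exI[of _ "\<chi> i. z $ Inl i"] exI[of _ "\<chi> i. z $ Inr i"])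
    (simp add: vec_join_def vec_eq_iff split: sum.split)

lemma invertible_block_diag:
  fixes U :: "real ^ 'd ^ 'd" and V :: "real ^ 'm ^ 'm"
  assumes "invertible U" "invertible V"
  shows "invertible (block_diag U V)"
proof -
  have "z = 0" if "block_diag U V *v z = 0" for z
  proof -
    obtain t y where z: "z = vec_join t y" using vec_join_surj by blast
    have 0: "vec_join 0 0 = (0 :: real ^ ('d + 'm))"
      by (simp add: vec_join_def vec_eq_iff split: sum.split)
    have "U *v t = 0 \<and> V *v y = 0" using that unfolding z block_diag_vec_join 0[symmetric] by simp
    then have "t = 0 \<and> y = 0"
      using assms by (metis invertible_left_inverse matrix_left_invertible_ker)
    then show ?thesis using 0 z by simp
  qed
  then show ?thesis by (metis invertible_left_inverse matrix_left_invertible_ker)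
qed

lemma norm_vec_join_power2:
  fixes t :: "real ^ 'd" and y :: "real ^ 'm"
  shows "(norm (vec_join t y))\<^sup>2 = (norm t)\<^sup>2 + (norm y)\<^sup>2"
  by (simp add: norm_vec_def L2_set_def sum_nonneg sum_UNIV_sum vec_join_def)

lemma norm_vec_join_le:
  fixes t :: "real ^ 'd" and y :: "real ^ 'm"
  shows "norm (vec_join t y) \<le> norm t + norm y"
  by (rule power2_le_imp_le) (auto simp: norm_vec_join_power2 power2_sum)

lemma norm_le_norm_vec_join:
  fixes t :: "real ^ 'd" and y :: "real ^ 'm"
  shows "norm t \<le> norm (vec_join t y)" "norm y \<le> norm (vec_join t y)"
  by (rule power2_le_imp_le; simp add: norm_vec_join_power2)+

text \<open>In finite dimension, convergence on the coordinate vectors is already uniform on bounded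
  sets.\<close>

lemma powers_uniformly_small:
  fixes M :: "real ^ 'n ^ 'n"
  assumes M: "\<And>v. (\<lambda>k. matrix_power M k *v v) \<longlonglongrightarrow> 0" and \<epsilon>: "0 < \<epsilon>"
  shows "\<exists>K. \<forall>k\<ge>K. \<forall>z. norm (matrix_power M k *v z) \<le> \<epsilon> * norm z"
proof -
  define b where "b k = (\<Sum>i\<in>UNIV. norm (matrix_power M k *v axis i 1))" for k
  have "b \<longlonglongrightarrow> 0"
    unfolding b_def by (intro tendsto_null_sum tendsto_norm_zero M)
  then obtain K where K: "\<And>k. k \<ge> K \<Longrightarrow> norm (b k) < \<epsilon>"
    using LIMSEQ_D[of b 0 \<epsilon>] \<epsilon> by auto
  have "norm (matrix_power M k *v z) \<le> \<epsilon> * norm z" if "k \<ge> K" for k z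
  proof -
    have "matrix_power M k *v z = (\<Sum>i\<in>UNIV. z $ i *\<^sub>R (matrix_power M k *v axis i 1))"
      unfolding matrix_vector_mult_basis
      by (simp add: vec_eq_iff column_def matrix_vector_mult_def mult.commute)
    also have "norm \<dots> \<le> (\<Sum>i\<in>UNIV. norm z * norm (matrix_power M k *v axis i 1))"
      by (intro sum_norm_le) (auto intro!: mult_right_mono component_le_norm_cart)
    also have "\<dots> = norm z * b k" by (simp add: b_def sum_distrib_left)
    also have "\<dots> \<le> norm z * \<epsilon>" using K[OF that] by (intro mult_left_mono) auto
    finally show ?thesis by (simp add: mult.commute)
  qed
  then show ?thesis by blast
qed

lemma contracting_block_diag_powers:
  fixes U :: "real ^ 'd ^ 'd" and V :: "real ^ 'm ^ 'm"
  assumes "contracting U" "contracting V"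
  shows "(\<lambda>k. matrix_power (block_diag U V) k *v z) \<longlonglongrightarrow> 0"
proof -
  obtain t y where z: "z = vec_join t y" using vec_join_surj by blast
  have "(\<lambda>k. norm (matrix_power U k *v t) + norm (matrix_power V k *v y)) \<longlonglongrightarrow> 0"
    using contracting_powers_tendsto_0[OF assms(1)] contracting_powers_tendsto_0[OF assms(2)]
    by (intro tendsto_add_zero tendsto_norm_zero)
  then show ?thesis
    unfolding z matrix_power_block_diag_vec_join
    by (rule Lim_null_comparison[rotated]) (simp add: norm_vec_join_le)
qed

subsection \<open>Growth of powers, and positive Hausdorff premeasure\<close>

lemma measure_unit_ball_pos: "0 < measure lborel (cball (0 :: real ^ 'n) 1)"
  using content_cball_pos[of 1 "0 :: real ^ 'n"] by simp

lemma flat_vol_eq_ball: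
  fixes M :: "real ^ 'n ^ 'n"
  assumes "\<And>z. norm z \<le> 1 \<Longrightarrow> norm (M *v z) \<le> r"
  shows "flat_vol M r = measure lborel (cball (0 :: real ^ 'n) 1)"
proof -
  have "flat_set M r = cball 0 1" using assms by (auto simp: flat_set_def)
  then show ?thesis by (simp add: flat_vol_def)
qed

text \<open>The case k = 0 of the bound in \<open>flat_vol_powers_le\<close>: the volume is r^n
  times that of the unit ball for r < 1, and at most the unit ball's for larger r.\<close>

lemma flat_vol_mat_1_le:
  fixes r \<gamma> :: real
  assumes r: "0 < r" and \<gamma>: "0 < \<gamma>" "\<gamma> \<le> CARD('n)"
  shows "flat_vol (mat 1 :: real ^ 'n ^ 'n) r \<le> measure lborel (cball (0 :: real ^ 'n) 1) * r powr \<gamma>"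
proof (cases "1 \<le> r")
  case True
  then have "1 \<le> r powr \<gamma>" using \<gamma> by (intro ge_one_powr_ge_zero) auto
  then show ?thesis
    using flat_vol_le_ball[of "mat 1 :: real ^ 'n ^ 'n" r]
      mult_left_mono[of 1 "r powr \<gamma>", OF _ less_imp_le[OF measure_unit_ball_pos[where 'n='n]]]
    by linarith
next
  case False
  let ?\<omega> = "measure lborel (cball (0 :: real ^ 'n) 1)"
  have "ennreal (flat_vol (mat 1 :: real ^ 'n ^ 'n) r) = emeasure lborel (flat_set (mat 1 :: real ^ 'n ^ 'n) r)"
    by (simp add: emeasure_flat_set)
  also have "\<dots> \<le> emeasure lborel {z :: real ^ 'n. norm z \<le> r \<and> norm (mat 1 *v z) \<le> r * 1}"
    by (intro emeasure_mono) (auto simp: flat_set_def)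
  also have "\<dots> = ennreal (r ^ CARD('n) * flat_vol (mat 1 :: real ^ 'n ^ 'n) 1)"
    by (rule emeasure_flat_set_scaled[OF r])
  also have "flat_vol (mat 1 :: real ^ 'n ^ 'n) 1 = ?\<omega>" by (rule flat_vol_eq_ball) simp
  finally have "flat_vol (mat 1 :: real ^ 'n ^ 'n) r \<le> r ^ CARD('n) * ?\<omega>"
    using r by (simp add: ennreal_le_iff)
  also have "r ^ CARD('n) = r powr CARD('n)" using r by (simp add: powr_realpow)
  also have "r powr CARD('n) * ?\<omega> \<le> r powr \<gamma> * ?\<omega>"
    using False r \<gamma> by (intro mult_right_mono powr_mono') auto
  finally show ?thesis by (simp add: mult.commute)
qed

text \<open>Submultiplicativity forces a dichotomy: once the bound fails badly for a single power,
  it fails exponentially along multiples of that power.\<close>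

lemma flat_vol_powers_le:
  fixes W :: "real ^ 'n ^ 'n" and \<gamma> :: real
  assumes W: "invertible W" and x: "0 < x" "x \<le> 1" and \<gamma>: "0 < \<gamma>" "\<gamma> \<le> CARD('n)"
    and not0: "\<not> (\<lambda>k. singular_value_function (matrix_power W k) \<gamma> / x ^ k) \<longlonglongrightarrow> 0"
  shows "\<exists>C>0. \<forall>k r. 0 < r \<longrightarrow> x ^ k * flat_vol (matrix_power W k) r \<le> C * r powr \<gamma>"
proof (rule ccontr)
  assume contra: "\<not> ?thesis"
  define \<omega> where "\<omega> = measure lborel (cball (0 :: real ^ 'n) 1)"
  have \<omega>: "0 < \<omega>" unfolding \<omega>_def by (rule measure_unit_ball_pos)
  define c where "c = 8 ^ CARD('n) * \<omega>"
  have c: "0 < c" using \<omega> by (simp add: c_def)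
  let ?v = "\<lambda>k. flat_vol (matrix_power W k)"
  \<comment> \<open>The constant has two tasks: \<omega> excludes the exponent 0, and 2 c leaves a
    gain of 2 after each multiplication has cost a factor c.\<close>
  have "\<exists>k r. 0 < r \<and> (\<omega> + 2 * c) * r powr \<gamma> < x ^ k * ?v k r"
    using contra \<omega> c by (auto simp: not_le)
  then obtain K r where r: "0 < r" and K: "(\<omega> + 2 * c) * r powr \<gamma> < x ^ K * ?v K r" by blast
  have "K \<noteq> 0"
  proof
    assume "K = 0"
    then have "x ^ K * ?v K r \<le> \<omega> * r powr \<gamma>"
      using flat_vol_mat_1_le[OF r \<gamma>] by (simp add: matrix_power_0 \<omega>_def)
    moreover have "\<omega> * r powr \<gamma> \<le> (\<omega> + 2 * c) * r powr \<gamma>" using c by (intro mult_right_mono) auto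
    ultimately show False using K by simp
  qed
  have K2: "2 * c * r powr \<gamma> \<le> x ^ K * ?v K r"
    using K \<omega> by (smt (verit) distrib_right mult_nonneg_nonneg powr_ge_zero)
  have mult: "?v k s * ?v l t \<le> c * ?v (k + l) (s * t)" if "0 < s" "0 < t" for k l s t
    using flat_vol_mult[OF that, of "matrix_power W k" "matrix_power W l"]
    by (simp add: matrix_power_add c_def \<omega>_def)
  have iter: "2 ^ l * (r ^ l) powr \<gamma> * \<omega> \<le> x ^ (K * l) * ?v (K * l) (r ^ l)" for l
  proof (induction l)
    case 0
    have "?v 0 1 = \<omega>" unfolding \<omega>_def matrix_power_0 by (rule flat_vol_eq_ball) simp
    then show ?case by simp
  next
    case (Suc l)
    have "(2 * c * r powr \<gamma>) * (2 ^ l * (r ^ l) powr \<gamma> * \<omega>) \<le>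
        (x ^ K * ?v K r) * (x ^ (K * l) * ?v (K * l) (r ^ l))"
      using c \<omega> x by (intro mult_mono[OF K2 Suc]) auto
    also have "\<dots> = x ^ (K * Suc l) * (?v K r * ?v (K * l) (r ^ l))"
      by (simp add: power_add mult_ac)
    also have "\<dots> \<le> x ^ (K * Suc l) * (c * ?v (K + K * l) (r * r ^ l))"
      using x r by (intro mult_left_mono mult) auto
    finally have "c * (2 ^ Suc l * (r powr \<gamma> * (r ^ l) powr \<gamma>) * \<omega>) \<le> c * (x ^ (K * Suc l) * ?v (K * Suc l) (r ^ Suc l))"
      by (simp add: mult_ac)
    moreover have "r powr \<gamma> * (r ^ l) powr \<gamma> = (r ^ Suc l) powr \<gamma>"
      using r by (simp add: powr_mult)
    ultimately show ?case using c by simp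
  qed
  \<comment> \<open>Large enough for \<open>flat_set\<close> of every power below \<open>K\<close>
    to be the whole unit ball. This absorbs the remainder of k modulo \<open>K\<close>.\<close>
  define \<sigma> where "\<sigma> = (\<Sum>i<K. onorm ((*v) (matrix_power W i))) + 1"
  have bl: "bounded_linear ((*v) (matrix_power W i))" for i by (simp add: linear_conv_bounded_linear[symmetric])
  have on0: "0 \<le> onorm ((*v) (matrix_power W i))" for i by (rule onorm_pos_le[OF bl])
  have \<sigma>0: "0 < \<sigma>" unfolding \<sigma>_def using on0 by (intro add_nonneg_pos sum_nonneg) auto
  have \<sigma>: "?v i \<sigma> = \<omega>" if "i < K" for i
    unfolding \<omega>_def
  proof (rule flat_vol_eq_ball)
    fix z :: "real ^ 'n"
    assume z: "norm z \<le> 1"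
    have "norm (matrix_power W i *v z) \<le> onorm ((*v) (matrix_power W i)) * norm z"
      by (rule onorm[OF bl])
    also have "\<dots> \<le> onorm ((*v) (matrix_power W i)) * 1" by (intro mult_left_mono z on0)
    also have "\<dots> \<le> \<sigma>" unfolding \<sigma>_def
      using member_le_sum[of i "{..<K}" "\<lambda>i. onorm ((*v) (matrix_power W i))"] that on0 by simp
    finally show "norm (matrix_power W i *v z) \<le> \<sigma>" .
  qed
  let ?\<phi> = "\<lambda>k. singular_value_function (matrix_power W k) \<gamma>"
  define A where "A = c * 2 ^ CARD('n) * \<sigma> powr \<gamma> / (\<omega> * \<omega> * x ^ K)"
  \<comment> \<open>The singular value function is tested at the radius \<sigma> r^l, where the
    volume is at least its growth along multiples of \<open>K\<close>. Replacing x^i by x^K for the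
    remainder i < K puts x^K into the denominator of \<open>A\<close>.\<close>
  have bound: "?\<phi> k / x ^ k \<le> A * (1 / 2) ^ (k div K)" for k
  proof -
    define l where "l = k div K"
    define i where "i = k mod K"
    have k: "k = i + K * l" by (simp add: l_def i_def)
    have i: "i < K" using \<open>K \<noteq> 0\<close> by (simp add: i_def)
    have \<phi>0: "0 < ?\<phi> k" by (rule singular_value_function_pos[OF invertible_matrix_power[OF W] \<gamma>])
    have "?\<phi> k * (\<omega> * ?v (K * l) (r ^ l)) \<le> ?\<phi> k * (c * ?v k (\<sigma> * r ^ l))"
      using mult[OF \<sigma>0, of "r ^ l" i "K * l"] r \<phi>0 \<sigma>[OF i] by (intro mult_left_mono) (auto simp: k)
    also have "\<dots> = c * (?\<phi> k * ?v k (\<sigma> * r ^ l))" by simp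
    also have "\<dots> \<le> c * (2 ^ CARD('n) * (\<sigma> * r ^ l) powr \<gamma>)"
      using c \<sigma>0 r by (intro mult_left_mono singular_value_function_flat_vol[OF invertible_matrix_power[OF W] \<gamma>]) auto
    finally have *: "?\<phi> k * (\<omega> * ?v (K * l) (r ^ l)) \<le> c * (2 ^ CARD('n) * (\<sigma> powr \<gamma> * (r ^ l) powr \<gamma>))"
      using \<sigma>0 r by (simp add: powr_mult)
    have "?\<phi> k * (\<omega> * (2 ^ l * (r ^ l) powr \<gamma> * \<omega>)) \<le> ?\<phi> k * (\<omega> * (x ^ (K * l) * ?v (K * l) (r ^ l)))"
      using \<phi>0 \<omega> by (intro mult_left_mono iter) auto
    also have "\<dots> = x ^ (K * l) * (?\<phi> k * (\<omega> * ?v (K * l) (r ^ l)))" by simp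
    also have "\<dots> \<le> x ^ (K * l) * (c * (2 ^ CARD('n) * (\<sigma> powr \<gamma> * (r ^ l) powr \<gamma>)))"
      using x by (intro mult_left_mono *) auto
    finally have "(r ^ l) powr \<gamma> * (?\<phi> k * (\<omega> * (2 ^ l * \<omega>))) \<le> (r ^ l) powr \<gamma> * (x ^ (K * l) * (c * (2 ^ CARD('n) * \<sigma> powr \<gamma>)))"
      by (simp add: mult_ac)
    then have "?\<phi> k * (\<omega> * (2 ^ l * \<omega>)) \<le> x ^ (K * l) * (c * (2 ^ CARD('n) * \<sigma> powr \<gamma>))"
      using r by (subst (asm) mult_le_cancel_left_pos) auto
    then have "x ^ K * (?\<phi> k * (\<omega> * (2 ^ l * \<omega>))) \<le> x ^ K * (x ^ (K * l) * (c * (2 ^ CARD('n) * \<sigma> powr \<gamma>)))"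
      using x by (intro mult_left_mono) auto
    also have "\<dots> \<le> x ^ i * (x ^ (K * l) * (c * (2 ^ CARD('n) * \<sigma> powr \<gamma>)))"
      using x i c by (intro mult_right_mono power_decreasing) auto
    also have "\<dots> = x ^ k * (c * (2 ^ CARD('n) * \<sigma> powr \<gamma>))" by (simp add: k power_add)
    finally have "x ^ K * (?\<phi> k * (\<omega> * (2 ^ l * \<omega>))) \<le> x ^ k * (c * (2 ^ CARD('n) * \<sigma> powr \<gamma>))" .
    then show ?thesis
      using x \<omega> unfolding A_def l_def[symmetric] by (simp add: field_simps power_divide)
  qed
  have "filterlim (\<lambda>k. k div K) at_top sequentially"
    using \<open>K \<noteq> 0\<close> by (intro filterlim_at_top_div_const_nat) auto
  then have "(\<lambda>k. (1 / 2 :: real) ^ (k div K)) \<longlonglongrightarrow> 0"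
    by (rule filterlim_compose[of "\<lambda>l. (1 / 2 :: real) ^ l", rotated]) (intro LIMSEQ_power_zero, simp)
  then have "(\<lambda>k. A * (1 / 2) ^ (k div K)) \<longlonglongrightarrow> 0" by (rule tendsto_mult_right_zero)
  then have "(\<lambda>k. ?\<phi> k / x ^ k) \<longlonglongrightarrow> 0"
  proof (rule Lim_null_comparison[rotated], intro always_eventually allI)
    fix k
    have "0 \<le> ?\<phi> k / x ^ k"
      using singular_value_function_pos[OF invertible_matrix_power[OF W, of k] \<gamma>] x by simp
    then show "norm (?\<phi> k / x ^ k) \<le> A * (1 / 2) ^ (k div K)" using bound[of k] by simp
  qed
  with not0 show False by simp
qed

text \<open>Mass distribution principle. A finite dyadic sum means that, on a set of positive mass,
  balls of radius 2^-i around the image point have mass at most M 2^(-i \<gamma>). A covering set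
  then carries mass at most a constant times its diameter to the power \<gamma>, and also to any
  smaller power \<open>s\<close>, since diameters are at most 1.\<close>

lemma hausdorff_premeasure_pos:
  fixes g :: "'a \<Rightarrow> 'b::euclidean_space"
  assumes N: "finite_measure N" "emeasure N (space N) \<noteq> 0" and g [measurable]: "g \<in> borel_measurable N"
    and fin: "(\<Sum>i. ennreal ((2 ^ i) powr \<gamma>) *
      (\<integral>\<^sup>+a. \<integral>\<^sup>+b. indicator (cball 0 (1 / 2 ^ i)) (g a - g b) \<partial>N \<partial>N)) < \<top>"
    and s: "0 \<le> s" "s \<le> \<gamma>" and \<gamma>: "0 < \<gamma>"
  shows "0 < hausdorff_premeasure s 1 (g ` space N)"
proof -
  interpret N: finite_measure N by fact
  have [measurable]: "cball 0 t \<in> sets (borel :: 'b measure)" for t by simp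
  define \<nu> where "\<nu> i a = (\<integral>\<^sup>+b. indicator (cball 0 (1 / 2 ^ i)) (g a - g b) \<partial>N)" for i :: nat and a
  have [measurable]: "\<nu> i \<in> borel_measurable N" for i unfolding \<nu>_def by measurable
  define F where "F a = (\<Sum>i. ennreal ((2 ^ i) powr \<gamma>) * \<nu> i a)" for a
  have [measurable]: "F \<in> borel_measurable N" unfolding F_def by measurable
  have "(\<integral>\<^sup>+a. F a \<partial>N) < \<top>"
    using fin unfolding F_def \<nu>_def[symmetric] by (simp add: nn_integral_suminf nn_integral_cmult)
  then have F_fin: "AE a in N. F a \<noteq> \<top>"
    using nn_integral_noteq_infinite[of F N] by (auto simp: less_top)
  define B where "B M = {a \<in> space N. F a \<le> of_nat M}" for M :: nat
  have [measurable]: "B M \<in> sets N" for M unfolding B_def by measurable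
  have "\<exists>M. emeasure N (B M) \<noteq> 0"
  proof (rule ccontr)
    assume "\<not> ?thesis"
    then have "AE a in N. a \<notin> B M" for M by (intro AE_not_in) (auto simp: null_sets_def)
    then have "AE a in N. \<forall>M. a \<notin> B M" by (simp add: AE_all_countable)
    with F_fin AE_space have "AE a in N. False"
    proof eventually_elim
      case (elim a)
      then obtain M :: nat where "F a < of_nat M" using ennreal_Ex_less_of_nat less_top by metis
      then have "F a \<le> of_nat M" by (rule less_imp_le)
      then have "a \<in> B M" using elim(2) by (simp add: B_def)
      then show ?case using elim(3) by blast
    qed
    then have "emeasure N (space N) = 0" by (simp add: AE_iff_measurable[OF sets.top])
    then show False using N by simp
  qed
  then obtain M0 where M0: "emeasure N (B M0) \<noteq> 0" by blast
  define M where "M = real M0"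
  have \<nu>_le: "\<nu> i a \<le> ennreal (M * (1 / 2 ^ i) powr \<gamma>)" if "a \<in> B M0" for i a
  proof -
    have "ennreal ((2 ^ i) powr \<gamma>) * \<nu> i a \<le> F a"
      unfolding F_def using sum_le_suminf[of "\<lambda>i. ennreal ((2 ^ i) powr \<gamma>) * \<nu> i a" "{i}"] by simp
    also have "\<dots> \<le> ennreal M" using that by (simp add: B_def M_def ennreal_of_nat_eq_real_of_nat)
    finally have FM: "ennreal ((2 ^ i) powr \<gamma>) * \<nu> i a \<le> ennreal M" .
    have one: "ennreal ((1 / 2 ^ i) powr \<gamma>) * ennreal ((2 ^ i) powr \<gamma>) = 1"
      by (simp add: ennreal_mult[symmetric] powr_mult[symmetric])
    have "\<nu> i a = ennreal ((1 / 2 ^ i) powr \<gamma>) * ennreal ((2 ^ i) powr \<gamma>) * \<nu> i a"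
      by (simp only: one mult_1)
    also have "\<dots> = ennreal ((1 / 2 ^ i) powr \<gamma>) * (ennreal ((2 ^ i) powr \<gamma>) * \<nu> i a)"
      by (rule mult.assoc)
    also have "\<dots> \<le> ennreal ((1 / 2 ^ i) powr \<gamma>) * ennreal M"
      by (intro mult_left_mono FM) simp
    also have "\<dots> = ennreal ((1 / 2 ^ i) powr \<gamma> * M)" by (rule ennreal_mult[symmetric]) (auto simp: M_def)
    finally show ?thesis by (simp only: mult.commute)
  qed
  \<comment> \<open>\<open>M + 1\<close> makes \<open>c\<close> positive without a case distinction
    on \<open>M\<close>; 2^\<gamma> comes from rounding a diameter up to a dyadic radius.\<close>
  define c where "c = (M + 1) * 2 powr \<gamma>"
  have c: "0 < c" by (simp add: c_def M_def add_nonneg_pos)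
  \<comment> \<open>Covering sets are arbitrary; their closures have the same diameter and
    measurable preimages.\<close>
  have piece: "emeasure N (B M0 \<inter> g -` closure E) \<le> ennreal c * diam_weight s E"
    if E: "bounded E" "diameter E \<le> 1" for E :: "'b set"
  proof (cases "B M0 \<inter> g -` closure E = {}")
    case True
    then show ?thesis by simp
  next
    case False
    then obtain a where a: "a \<in> B M0" "g a \<in> closure E" by auto
    then have "E \<noteq> {}" by auto
    have [measurable]: "B M0 \<inter> g -` closure E \<in> sets N"
    proof -
      have "B M0 \<inter> g -` closure E = B M0 \<inter> (g -` closure E \<inter> space N)" by (auto simp: B_def)
      then show ?thesis by simp
    qed
    have d0: "0 \<le> diameter E" by (rule diameter_ge_0[OF E(1)])
    have dist: "norm (g a - g b) \<le> diameter E" if "g b \<in> closure E" for b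
      using diameter_bounded_bound[of "closure E" "g a" "g b"] a that E(1) bounded_closure[OF E(1)]
      by (simp add: diameter_closure dist_norm)
    have le: "emeasure N (B M0 \<inter> g -` closure E) \<le> \<nu> i a" if i: "diameter E \<le> 1 / 2 ^ i" for i
    proof -
      have "emeasure N (B M0 \<inter> g -` closure E) = (\<integral>\<^sup>+b. indicator (B M0 \<inter> g -` closure E) b \<partial>N)" by simp
      also have "\<dots> \<le> \<nu> i a" unfolding \<nu>_def
        by (intro nn_integral_mono) (use dist i in \<open>force simp: indicator_def intro: order_trans\<close>)
      finally show ?thesis .
    qed
    show ?thesis
    proof (cases "diameter E = 0")
      case True
      \<comment> \<open>A set of diameter 0 lies in balls of every dyadic radius and hence has mass
        0, so the bound holds whatever its weight.\<close>
      have "emeasure N (B M0 \<inter> g -` closure E) \<le> ennreal (M * (1 / 2 ^ i) powr \<gamma>)" for i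
        using le[of i] \<nu>_le[OF a(1), of i] True by (auto intro: order_trans)
      moreover have "(\<lambda>i. ennreal (M * (1 / 2 ^ i) powr \<gamma>)) \<longlonglongrightarrow> ennreal (M * 0)"
      proof (intro tendsto_ennrealI tendsto_mult tendsto_const)
        have "(\<lambda>i. (1 / 2 ^ i :: real)) \<longlonglongrightarrow> 0"
          using LIMSEQ_power_zero[of "1 / 2 :: real"] by (simp add: power_divide)
        then show "(\<lambda>i. (1 / 2 ^ i :: real) powr \<gamma>) \<longlonglongrightarrow> 0"
          using tendsto_powr'[of _ 0 sequentially "\<lambda>_. \<gamma>" \<gamma>] \<gamma> by simp
      qed
      ultimately have "emeasure N (B M0 \<inter> g -` closure E) \<le> ennreal (M * 0)"
        by (intro LIMSEQ_le_const) auto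
      then show ?thesis by simp
    next
      case False
      then have d: "0 < diameter E" using d0 by simp
      define Z where "Z = {i :: nat. diameter E \<le> 1 / 2 ^ i}"
      have "\<exists>i. (1 / 2) ^ i < diameter E" using d by (intro real_arch_pow_inv) auto
      then obtain i0 where i0: "(1 / 2) ^ i0 < diameter E" by blast
      have "i < i0" if "i \<in> Z" for i
      proof (rule ccontr)
        assume "\<not> i < i0"
        then have "(1 / 2 :: real) ^ i \<le> (1 / 2) ^ i0" by (intro power_decreasing) auto
        then show False using that i0 by (simp add: Z_def power_divide)
      qed
      then have "finite Z" by (metis bounded_nat_set_is_finite)
      have "0 \<in> Z" using E by (simp add: Z_def)
      \<comment> \<open>The largest \<open>i\<close> with diameter at most 2^-i also satisfies 2^-i
        < 2 * diameter.\<close>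
      define i where "i = Max Z"
      have "Z \<noteq> {}" using \<open>0 \<in> Z\<close> by blast
      then have i: "i \<in> Z" "Suc i \<notin> Z"
        using Max_in[OF \<open>finite Z\<close>] Max_ge[OF \<open>finite Z\<close>, of "Suc (Max Z)"] by (auto simp: i_def)
      have half: "1 / 2 ^ i \<le> 2 * diameter E" using i(2) by (simp add: Z_def not_le field_simps)
      have "emeasure N (B M0 \<inter> g -` closure E) \<le> ennreal (M * (1 / 2 ^ i) powr \<gamma>)"
        using le[of i] \<nu>_le[OF a(1), of i] i by (auto simp: Z_def intro: order_trans)
      also have "M * (1 / 2 ^ i) powr \<gamma> \<le> (M + 1) * (2 * diameter E) powr \<gamma>"
        using half \<gamma> by (intro mult_mono powr_mono2) (auto simp: M_def)
      also have "\<dots> = c * diameter E powr \<gamma>" using d by (simp add: c_def powr_mult)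
      also have "\<dots> \<le> c * diameter E powr s"
        using c d E(2) s by (intro mult_left_mono powr_mono') auto
      finally have "emeasure N (B M0 \<inter> g -` closure E) \<le> ennreal c * ennreal (diameter E powr s)"
        using c by (simp add: ennreal_mult ennreal_leI)
      moreover have "ennreal (diameter E powr s) = diam_weight s E"
        using d \<open>E \<noteq> {}\<close> by (simp add: diam_weight_def)
      ultimately show ?thesis by simp
    qed
  qed
  have "emeasure N (B M0) / ennreal c \<le> (\<Sum>i. diam_weight s (E i))"
    if E: "g ` space N \<subseteq> (\<Union>i. E i)" "\<forall>i. bounded (E i) \<and> diameter (E i) \<le> 1" for E :: "nat \<Rightarrow> 'b set"
  proof (rule divide_le_posI_ennreal)
    define H where "H i = B M0 \<inter> g -` closure (E i)" for i
    have "H i = B M0 \<inter> (g -` closure (E i) \<inter> space N)" for i by (auto simp: B_def H_def)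
    then have H [measurable]: "H i \<in> sets N" for i by simp
    have "B M0 \<subseteq> (\<Union>i. H i)"
    proof
      fix a assume a: "a \<in> B M0"
      then have "g a \<in> (\<Union>i. E i)" using E(1) by (auto simp: B_def)
      then obtain i where "g a \<in> closure (E i)" using closure_subset by blast
      then show "a \<in> (\<Union>i. H i)" using a by (auto simp: H_def)
    qed
    then have "emeasure N (B M0) \<le> emeasure N (\<Union>i. H i)"
      by (intro emeasure_mono) auto
    also have "\<dots> \<le> (\<Sum>i. emeasure N (H i))"
      using H by (intro emeasure_subadditive_countably) auto
    also have "\<dots> \<le> (\<Sum>i. ennreal c * diam_weight s (E i))"
      unfolding H_def using E(2) by (intro suminf_le piece) auto
    finally show "emeasure N (B M0) \<le> ennreal c * (\<Sum>i. diam_weight s (E i))" by simp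
  qed (use c in auto)
  then have "emeasure N (B M0) / ennreal c \<le> hausdorff_premeasure s 1 (g ` space N)"
    unfolding hausdorff_premeasure_def by (intro INF_greatest) auto
  moreover have "0 < emeasure N (B M0) / ennreal c"
    using M0 by (simp add: ennreal_zero_less_divide zero_less_iff_neq_zero)
  ultimately show ?thesis by order
qed

subsection \<open>Intensity of the occupation measure\<close>

lemma continuous_on_vec_join: "continuous_on UNIV (\<lambda>p::(real ^ 'd) \<times> (real ^ 'm). vec_join (fst p) (snd p))"
  unfolding vec_join_def
proof (intro continuous_on_vec_lambda)
  fix k :: "'d + 'm"
  show "continuous_on UNIV
    (\<lambda>p::(real^'d) \<times> (real^'m). case k of Inl i \<Rightarrow> fst p $ i | Inr j \<Rightarrow> snd p $ j)"
    by (cases k) (auto intro!: continuous_intros)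
qed

lemma borel_measurable_vec_join [measurable (raw)]:
  fixes f :: "'a \<Rightarrow> real ^ 'd" and g :: "'a \<Rightarrow> real ^ 'm"
  assumes "f \<in> borel_measurable N" "g \<in> borel_measurable N"
  shows "(\<lambda>x. vec_join (f x) (g x)) \<in> borel_measurable N"
  using borel_measurable_continuous_on[OF continuous_on_vec_join borel_measurable_Pair[OF assms]] by simp

lemma vec_join_diff: "vec_join t y - vec_join s z = vec_join (t - s) (y - z :: real ^ 'm)"
  for t s :: "real ^ 'd"
  by (simp add: vec_eq_iff split_sum_all vec_join_def)

section \<open>Cubes and Lebesgue measure on the unit cube\<close>

lemma unit_cube_eq_cbox: "unit_cube = cbox 0 (\<chi> i. 1)"
  by (auto simp: unit_cube_def mem_box_cart)

lemma cube_eq_cbox: "cube = cbox (\<chi> i. -1) (\<chi> i. 1)"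
  by (auto simp: cube_def mem_box_cart)

lemma borel_unit_cube [measurable]: "unit_cube \<in> sets borel"
  and borel_cube [measurable]: "cube \<in> sets borel"
  by (simp_all add: unit_cube_eq_cbox cube_eq_cbox)

lemma emeasure_lborel_cbox_cart:
  fixes l u :: "real ^ 'n"
  assumes "\<And>i. l $ i \<le> u $ i"
  shows "emeasure lborel (cbox l u) = ennreal (\<Prod>i\<in>UNIV. u $ i - l $ i)"
  using assms by (subst emeasure_lborel_cbox; simp add: prod_Basis_cart inner_axis) (auto simp: Basis_cart inner_axis)

lemma emeasure_unit_cube: "emeasure lborel (unit_cube :: (real ^ 'n) set) = 1"
  unfolding unit_cube_eq_cbox by (subst emeasure_lborel_cbox_cart) auto

abbreviation cube_measure :: "(real ^ 'd) measure" where
  "cube_measure \<equiv> restrict_space lborel unit_cube"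

lemma finite_measure_cube_measure: "finite_measure cube_measure"
  by (rule finite_measureI) (simp add: emeasure_restrict_space space_restrict_space emeasure_unit_cube)

lemma nn_integral_cube_measure: "(\<integral>\<^sup>+t. f t \<partial>cube_measure) = (\<integral>\<^sup>+t. f t * indicator unit_cube t \<partial>lborel)"
  by (rule nn_integral_restrict_space) simp

lemma cube_subset_cball: "cube \<subseteq> cball (0 :: real ^ 'n) (sqrt CARD('n))"
proof
  fix z :: "real ^ 'n"
  assume "z \<in> cube"
  then have "(z $ i)\<^sup>2 \<le> 1" for i by (auto simp: cube_def abs_square_le_1 abs_le_iff)
  then have "(\<Sum>i\<in>UNIV. (z $ i)\<^sup>2) \<le> (\<Sum>i\<in>(UNIV :: 'n set). 1)" by (intro sum_mono) auto
  then show "z \<in> cball 0 (sqrt CARD('n))" by (simp add: norm_vec_def L2_set_def)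
qed

lemma cball_subset_cube: "cball (0 :: real ^ 'n) 1 \<subseteq> cube"
proof
  fix z :: "real ^ 'n"
  assume "z \<in> cball 0 1"
  then have "\<bar>z $ i\<bar> \<le> 1" for i using component_le_norm_cart[of z i] by simp
  then have "-1 \<le> z $ i \<and> z $ i \<le> 1" for i by (simp add: abs_le_iff minus_le_iff)
  then show "z \<in> cube" by (simp add: cube_def)
qed

locale affine_field = prob_space P for P :: "'w measure" +
  fixes U :: "real ^ 'd ^ 'd" and V :: "real ^ 'm ^ 'm" and X :: "real ^ 'd \<Rightarrow> 'w \<Rightarrow> real ^ 'm"
  assumes invertible: "invertible U" "invertible V"
    and contracting: "contracting U" "contracting V"
    and joint [measurable]: "(\<lambda>(t, \<omega>). X t \<omega>) \<in> borel_measurable (borel \<Otimes>\<^sub>M P)"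
    and scaling: "same_fdd P (\<lambda>t. X (U *v t)) (\<lambda>t \<omega>. V *v X t \<omega>)"
    and increments: "stationary_increments P X"
begin

abbreviation W :: "real ^ ('d + 'm) ^ ('d + 'm)" where "W \<equiv> block_diag U V"

lemma X_measurable [measurable (raw)]:
  assumes "f \<in> borel_measurable N" "g \<in> measurable N P"
  shows "(\<lambda>x. X (f x) (g x)) \<in> borel_measurable N"
  using measurable_compose[OF measurable_Pair[OF assms] joint] by simp

sublocale LP: pair_sigma_finite "lborel :: (real ^ 'd) measure" P ..

text \<open>The probability that (t, X(t)) lies in \<open>D\<close>, in an integral form ready for
  Fubini.\<close>

definition hit :: "(real ^ ('d + 'm)) set \<Rightarrow> real ^ 'd \<Rightarrow> ennreal" where
  "hit D t = (\<integral>\<^sup>+\<omega>. indicator D (vec_join t (X t \<omega>)) \<partial>P)"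

lemma hit_measurable [measurable]:
  assumes [measurable]: "D \<in> sets borel"
  shows "hit D \<in> borel_measurable borel"
  unfolding hit_def by measurable

text \<open>The intensity measure of \<tau>_X as a push-forward, which makes it a measure by
  construction; \<open>occupation_intensity_eq\<close> links it to the pathwise definition.\<close>

definition occ :: "(real ^ ('d + 'm)) measure" where
  "occ = distr (lborel \<Otimes>\<^sub>M P) borel (\<lambda>(t, \<omega>). vec_join t (X t \<omega>))"

lemma sets_occ [simp, measurable_cong]: "sets occ = sets borel"
  by (simp add: occ_def)

lemma emeasure_occ:
  assumes [measurable]: "D \<in> sets borel"
  shows "emeasure occ D = (\<integral>\<^sup>+t. hit D t \<partial>lborel)"
proof -
  have "emeasure occ D = (\<integral>\<^sup>+z. indicator D z \<partial>occ)" by simp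
  also have "\<dots> = (\<integral>\<^sup>+p. indicator D (vec_join (fst p) (X (fst p) (snd p))) \<partial>(lborel \<Otimes>\<^sub>M P))"
    unfolding occ_def by (subst nn_integral_distr) (auto simp: split_beta)
  also have "\<dots> = (\<integral>\<^sup>+t. hit D t \<partial>lborel)"
    unfolding hit_def by (subst nn_integral_fst[symmetric]) auto
  finally show ?thesis .
qed

lemma occupation_intensity_eq:
  assumes [measurable]: "D \<in> sets borel"
  shows "occupation_intensity P X D = emeasure occ D"
proof -
  have "occupation_intensity P X D = (\<integral>\<^sup>+\<omega>. \<integral>\<^sup>+t. indicator D (vec_join t (X t \<omega>)) \<partial>lborel \<partial>P)"
    unfolding occupation_intensity_def
  proof (rule nn_integral_cong)
    fix \<omega> assume [simp]: "\<omega> \<in> space P"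
    have [measurable]: "(\<lambda>t. X t \<omega>) \<in> borel_measurable borel" by measurable
    show "emeasure (occupation_measure (\<lambda>t. X t \<omega>)) D = (\<integral>\<^sup>+t. indicator D (vec_join t (X t \<omega>)) \<partial>lborel)"
    proof -
      have "emeasure (distr lborel borel (\<lambda>t. vec_join t (X t \<omega>))) D =
          (\<integral>\<^sup>+z. indicator D z \<partial>distr lborel borel (\<lambda>t. vec_join t (X t \<omega>)))"
        by (rule nn_integral_indicator[symmetric]) simp
      also have "\<dots> = (\<integral>\<^sup>+t. indicator D (vec_join t (X t \<omega>)) \<partial>lborel)"
        by (rule nn_integral_distr) measurable
      finally show ?thesis by (simp add: occupation_measure_eq_distr)
    qed
  qed
  also have "\<dots> = emeasure occ D"
    unfolding emeasure_occ[OF assms] hit_def by (rule LP.Fubini') measurable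
  finally show ?thesis .
qed

lemma distr_scaling: "distr P borel (X (U *v t)) = distr P borel (\<lambda>\<omega>. V *v X t \<omega>)"
proof -
  have "distr P (\<Pi>\<^sub>M s\<in>{t}. borel) (\<lambda>\<omega>. \<lambda>s\<in>{t}. X (U *v s) \<omega>) =
      distr P (\<Pi>\<^sub>M s\<in>{t}. borel) (\<lambda>\<omega>. \<lambda>s\<in>{t}. V *v X s \<omega>)"
    using scaling by (simp add: same_fdd_def)
  then have "distr (distr P (\<Pi>\<^sub>M s\<in>{t}. borel) (\<lambda>\<omega>. \<lambda>s\<in>{t}. X (U *v s) \<omega>)) borel (\<lambda>f. f t) =
      distr (distr P (\<Pi>\<^sub>M s\<in>{t}. borel) (\<lambda>\<omega>. \<lambda>s\<in>{t}. V *v X s \<omega>)) borel (\<lambda>f. f t)" by simp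
  then show ?thesis
    by (subst (asm) (1 2) distr_distr) (auto simp: o_def)
qed

lemma hit_scaling:
  assumes [measurable]: "D \<in> sets borel"
  shows "hit D (U *v t) = hit {z. W *v z \<in> D} t"
proof -
  have "hit D (U *v t) = (\<integral>\<^sup>+y. indicator D (vec_join (U *v t) y) \<partial>distr P borel (X (U *v t)))"
    unfolding hit_def by (subst nn_integral_distr) auto
  also have "\<dots> = (\<integral>\<^sup>+\<omega>. indicator D (vec_join (U *v t) (V *v X t \<omega>)) \<partial>P)"
    unfolding distr_scaling by (subst nn_integral_distr) auto
  also have "\<dots> = hit {z. W *v z \<in> D} t"
    unfolding hit_def by (simp add: block_diag_vec_join[symmetric] indicator_def)
  finally show ?thesis .
qed

text \<open>The substitution t -> U t produces the determinant. Since X(U t) has the law of V X(t),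
  it amounts to applying \<open>W\<close> to the points of the graph.\<close>

lemma emeasure_occ_scaling:
  assumes [measurable]: "D \<in> sets borel"
  shows "emeasure occ D = ennreal \<bar>det U\<bar> * emeasure occ {z. W *v z \<in> D}"
  by (simp add: emeasure_occ nn_integral_lborel_matrix[OF invertible(1), of "hit D"] hit_scaling)

lemma emeasure_occ_power:
  assumes "D \<in> sets borel"
  shows "emeasure occ D = ennreal (\<bar>det U\<bar> ^ k) * emeasure occ {z. matrix_power W k *v z \<in> D}"
  using assms
proof (induction k arbitrary: D)
  case 0
  then show ?case by (simp add: matrix_power_0)
next
  case (Suc k)
  note [measurable] = Suc.prems
  have "emeasure occ D = ennreal (\<bar>det U\<bar> ^ k) * emeasure occ {z. matrix_power W k *v z \<in> D}"
    by (rule Suc.IH[OF Suc.prems])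
  also have "emeasure occ {z. matrix_power W k *v z \<in> D} =
      ennreal \<bar>det U\<bar> * emeasure occ {z. matrix_power W (Suc k) *v z \<in> D}"
    by (subst emeasure_occ_scaling) (auto simp: matrix_power_Suc2 matrix_vector_mul_assoc[symmetric])
  finally show ?case by (simp add: ennreal_mult mult_ac)
qed

section \<open>Pairs of times and stationary increments\<close>

lemma distr_increments: "distr P borel (\<lambda>\<omega>. X t \<omega> - X s \<omega>) = distr P borel (X (t - s))"
  using increments by (simp add: stationary_increments_def)

lemma nn_integral_increments:
  assumes [measurable]: "D \<in> sets borel"
  shows "(\<integral>\<^sup>+\<omega>. indicator D (vec_join t (X t \<omega>) - vec_join s (X s \<omega>)) \<partial>P) = hit D (t - s)"
proof -
  have "(\<integral>\<^sup>+\<omega>. indicator D (vec_join t (X t \<omega>) - vec_join s (X s \<omega>)) \<partial>P) =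
      (\<integral>\<^sup>+y. indicator D (vec_join (t - s) y) \<partial>distr P borel (\<lambda>\<omega>. X t \<omega> - X s \<omega>))"
    by (subst nn_integral_distr) (auto simp: vec_join_diff)
  also have "\<dots> = hit D (t - s)"
    unfolding distr_increments hit_def by (subst nn_integral_distr) auto
  finally show ?thesis .
qed

text \<open>Kept random, with pi of the overview as its expectation, because smoothing and the
  Frostman argument are applied to single paths.\<close>

definition pair_mass :: "(real ^ ('d + 'm)) set \<Rightarrow> 'w \<Rightarrow> ennreal" where
  "pair_mass D \<omega> = (\<integral>\<^sup>+t. \<integral>\<^sup>+s. indicator D (vec_join t (X t \<omega>) - vec_join s (X s \<omega>)) \<partial>cube_measure \<partial>cube_measure)"

lemma measurable_cube_measure_id [measurable]: "(\<lambda>t. t) \<in> borel_measurable cube_measure"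
  by (rule measurable_restrict_space1) simp

sublocale N: finite_measure "cube_measure :: (real ^ 'd) measure"
  by (rule finite_measure_cube_measure)

sublocale NP: pair_sigma_finite "cube_measure :: (real ^ 'd) measure" P ..

lemma pair_mass_measurable [measurable]:
  assumes [measurable]: "D \<in> sets borel"
  shows "pair_mass D \<in> borel_measurable P"
  unfolding pair_mass_def by measurable

lemma nn_integral_pair_mass:
  assumes [measurable]: "D \<in> sets borel"
  shows "(\<integral>\<^sup>+\<omega>. pair_mass D \<omega> \<partial>P) = (\<integral>\<^sup>+t. \<integral>\<^sup>+s. hit D (t - s) \<partial>cube_measure \<partial>cube_measure)"
proof -
  have "(\<integral>\<^sup>+\<omega>. pair_mass D \<omega> \<partial>P) =
      (\<integral>\<^sup>+t. \<integral>\<^sup>+\<omega>. \<integral>\<^sup>+s. indicator D (vec_join t (X t \<omega>) - vec_join s (X s \<omega>)) \<partial>cube_measure \<partial>P \<partial>cube_measure)"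
    unfolding pair_mass_def by (rule NP.Fubini') measurable
  also have "\<dots> = (\<integral>\<^sup>+t. \<integral>\<^sup>+s. \<integral>\<^sup>+\<omega>. indicator D (vec_join t (X t \<omega>) - vec_join s (X s \<omega>)) \<partial>P \<partial>cube_measure \<partial>cube_measure)"
    by (intro nn_integral_cong NP.Fubini') measurable
  finally show ?thesis by (simp add: nn_integral_increments)
qed

text \<open>Differences of points of the unit cube lie in \<open>cube\<close>, and the outer
  integral has total mass 1.\<close>

lemma nn_integral_pair_mass_le:
  assumes [measurable]: "D \<in> sets borel"
  shows "(\<integral>\<^sup>+\<omega>. pair_mass D \<omega> \<partial>P) \<le> (\<integral>\<^sup>+t\<in>cube. hit D t \<partial>lborel)"
proof -
  have "(\<integral>\<^sup>+\<omega>. pair_mass D \<omega> \<partial>P) \<le> (\<integral>\<^sup>+t. (\<integral>\<^sup>+t\<in>cube. hit D t \<partial>lborel) \<partial>(cube_measure :: (real ^ 'd) measure))"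
    unfolding nn_integral_pair_mass[OF assms]
  proof (rule nn_integral_mono)
    fix t assume "t \<in> space (cube_measure :: (real ^ 'd) measure)"
    then have t: "t \<in> unit_cube" by (simp add: space_restrict_space)
    have "(\<integral>\<^sup>+s. hit D (t - s) \<partial>cube_measure) \<le> (\<integral>\<^sup>+s. hit D (t - s) * indicator cube (t - s) \<partial>lborel)"
      unfolding nn_integral_cube_measure
    proof (rule nn_integral_mono)
      show "hit D (t - s) * indicator unit_cube s \<le> hit D (t - s) * indicator cube (t - s)" for s
        using t by (auto simp: indicator_def unit_cube_def cube_def algebra_simps intro: add_mono)
          (smt (verit))+
    qed
    also have "\<dots> = (\<integral>\<^sup>+t\<in>cube. hit D t \<partial>lborel)"
      by (rule nn_integral_lborel_reflect[of "\<lambda>u. hit D u * indicator cube u"]) measurable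
    finally show "(\<integral>\<^sup>+s. hit D (t - s) \<partial>cube_measure) \<le> (\<integral>\<^sup>+t\<in>cube. hit D t \<partial>lborel)" .
  qed
  also have "\<dots> = (\<integral>\<^sup>+t\<in>cube. hit D t \<partial>lborel)"
    by (simp add: emeasure_restrict_space space_restrict_space emeasure_unit_cube)
  finally show ?thesis .
qed

text \<open>For t in the central cube \<open>I\<close> of side 1/2, every s at distance at most 1/4
  stays in the unit cube. As \<open>D\<close> reaches no further than 1/4, the inner integral over s
  is then the whole intensity of \<open>D\<close>; the factor is the volume of
  \<open>I\<close>.\<close>

lemma nn_integral_pair_mass_ge:
  assumes [measurable]: "D \<in> sets borel" and D: "D \<subseteq> cball 0 (1 / 4)"
  shows "ennreal ((1 / 2) ^ CARD('d)) * emeasure occ D \<le> (\<integral>\<^sup>+\<omega>. pair_mass D \<omega> \<partial>P)"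
proof -
  define I :: "(real ^ 'd) set" where "I = cbox (\<chi> i. 1 / 4) (\<chi> i. 3 / 4)"
  have [measurable]: "I \<in> sets borel" by (simp add: I_def)
  have I: "emeasure lborel I = ennreal ((1 / 2) ^ CARD('d))"
    unfolding I_def by (subst emeasure_lborel_cbox_cart) auto
  have ge: "emeasure occ D * indicator I t \<le> (\<integral>\<^sup>+s. hit D (t - s) \<partial>cube_measure)" for t
  proof (cases "t \<in> I")
    case True
    have "emeasure occ D = (\<integral>\<^sup>+s. hit D (t - s) \<partial>lborel)"
      unfolding emeasure_occ[OF assms(1)] by (rule nn_integral_lborel_reflect[symmetric]) measurable
    also have "\<dots> \<le> (\<integral>\<^sup>+s. hit D (t - s) \<partial>cube_measure)"
      unfolding nn_integral_cube_measure
    proof (rule nn_integral_mono)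
      fix s
      show "hit D (t - s) \<le> hit D (t - s) * indicator unit_cube s"
      proof (cases "norm (t - s) \<le> 1 / 4")
        case le: True
        have ts: "\<bar>t $ i - s $ i\<bar> \<le> 1 / 4" for i
          using component_le_norm_cart[of "t - s" i] le by simp
        then have "0 \<le> s $ i \<and> s $ i \<le> 1" for i
        proof -
          have "1 / 4 \<le> t $ i \<and> t $ i \<le> 3 / 4" using True by (simp add: I_def mem_box_cart)
          with ts[of i] show ?thesis by linarith
        qed
        then show ?thesis by (simp add: unit_cube_def)
      next
        case False
        then have "vec_join (t - s) y \<notin> D" for y
          using D norm_le_norm_vec_join(1)[of "t - s" y] by (force simp: subset_iff)
        then show ?thesis by (simp add: hit_def)
      qed
    qed
    finally show ?thesis using True by simp
  qed simp
  have "I \<subseteq> unit_cube"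
  proof
    fix t assume "t \<in> I"
    then have t: "1 / 4 \<le> t $ i \<and> t $ i \<le> 3 / 4" for i by (simp add: I_def mem_box_cart)
    have "0 \<le> t $ i \<and> t $ i \<le> 1" for i using t[of i] by linarith
    then show "t \<in> unit_cube" by (simp add: unit_cube_def)
  qed
  have "ennreal ((1 / 2) ^ CARD('d)) * emeasure occ D = (\<integral>\<^sup>+t. emeasure occ D * indicator I t \<partial>lborel)"
    by (simp add: nn_integral_cmult I) (simp add: mult.commute)
  also have "\<dots> = (\<integral>\<^sup>+t. emeasure occ D * indicator I t \<partial>cube_measure)"
    unfolding nn_integral_cube_measure
    using \<open>I \<subseteq> unit_cube\<close> by (intro nn_integral_cong) (auto simp: indicator_def)
  also have "\<dots> \<le> (\<integral>\<^sup>+\<omega>. pair_mass D \<omega> \<partial>P)"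
    unfolding nn_integral_pair_mass[OF assms(1)] by (intro nn_integral_mono ge)
  finally show ?thesis .
qed

end

subsection \<open>Upper bound for the dimension\<close>

lemma
  fixes A :: "real ^ 'n ^ 'm"
  assumes "invertible A"
  shows matrix_inv_right: "A ** matrix_inv A = mat 1" and matrix_inv_left: "matrix_inv A ** A = mat 1"
  using someI_ex[OF assms[unfolded invertible_def]] unfolding matrix_inv_def by auto

context affine_field
begin

abbreviation dU where "dU \<equiv> \<bar>det U\<bar>"

lemma invertible_W_power: "invertible (matrix_power W k)"
  by (intro invertible_matrix_power invertible_block_diag invertible)

lemma W_powers_small: "0 < \<epsilon> \<Longrightarrow> \<exists>K. \<forall>k\<ge>K. \<forall>z. norm (matrix_power W k *v z) \<le> \<epsilon> * norm z"
  by (intro powers_uniformly_small contracting_block_diag_powers contracting)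

lemma dU_pos: "0 < dU"
  using invertible(1) by (simp add: invertible_det_nz)

text \<open>Some power of \<open>U\<close> halves all norms, so it maps the ball of radius 2 into
  the unit ball. Comparing volumes gives |det U|^k 2^d <= 1.\<close>

lemma dU_less_1: "dU < 1"
proof -
  obtain k where k: "\<And>z. norm (matrix_power U k *v z) \<le> 1 / 2 * norm z"
    using powers_uniformly_small[OF contracting_powers_tendsto_0[OF contracting(1)], of "1 / 2"] by auto
  let ?b = "measure lborel (cball (0 :: real ^ 'd) 1)"
  have fin: "emeasure lborel (cball (0 :: real ^ 'd) 1) = ennreal ?b"
    by (intro emeasure_eq_ennreal_measure) (use emeasure_bounded_finite[of "cball (0 :: real ^ 'd) 1"] in force)
  have b: "0 < ?b" by (rule measure_unit_ball_pos)
  have det: "det (matrix_power U k) = det U ^ k" for k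
    by (induction k) (auto simp: matrix_power_0 matrix_power_Suc det_mul)
  have "emeasure lborel {z :: real ^ 'd. norm z \<le> 2 \<and> norm (mat 1 *v z) \<le> 2 * 1} = ennreal (2 ^ CARD('d) * flat_vol (mat 1 :: real ^ 'd ^ 'd) 1)"
    by (rule emeasure_flat_set_scaled) simp
  moreover have "flat_vol (mat 1 :: real ^ 'd ^ 'd) 1 = ?b" by (rule flat_vol_eq_ball) simp
  ultimately have two: "emeasure lborel (cball (0 :: real ^ 'd) 2) = ennreal (2 ^ CARD('d) * ?b)"
    by (simp add: cball_def dist_norm)
  have "ennreal (dU ^ k) * ennreal (2 ^ CARD('d) * ?b) =
      ennreal \<bar>det (matrix_power U k)\<bar> * (\<integral>\<^sup>+z. indicator (cball (0 :: real ^ 'd) 2) z \<partial>lborel)"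
    by (simp add: two det power_abs)
  also have "\<dots> \<le> ennreal \<bar>det (matrix_power U k)\<bar> * (\<integral>\<^sup>+z. indicator (cball 0 1) (matrix_power U k *v z) \<partial>lborel)"
  proof (intro mult_left_mono nn_integral_mono)
    show "indicator (cball 0 2) z \<le> (indicator (cball 0 1) (matrix_power U k *v z) :: ennreal)" for z
      using k[of z] by (auto simp: indicator_def)
  qed simp
  also have "\<dots> = (\<integral>\<^sup>+z. indicator (cball (0 :: real ^ 'd) 1) z \<partial>lborel)"
    by (rule nn_integral_lborel_matrix[symmetric]) (auto intro!: invertible_matrix_power invertible borel_measurable_indicator)
  finally have "ennreal (dU ^ k) * ennreal (2 ^ CARD('d) * ?b) \<le> ennreal ?b" by (simp add: fin)
  then have "dU ^ k * (2 ^ CARD('d) * ?b) \<le> ?b" by (simp add: ennreal_mult[symmetric])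
  then have le1: "dU ^ k * 2 ^ CARD('d) \<le> 1"
    using b by (simp add: mult.assoc[symmetric])
  have "(2 :: real) ^ CARD('d) > 1" by (intro one_less_power) auto
  show ?thesis
  proof (rule ccontr)
    assume "\<not> dU < 1"
    then have "1 \<le> dU ^ k" by (intro one_le_power) auto
    then have "1 * 2 ^ CARD('d) \<le> dU ^ k * 2 ^ CARD('d)" by (intro mult_right_mono) auto
    with le1 \<open>(2 :: real) ^ CARD('d) > 1\<close> show False by linarith
  qed
qed

text \<open>Markov's inequality: on the ball of radius r the sum of the two norms is at most 2
  r.\<close>

lemma nn_integral_pair_mass_cball_le:
  assumes \<gamma>: "0 < \<gamma>" and r: "0 < r"
  shows "(\<integral>\<^sup>+\<omega>. pair_mass (cball 0 r) \<omega> \<partial>P) \<le> ennreal ((2 * r) powr \<gamma>) *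
    (\<integral>\<^sup>+ t \<in> cube. (\<integral>\<^sup>+ \<omega>. ennreal ((norm t + norm (X t \<omega>)) powr (- \<gamma>)) \<partial>P) \<partial>lborel)"
proof -
  let ?f = "\<lambda>t \<omega>. ennreal ((norm t + norm (X t \<omega>)) powr (- \<gamma>))"
  \<comment> \<open>At t = 0 the base may vanish, and 0 to a negative power is 0 in HOL; this one
    time is a null set.\<close>
  have 1: "indicator (cball 0 r) (vec_join t (X t \<omega>)) \<le> ennreal ((2 * r) powr \<gamma>) * ?f t \<omega>"
    if "t \<noteq> 0" for t \<omega>
  proof (cases "vec_join t (X t \<omega>) \<in> cball 0 r")
    case True
    define b where "b = norm t + norm (X t \<omega>)"
    have "0 < b" using that by (simp add: b_def add_pos_nonneg)
    moreover have "b \<le> 2 * r"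
      using True norm_le_norm_vec_join(1)[of t "X t \<omega>"] norm_le_norm_vec_join(2)[of "X t \<omega>" t] by (simp add: b_def)
    ultimately have "b powr \<gamma> * b powr (- \<gamma>) \<le> (2 * r) powr \<gamma> * b powr (- \<gamma>)"
      using \<gamma> by (intro mult_right_mono powr_mono2) auto
    then have "1 \<le> (2 * r) powr \<gamma> * b powr (- \<gamma>)"
      using \<open>0 < b\<close> by (simp add: powr_add[symmetric])
    then have "ennreal 1 \<le> ennreal ((2 * r) powr \<gamma> * b powr (- \<gamma>))" by (rule ennreal_leI)
    then show ?thesis using True by (simp add: ennreal_mult b_def)
  qed simp
  have "hit (cball 0 r) t \<le> ennreal ((2 * r) powr \<gamma>) * (\<integral>\<^sup>+\<omega>. ?f t \<omega> \<partial>P)" if "t \<noteq> 0" for t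
  proof -
    have "hit (cball 0 r) t \<le> (\<integral>\<^sup>+\<omega>. ennreal ((2 * r) powr \<gamma>) * ?f t \<omega> \<partial>P)"
      unfolding hit_def by (intro nn_integral_mono 1 that)
    then show ?thesis by (simp add: nn_integral_cmult)
  qed
  moreover have "AE t in lborel. t \<noteq> (0 :: real ^ 'd)" by (rule AE_lborel_singleton)
  ultimately have AE: "AE t in lborel. hit (cball 0 r) t * indicator cube t \<le>
      ennreal ((2 * r) powr \<gamma>) * ((\<integral>\<^sup>+\<omega>. ?f t \<omega> \<partial>P) * indicator cube t)"
    by (auto simp: mult.assoc[symmetric] indicator_def)
  have "(\<integral>\<^sup>+\<omega>. pair_mass (cball 0 r) \<omega> \<partial>P) \<le> (\<integral>\<^sup>+t\<in>cube. hit (cball 0 r) t \<partial>lborel)"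
    by (rule nn_integral_pair_mass_le) simp
  also have "\<dots> \<le> (\<integral>\<^sup>+t. ennreal ((2 * r) powr \<gamma>) * ((\<integral>\<^sup>+\<omega>. ?f t \<omega> \<partial>P) * indicator cube t) \<partial>lborel)"
    by (intro nn_integral_mono_AE AE)
  also have "\<dots> = ennreal ((2 * r) powr \<gamma>) * (\<integral>\<^sup>+ t \<in> cube. (\<integral>\<^sup>+ \<omega>. ?f t \<omega> \<partial>P) \<partial>lborel)"
    by (rule nn_integral_cmult) measurable
  finally show ?thesis .
qed

text \<open>Projected to time, \<open>occ\<close> is Lebesgue measure, so its total mass is
  infinite; balls exhaust the space.\<close>

lemma emeasure_occ_ball_pos: "\<exists>R::nat. emeasure occ (cball 0 (real R)) \<noteq> 0"
proof (rule ccontr)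
  assume "\<not> ?thesis"
  then have "emeasure occ (\<Union>R::nat. cball 0 (real R)) = 0"
    by (intro emeasure_UN_eq_0) auto
  moreover have "(\<Union>R::nat. cball (0 :: real ^ ('d + 'm)) (real R)) = UNIV"
    by (auto intro: real_arch_simple)
  ultimately have "emeasure occ UNIV = 0" by simp
  moreover have "hit UNIV = (\<lambda>_. 1)" by (intro ext) (simp add: hit_def emeasure_space_1)
  then have "emeasure occ UNIV = (\<integral>\<^sup>+t. 1 \<partial>(lborel :: (real ^ 'd) measure))"
    by (subst emeasure_occ) simp_all
  ultimately show False by (simp add: emeasure_lborel_UNIV)
qed

text \<open>The graph is pulled back by \<open>A\<close>, which turns the image of a ball under
  \<open>A\<close> into the ball itself. The set \<open>E\<close> is then a ball of volume
  independent of \<open>A\<close>, while \<open>A\<close> maps differences of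
  \<open>K = flat_set A r\<close> into the ball of radius 2 r.\<close>

lemma pair_mass_autocorrelation:
  assumes \<omega>: "\<omega> \<in> space P" and R: "0 \<le> R" and r: "0 < r" and v: "0 < flat_vol A r"
    and A: "invertible A"
  shows "ennreal (flat_vol A r) * pair_mass {z. norm (matrix_inv A *v z) \<le> R} \<omega> \<le>
    emeasure lborel (cball (0 :: real ^ ('d + 'm)) (R + 2)) * pair_mass (cball 0 (2 * r)) \<omega>"
proof -
  note [simp] = \<omega>
  let ?B = "matrix_inv A"
  let ?g = "\<lambda>t. ?B *v vec_join t (X t \<omega>)"
  have AB: "A *v (?B *v z) = z" for z
    using A by (simp add: matrix_vector_mul_assoc matrix_inv_right)
  have "emeasure lborel (flat_set A r) *
      (\<integral>\<^sup>+t. \<integral>\<^sup>+s. indicator (cball 0 R) (?g t - ?g s) \<partial>cube_measure \<partial>cube_measure) \<le>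
    emeasure lborel (cball (0 :: real ^ ('d + 'm)) (R + 2)) *
      (\<integral>\<^sup>+t. \<integral>\<^sup>+s. indicator {z. norm (A *v z) \<le> 2 * r} (?g t - ?g s) \<partial>cube_measure \<partial>cube_measure)"
  proof (rule autocorrelation_le[OF finite_measure_cube_measure])
    show "?g \<in> borel_measurable cube_measure" by measurable
    show "d - k + l \<in> cball 0 (R + 2)" if "d \<in> cball 0 R" "k \<in> flat_set A r" "l \<in> flat_set A r" for d k l
      using that norm_triangle_ineq[of "d - k" l] norm_triangle_ineq4[of d k] by (simp add: flat_set_def)
    show "k - l \<in> {z. norm (A *v z) \<le> 2 * r}" if "k \<in> flat_set A r" "l \<in> flat_set A r" for k l
      using that norm_triangle_ineq4[of "A *v k" "A *v l"] by (simp add: flat_set_def matrix_vector_mult_diff_distrib)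
  qed (use v in \<open>auto simp: emeasure_flat_set\<close>)
  moreover have "indicator (cball 0 R) (?g t - ?g s) =
      (indicator {z. norm (?B *v z) \<le> R} (vec_join t (X t \<omega>) - vec_join s (X s \<omega>)) :: ennreal)" for t s
    by (simp add: indicator_def matrix_vector_mult_diff_distrib)
  moreover have "indicator {z. norm (A *v z) \<le> 2 * r} (?g t - ?g s) =
      (indicator (cball 0 (2 * r)) (vec_join t (X t \<omega>) - vec_join s (X s \<omega>)) :: ennreal)" for t s
    by (simp add: indicator_def matrix_vector_mult_diff_distrib AB)
  ultimately show ?thesis by (simp add: pair_mass_def emeasure_flat_set)
qed

text \<open>The exponent must be large for W^k to carry the chosen ball into the ball of radius 1/4
  required by \<open>nn_integral_pair_mass_ge\<close>; the radius r stays free.\<close>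

lemma flat_vol_le_of_integral:
  assumes \<gamma>: "0 < \<gamma>"
    and fin: "(\<integral>\<^sup>+ t \<in> cube. (\<integral>\<^sup>+ \<omega>. ennreal ((norm t + norm (X t \<omega>)) powr (- \<gamma>)) \<partial>P) \<partial>lborel) < \<infinity>"
  shows "\<exists>c>0. \<exists>K. \<forall>k\<ge>K. \<forall>r>0. c * (dU ^ k * flat_vol (matrix_power W k) r) \<le> r powr \<gamma>"
proof -
  obtain R0 :: nat where R0: "emeasure occ (cball 0 (real R0)) \<noteq> 0" using emeasure_occ_ball_pos by blast
  define R where "R = real R0"
  \<comment> \<open>Truncation at 1 yields a finite positive number at once.\<close>
  define p where "p = enn2real (min 1 (emeasure occ (cball 0 R)))"
  have p_eq: "ennreal p = min 1 (emeasure occ (cball 0 R))"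
    unfolding p_def by (intro ennreal_enn2real) (auto simp: min_less_iff_disj)
  then have p: "0 < p" using R0 unfolding R_def[symmetric]
    by (metis ennreal_eq_0_iff min_def not_less one_neq_zero)
  define I where "I = enn2real (\<integral>\<^sup>+ t \<in> cube. (\<integral>\<^sup>+ \<omega>. ennreal ((norm t + norm (X t \<omega>)) powr (- \<gamma>)) \<partial>P) \<partial>lborel)"
  have I: "(\<integral>\<^sup>+ t \<in> cube. (\<integral>\<^sup>+ \<omega>. ennreal ((norm t + norm (X t \<omega>)) powr (- \<gamma>)) \<partial>P) \<partial>lborel) = ennreal I"
    unfolding I_def using fin by (simp add: ennreal_enn2real infinity_ennreal_def)
  have I0: "0 \<le> I" by (simp add: I_def)
  define L where "L = measure lborel (cball (0 :: real ^ ('d + 'm)) (R + 2))"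
  have L: "emeasure lborel (cball (0 :: real ^ ('d + 'm)) (R + 2)) = ennreal L"
    unfolding L_def by (intro emeasure_eq_ennreal_measure) (use emeasure_bounded_finite[of "cball (0 :: real ^ ('d + 'm)) (R + 2)"] in force)
  have L0: "0 \<le> L" by (simp add: L_def)
  \<comment> \<open>R / (4 (R + 1)) is at most 1/4, and \<open>R + 1\<close> keeps the denominator
    positive.\<close>
  obtain K where K: "\<And>k z. k \<ge> K \<Longrightarrow> norm (matrix_power W k *v z) \<le> 1 / (4 * (R + 1)) * norm z"
    using W_powers_small[of "1 / (4 * (R + 1))"] by (auto simp: R_def)
  define h where "h = (1 / 2 :: real) ^ CARD('d)"
  have h: "0 < h" by (simp add: h_def)
  define q where "q = L * (4 powr \<gamma> * I) + 1"
  have q: "0 < q" unfolding q_def using L0 I0 by (intro add_nonneg_pos mult_nonneg_nonneg) auto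
  have main: "h * p / q * (dU ^ k * flat_vol (matrix_power W k) r) \<le> r powr \<gamma>" if k: "k \<ge> K" and r: "0 < r" for k r
  proof (cases "flat_vol (matrix_power W k) r = 0")
    case True
    then show ?thesis by simp
  next
    case False
    let ?A = "matrix_power W k" and ?v = "flat_vol (matrix_power W k) r"
    have v: "0 < ?v" using False flat_vol_nonneg by (simp add: order.strict_iff_order)
    let ?B = "matrix_inv ?A"
    have inv: "?B *v (?A *v z) = z" "?A *v (?B *v z) = z" for z
      using invertible_W_power[of k] by (simp_all add: matrix_vector_mul_assoc matrix_inv_left matrix_inv_right)
    define D where "D = {z. norm (?B *v z) \<le> R}"
    have D [measurable]: "D \<in> sets borel" unfolding D_def by measurable
    have "D \<subseteq> cball 0 (1 / 4)"
    proof
      fix z assume "z \<in> D"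
      then have "norm (?A *v (?B *v z)) \<le> 1 / (4 * (R + 1)) * R"
        using K[OF k, of "?B *v z"] by (simp add: D_def) (smt (verit) R_def divide_right_mono mult_nonneg_nonneg of_nat_0_le_iff)
      also have "\<dots> \<le> 1 / 4" by (simp add: R_def field_simps)
      finally show "z \<in> cball 0 (1 / 4)" by (simp add: inv)
    qed
    have "emeasure occ D = ennreal (dU ^ k) * emeasure occ {z. ?A *v z \<in> D}"
      by (rule emeasure_occ_power[OF D])
    also have "{z. ?A *v z \<in> D} = cball 0 R" by (auto simp: D_def inv)
    finally have occD: "emeasure occ D = ennreal (dU ^ k) * emeasure occ (cball 0 R)" .
    have "ennreal (?v * (h * (dU ^ k * p))) = ennreal ?v * (ennreal h * (ennreal (dU ^ k) * ennreal p))"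
      using h p v by (simp add: ennreal_mult)
    also have "\<dots> \<le> ennreal ?v * (ennreal h * emeasure occ D)"
      unfolding occD p_eq by (intro mult_left_mono) auto
    also have "\<dots> \<le> ennreal ?v * (\<integral>\<^sup>+\<omega>. pair_mass D \<omega> \<partial>P)"
      unfolding h_def by (intro mult_left_mono nn_integral_pair_mass_ge D \<open>D \<subseteq> cball 0 (1 / 4)\<close>) auto
    also have "\<dots> = (\<integral>\<^sup>+\<omega>. ennreal ?v * pair_mass D \<omega> \<partial>P)"
      by (simp add: nn_integral_cmult)
    also have "\<dots> \<le> (\<integral>\<^sup>+\<omega>. ennreal L * pair_mass (cball 0 (2 * r)) \<omega> \<partial>P)"
      using pair_mass_autocorrelation[OF _ _ r v invertible_W_power, of _ R]
      unfolding L D_def[symmetric] by (intro nn_integral_mono) (auto simp: R_def)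
    also have "\<dots> = ennreal L * (\<integral>\<^sup>+\<omega>. pair_mass (cball 0 (2 * r)) \<omega> \<partial>P)"
      by (rule nn_integral_cmult) simp
    also have "\<dots> \<le> ennreal L * (ennreal ((2 * (2 * r)) powr \<gamma>) * ennreal I)"
      unfolding I[symmetric] using r \<gamma> by (intro mult_left_mono nn_integral_pair_mass_cball_le) auto
    also have "\<dots> = ennreal (L * ((4 * r) powr \<gamma> * I))"
      using L0 I0 by (simp add: ennreal_mult)
    finally have "?v * (h * (dU ^ k * p)) \<le> L * ((4 * r) powr \<gamma> * I)"
      using L0 I0 by simp
    also have "\<dots> = (L * (4 powr \<gamma> * I)) * r powr \<gamma>" using r by (simp add: powr_mult)
    also have "\<dots> \<le> q * r powr \<gamma>" unfolding q_def by (intro mult_right_mono) auto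
    finally show ?thesis using q by (simp add: field_simps)
  qed
  have "0 < h * p / q" using h p q by simp
  then show ?thesis using main by blast
qed

text \<open>By its definition the exponent is either n or an infimum over \<open>R\<close>, so
  \<delta> has to be compared with n and with every member of \<open>R\<close>.\<close>

lemma le_s_exponent:
  assumes fin: "\<And>\<gamma>. 0 < \<gamma> \<Longrightarrow> \<gamma> < \<delta> \<Longrightarrow>
      (\<integral>\<^sup>+ t \<in> cube. (\<integral>\<^sup>+ \<omega>. ennreal ((norm t + norm (X t \<omega>)) powr (- \<gamma>)) \<partial>P) \<partial>lborel) < \<infinity>"
  shows "\<delta> \<le> s_exponent W dU"
proof -
  let ?n = "real CARD('d + 'm)"
  let ?\<phi> = "\<lambda>k. singular_value_function (matrix_power W k)"
  define R where "R = {r. 0 < r \<and> r \<le> ?n \<and> (\<lambda>k. ?\<phi> k r / dU ^ k) \<longlonglongrightarrow> 0}"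
  have s: "s_exponent W dU = (if R = {} then ?n else Inf R)"
    by (simp only: s_exponent_def R_def Let_def)
  \<comment> \<open>With k fixed and r tending to 0 the volume decays no faster than r^n, which is
    incompatible with a bound by r^\<gamma> for \<gamma> > n.\<close>
  have le_n: "\<delta> \<le> ?n"
  proof (rule ccontr)
    assume "\<not> \<delta> \<le> ?n"
    then obtain \<gamma> where \<gamma>: "?n < \<gamma>" "\<gamma> < \<delta>" using dense[of ?n \<delta>] by auto
    then have \<gamma>0: "0 < \<gamma>" by (meson of_nat_0_le_iff order_le_less_trans)
    obtain c K where c: "0 < c" and K: "\<And>r. 0 < r \<Longrightarrow> c * (dU ^ K * flat_vol (matrix_power W K) r) \<le> r powr \<gamma>"
      using flat_vol_le_of_integral[OF \<gamma>0 fin[OF \<gamma>0 \<gamma>(2)]] by blast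
    let ?A = "matrix_power W K"
    define a where "a = onorm ((*v) ?A) + 1"
    have bl: "bounded_linear ((*v) ?A)" by (simp add: linear_conv_bounded_linear[symmetric])
    have a: "1 \<le> a" using onorm_pos_le[OF bl] by (simp add: a_def)
    have Aa: "norm (?A *v z) \<le> a * norm z" for z
      using onorm[OF bl, of z] by (simp add: a_def distrib_right add_increasing2)
    let ?b = "measure lborel (cball (0 :: real ^ ('d + 'm)) 1)"
    have b: "0 < ?b" by (rule measure_unit_ball_pos)
    have v: "r ^ CARD('d + 'm) * ?b \<le> flat_vol ?A (a * r)" if r: "0 < r" "r \<le> 1" for r
    proof -
      have "ennreal (r ^ CARD('d + 'm) * flat_vol (mat 1 :: real ^ ('d + 'm) ^ ('d + 'm)) 1) =
          emeasure lborel {z :: real ^ ('d + 'm). norm z \<le> r \<and> norm (mat 1 *v z) \<le> r * 1}"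
        by (rule emeasure_flat_set_scaled[symmetric, OF r(1)])
      also have "\<dots> \<le> emeasure lborel (flat_set ?A (a * r))"
      proof (rule emeasure_mono)
        show "{z :: real ^ ('d + 'm). norm z \<le> r \<and> norm (mat 1 *v z) \<le> r * 1} \<subseteq> flat_set ?A (a * r)"
          using r a Aa by (auto simp: flat_set_def intro: order_trans[OF Aa])
      qed simp
      also have "flat_vol (mat 1 :: real ^ ('d + 'm) ^ ('d + 'm)) 1 = ?b" by (rule flat_vol_eq_ball) simp
      finally show ?thesis by (simp add: emeasure_flat_set)
    qed
    define e where "e = c * (dU ^ K * ?b) / a powr \<gamma>"
    have e: "0 < e" unfolding e_def using c dU_pos b a by (intro divide_pos_pos mult_pos_pos) auto
    have le: "e \<le> r powr (\<gamma> - ?n)" if r: "0 < r" "r \<le> 1" for r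
    proof -
      have "c * (dU ^ K * (r ^ CARD('d + 'm) * ?b)) \<le> c * (dU ^ K * flat_vol ?A (a * r))"
        using c dU_pos by (intro mult_left_mono v r) auto
      also have "\<dots> \<le> (a * r) powr \<gamma>" using a r by (intro K) auto
      also have "\<dots> = a powr \<gamma> * r powr \<gamma>" using a r by (simp add: powr_mult)
      also have "r powr \<gamma> = r powr (\<gamma> - ?n) * r ^ CARD('d + 'm)"
        using r by (simp add: powr_realpow[symmetric] powr_add[symmetric])
      finally have "r ^ CARD('d + 'm) * (c * (dU ^ K * ?b)) \<le> r ^ CARD('d + 'm) * (a powr \<gamma> * r powr (\<gamma> - ?n))"
        by (simp only: mult_ac)
      then have "c * (dU ^ K * ?b) \<le> a powr \<gamma> * r powr (\<gamma> - ?n)"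
        using r by (subst (asm) mult_le_cancel_left_pos) auto
      then show ?thesis using a by (simp add: e_def divide_le_eq mult.commute)
    qed
    \<comment> \<open>Makes r^(\<gamma> - n) at most e / 2, while \<open>le\<close> demands at least
      e.\<close>
    define r where "r = min 1 ((e / 2) powr (1 / (\<gamma> - ?n)))"
    have "0 < r" "r \<le> 1" using e by (auto simp: r_def)
    then have "e \<le> r powr (\<gamma> - ?n)" by (rule le)
    also have "\<dots> \<le> ((e / 2) powr (1 / (\<gamma> - ?n))) powr (\<gamma> - ?n)"
      using \<gamma> \<open>0 < r\<close> by (intro powr_mono2) (auto simp: r_def)
    also have "\<dots> = e / 2" using \<gamma> e by (simp add: powr_powr)
    finally show False using e by simp
  qed
  have "\<delta> \<le> \<gamma>" if "\<gamma> \<in> R" for \<gamma>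
  proof (rule ccontr)
    assume "\<not> \<delta> \<le> \<gamma>"
    then have \<gamma>: "0 < \<gamma>" "\<gamma> \<le> CARD('d + 'm)" "\<gamma> < \<delta>" using that by (auto simp: R_def)
    obtain c K where c: "0 < c" and K: "\<And>k r. K \<le> k \<Longrightarrow> 0 < r \<Longrightarrow> c * (dU ^ k * flat_vol (matrix_power W k) r) \<le> r powr \<gamma>"
      using flat_vol_le_of_integral[OF \<gamma>(1) fin[OF \<gamma>(1,3)]] by blast
    define h where "h = (2 / sqrt CARD('d + 'm)) ^ CARD('d + 'm)"
    have h: "0 < h"
      unfolding h_def by (intro zero_less_power divide_pos_pos real_sqrt_gt_zero of_nat_0_less_iff[THEN iffD2] zero_less_card_finite) simp
    \<comment> \<open>At the radius where volume and singular value function are comparable, the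
      upper bound on the volume becomes a lower bound on \<phi> / x^k that does not depend on
      k.\<close>
    have ge: "h * c \<le> ?\<phi> k \<gamma> / dU ^ k" if k: "K \<le> k" for k
    proof -
      obtain r where r: "0 < r" "h * r powr \<gamma> \<le> ?\<phi> k \<gamma> * flat_vol (matrix_power W k) r"
        using singular_value_function_flat_vol(2)[OF invertible_W_power \<gamma>(1,2)] unfolding h_def by blast
      let ?v = "flat_vol (matrix_power W k) r"
      have \<phi>: "0 < ?\<phi> k \<gamma>" by (rule singular_value_function_pos[OF invertible_W_power \<gamma>(1,2)])
      have "0 < h * r powr \<gamma>" using h r by simp
      then have v: "0 < ?v" using r \<phi> by (smt (verit) zero_less_mult_pos)
      have "h * (c * (dU ^ k * ?v)) \<le> h * r powr \<gamma>" using h by (intro mult_left_mono K k r) auto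
      with r have "(h * c * dU ^ k) * ?v \<le> ?\<phi> k \<gamma> * ?v" by (simp add: mult_ac)
      then have "h * c * dU ^ k \<le> ?\<phi> k \<gamma>" using v by simp
      then show ?thesis using dU_pos by (simp add: le_divide_eq)
    qed
    have "(\<lambda>k. ?\<phi> k \<gamma> / dU ^ k) \<longlonglongrightarrow> 0" using that by (simp add: R_def)
    then have "h * c \<le> 0" by (rule LIMSEQ_le_const) (use ge in blast)
    then show False using h c by (simp add: mult_le_0_iff)
  qed
  then show ?thesis unfolding s using le_n by (auto intro: cInf_greatest)
qed

subsection \<open>Lower bound for the dimension\<close>

text \<open>The origin is a fixed point of \<open>W\<close> and belongs to no peeled piece, so it
  must be negligible. Only t = 0 can contribute to it.\<close>

lemma emeasure_occ_0: "emeasure occ {0} = 0"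
proof -
  have "hit {0} t = 0" if "t \<noteq> 0" for t
  proof -
    have "vec_join t y \<noteq> 0" for y :: "real ^ 'm"
      using norm_le_norm_vec_join(1)[of t y] that by auto
    then show ?thesis by (simp add: hit_def)
  qed
  moreover have "AE t in lborel. t \<noteq> (0 :: real ^ 'd)" by (rule AE_lborel_singleton)
  ultimately have "AE t in lborel. hit {0} t = 0" by auto
  then show ?thesis by (simp add: emeasure_occ nn_integral_0_iff_AE)
qed

text \<open>The sets \<open>W\<^sup>k(cube)\<close> need not be nested, hence the largest \<open>k\<close> is taken.\<close>

lemma cube_peel:
  assumes "z \<in> cube" "z \<noteq> 0"
  shows "\<exists>k q. q \<in> cube - (*v) W ` cube \<and> z = matrix_power W k *v q"
proof -
  let ?n = "sqrt CARD('d + 'm)"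
  have n: "0 < ?n" using zero_less_card_finite[where 'a="'d + 'm"] by (simp only: real_sqrt_gt_0_iff of_nat_0_less_iff)
  define Z where "Z = {k. z \<in> (*v) (matrix_power W k) ` cube}"
  \<comment> \<open>Points of the cube have norm at most \<open>?n\<close>, so powers beyond
    \<open>K\<close> send them to norm at most half that of z.\<close>
  define \<epsilon> where "\<epsilon> = norm z / (2 * ?n)"
  have "0 < \<epsilon>" unfolding \<epsilon>_def using assms n by (intro divide_pos_pos mult_pos_pos) auto
  then obtain K where K: "\<And>k q. K \<le> k \<Longrightarrow> norm (matrix_power W k *v q) \<le> \<epsilon> * norm q"
    using W_powers_small by blast
  have "k < K" if kZ: "k \<in> Z" for k
  proof (rule ccontr)
    assume "\<not> k < K"
    obtain q where q: "q \<in> cube" "z = matrix_power W k *v q" using kZ by (auto simp: Z_def)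
    have "norm q \<le> ?n" using q cube_subset_cball[where 'n="'d + 'm"] by auto
    have "norm z \<le> \<epsilon> * norm q" using K[of k q] q \<open>\<not> k < K\<close> by simp
    also have "\<dots> \<le> \<epsilon> * ?n" using \<open>0 < \<epsilon>\<close> \<open>norm q \<le> ?n\<close> by (intro mult_left_mono) auto
    also have "\<dots> = norm z / 2" unfolding \<epsilon>_def using n by (simp only: field_simps) simp
    finally show False using assms by simp
  qed
  then have fin: "finite Z" by (metis bounded_nat_set_is_finite)
  have "0 \<in> Z" using assms by (simp add: Z_def matrix_power_0)
  then have "Z \<noteq> {}" by blast
  then have k: "Max Z \<in> Z" "Suc (Max Z) \<notin> Z"
    using Max_in[OF fin] Max_ge[OF fin, of "Suc (Max Z)"] by auto
  then obtain q where q: "q \<in> cube" "z = matrix_power W (Max Z) *v q" by (auto simp: Z_def)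
  have "q \<notin> (*v) W ` cube"
  proof
    assume "q \<in> (*v) W ` cube"
    then obtain p where p: "p \<in> cube" "q = W *v p" by blast
    have "z = matrix_power W (Suc (Max Z)) *v p"
      by (simp only: q(2) p(2) matrix_power_Suc2 matrix_vector_mul_assoc[symmetric])
    then have "Suc (Max Z) \<in> Z" unfolding Z_def using p(1) by blast
    then show False using k(2) by simp
  qed
  then show ?thesis using q by blast
qed

lemma borel_cube_diff [measurable]: "cube - (*v) W ` cube \<in> sets borel"
proof -
  have "compact ((*v) W ` cube)"
    by (intro compact_continuous_image linear_continuous_on) (auto simp: linear_conv_bounded_linear[symmetric] cube_eq_cbox)
  then show ?thesis by (intro sets.Diff borel_cube borel_closed compact_imp_closed)
qed

text \<open>Pulled back by W^k, the piece lies in the region where the intensity has bounded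
  density. There it is contained in a flattened ball of radius \<open>n\<close>, since the cube lies
  in the ball of radius \<open>n\<close>; the pull-back itself costs the factor x^k.\<close>

lemma emeasure_occ_piece_le:
  assumes C0: "0 < C0" "\<And>A. A \<in> sets borel \<Longrightarrow> A \<subseteq> cube - (*v) W ` cube \<Longrightarrow>
      emeasure occ A \<le> ennreal C0 * emeasure lborel A"
    and r: "0 < r"
  defines "n \<equiv> sqrt CARD('d + 'm)"
  shows "emeasure occ {z \<in> cball 0 r. matrix_inv (matrix_power W k) *v z \<in> cube - (*v) W ` cube} \<le>
    ennreal (C0 * n ^ CARD('d + 'm) * (dU ^ k * flat_vol (matrix_power W k) (r / n)))"
proof -
  let ?A = "matrix_power W k"
  define S where "S = cube - (*v) W ` cube"
  have [measurable]: "S \<in> sets borel" unfolding S_def by (rule borel_cube_diff)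
  define D where "D = {z \<in> cball 0 r. matrix_inv ?A *v z \<in> S}"
  have D: "D \<in> sets borel" unfolding D_def by measurable
  have n: "0 < n" unfolding n_def using zero_less_card_finite[where 'a="'d + 'm"] by (simp only: real_sqrt_gt_0_iff of_nat_0_less_iff)
  have inv: "matrix_inv ?A *v (?A *v z) = z" for z
    using invertible_W_power[of k] by (simp add: matrix_vector_mul_assoc matrix_inv_left)
  have pre: "{z. ?A *v z \<in> D} = {z \<in> S. norm (?A *v z) \<le> r}" by (auto simp: D_def inv)
  have "emeasure occ {z. ?A *v z \<in> D} \<le> ennreal C0 * emeasure lborel {z. ?A *v z \<in> D}"
  proof (rule C0(2))
    show "{z. ?A *v z \<in> D} \<in> sets borel" unfolding pre by measurable
    show "{z. ?A *v z \<in> D} \<subseteq> cube - (*v) W ` cube" unfolding pre S_def by auto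
  qed
  also have "\<dots> \<le> ennreal C0 * emeasure lborel {z. norm z \<le> n \<and> norm (?A *v z) \<le> n * (r / n)}"
  proof (intro mult_left_mono emeasure_mono)
    show "{z. ?A *v z \<in> D} \<subseteq> {z. norm z \<le> n \<and> norm (?A *v z) \<le> n * (r / n)}"
      unfolding pre S_def using n cube_subset_cball[where 'n="'d + 'm"] by (auto simp: n_def)
  qed measurable
  also have "\<dots> = ennreal (C0 * (n ^ CARD('d + 'm) * flat_vol ?A (r / n)))"
    unfolding emeasure_flat_set_scaled[OF n] using C0 n by (intro ennreal_mult[symmetric]) auto
  finally have le: "emeasure occ {z. ?A *v z \<in> D} \<le> ennreal (C0 * (n ^ CARD('d + 'm) * flat_vol ?A (r / n)))" .
  have "emeasure occ D = ennreal (dU ^ k) * emeasure occ {z. ?A *v z \<in> D}"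
    by (rule emeasure_occ_power[OF D])
  also have "\<dots> \<le> ennreal (dU ^ k) * ennreal (C0 * (n ^ CARD('d + 'm) * flat_vol ?A (r / n)))"
    by (intro mult_left_mono le) auto
  also have "\<dots> = ennreal (C0 * n ^ CARD('d + 'm) * (dU ^ k * flat_vol ?A (r / n)))"
    using C0 n by (subst ennreal_mult[symmetric]) (auto simp: mult_ac)
  finally show ?thesis by (simp only: D_def S_def)
qed

text \<open>The quantity x^k v(r / n) is bounded both by a multiple of x^k and by a multiple of
  r^\<gamma>. A weighted geometric mean of the two bounds decays geometrically in k and still has a
  power of r.\<close>

lemma nn_integral_pair_mass_le_powr:
  assumes bci: "bci_condition P X W" and C: "0 < C"
    "\<And>k r. 0 < r \<Longrightarrow> dU ^ k * flat_vol (matrix_power W k) r \<le> C * r powr \<gamma>"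
    and \<beta>: "0 < \<beta>" "\<beta> < \<gamma>"
  shows "\<exists>C'\<ge>0. \<forall>r. 0 < r \<longrightarrow> r \<le> 1 \<longrightarrow> (\<integral>\<^sup>+\<omega>. pair_mass (cball 0 r) \<omega> \<partial>P) \<le> ennreal (C' * r powr \<beta>)"
proof -
  obtain C0 where "0 < C0" and bound: "\<forall>A \<in> sets borel. A \<subseteq> cube - (*v) W ` cube \<longrightarrow>
      occupation_intensity P X A \<le> ennreal C0 * emeasure lborel A"
    using bci unfolding bci_condition_def by blast
  have C0: "0 < C0" "\<And>A. A \<in> sets borel \<Longrightarrow> A \<subseteq> cube - (*v) W ` cube \<Longrightarrow>
      emeasure occ A \<le> ennreal C0 * emeasure lborel A"
    using \<open>0 < C0\<close> bound by (auto simp: occupation_intensity_eq)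
  define n where "n = sqrt CARD('d + 'm)"
  have card: "0 < CARD('d + 'm)" by (rule zero_less_card_finite)
  have n: "1 \<le> n" unfolding n_def using card by (simp only: real_sqrt_ge_1_iff)
  define \<omega> where "\<omega> = measure lborel (cball (0 :: real ^ ('d + 'm)) 1)"
  have \<omega>: "0 < \<omega>" unfolding \<omega>_def by (rule measure_unit_ball_pos)
  \<comment> \<open>The weight for which (r^\<gamma>)^\<theta> = r^\<beta>; the remaining power x^(1
    - \<theta>) is the ratio \<open>q\<close> of the series over the pieces.\<close>
  define \<theta> where "\<theta> = \<beta> / \<gamma>"
  have \<theta>: "0 < \<theta>" "\<theta> < 1" "\<gamma> * \<theta> = \<beta>" using \<beta> by (auto simp: \<theta>_def)
  define q where "q = dU powr (1 - \<theta>)"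
  have q: "0 \<le> q" "q < 1"
    using dU_pos dU_less_1 \<theta> powr_less_mono2[of "1 - \<theta>" dU 1] by (auto simp: q_def)
  define E where "E = C0 * n ^ CARD('d + 'm) * (\<omega> powr (1 - \<theta>) * C powr \<theta>)"
  have E: "0 \<le> E" unfolding E_def using C0 n by auto
  have main: "(\<integral>\<^sup>+\<omega>. pair_mass (cball 0 r) \<omega> \<partial>P) \<le> ennreal (E / (1 - q) * r powr \<beta>)" if r: "0 < r" "r \<le> 1" for r
  proof -
    define A where "A k = {z \<in> cball 0 r. matrix_inv (matrix_power W k) *v z \<in> cube - (*v) W ` cube}" for k
    have A [measurable]: "A k \<in> sets borel" for k unfolding A_def by measurable
    have occA: "emeasure occ (A k) \<le> ennreal (E * r powr \<beta> * q ^ k)" for k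
    proof -
      define f where "f = dU ^ k * flat_vol (matrix_power W k) (r / n)"
      have f0: "0 \<le> f" by (simp add: f_def)
      have f1: "f \<le> \<omega> * dU ^ k"
        unfolding f_def \<omega>_def using flat_vol_le_ball[of "matrix_power W k" "r / n"]
        by (subst mult.commute) (intro mult_right_mono, auto)
      have "f \<le> C * (r / n) powr \<gamma>" unfolding f_def using r n by (intro C(2)) auto
      also have "\<dots> \<le> C * r powr \<gamma>"
        using C r n \<beta> by (intro mult_left_mono powr_mono2) (auto simp: divide_le_eq mult_le_cancel_left1)
      finally have f2: "f \<le> C * r powr \<gamma>" .
      have dUk: "(dU ^ k) powr (1 - \<theta>) = q ^ k"
        by (induction k) (auto simp: q_def powr_mult)
      have "f = f powr (1 - \<theta>) * f powr \<theta>" using f0 by (simp add: powr_add[symmetric])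
      also have "\<dots> \<le> (\<omega> * dU ^ k) powr (1 - \<theta>) * (C * r powr \<gamma>) powr \<theta>"
        using f0 f1 f2 \<theta> by (intro mult_mono powr_mono2) auto
      also have "\<dots> = (\<omega> powr (1 - \<theta>) * q ^ k) * (C powr \<theta> * r powr \<beta>)"
        using \<omega> C r \<theta>(3) by (simp add: powr_mult dUk powr_powr)
      finally have f3: "f \<le> (\<omega> powr (1 - \<theta>) * q ^ k) * (C powr \<theta> * r powr \<beta>)" .
      have "emeasure occ (A k) \<le> ennreal (C0 * n ^ CARD('d + 'm) * f)"
        unfolding A_def f_def n_def by (rule emeasure_occ_piece_le[OF C0 r(1)])
      also have "\<dots> \<le> ennreal (C0 * n ^ CARD('d + 'm) * ((\<omega> powr (1 - \<theta>) * q ^ k) * (C powr \<theta> * r powr \<beta>)))"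
        using C0 n by (intro ennreal_leI mult_left_mono f3) auto
      also have "C0 * n ^ CARD('d + 'm) * ((\<omega> powr (1 - \<theta>) * q ^ k) * (C powr \<theta> * r powr \<beta>)) = E * r powr \<beta> * q ^ k"
        by (simp only: E_def mult_ac)
      finally show ?thesis .
    qed
    \<comment> \<open>Since r <= 1 the ball lies in \<open>cube\<close>, so \<open>cube_peel\<close>
      reaches every point except the origin.\<close>
    have sub: "cball 0 r \<subseteq> {0} \<union> (\<Union>k. A k)"
    proof
      fix z :: "real ^ ('d + 'm)"
      assume z: "z \<in> cball 0 r"
      show "z \<in> {0} \<union> (\<Union>k. A k)"
      proof (cases "z = 0")
        case False
        have "z \<in> cube" using z r cball_subset_cube[where 'n="'d + 'm"] by auto
        then obtain k p where kp: "p \<in> cube - (*v) W ` cube" "z = matrix_power W k *v p"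
          using cube_peel False by blast
        then have "matrix_inv (matrix_power W k) *v z = p"
          using invertible_W_power[of k] by (simp add: matrix_vector_mul_assoc matrix_inv_left)
        then have "z \<in> A k" using z kp by (simp add: A_def)
        then show ?thesis by blast
      qed simp
    qed
    have "(\<integral>\<^sup>+\<omega>. pair_mass (cball 0 r) \<omega> \<partial>P) \<le> (\<integral>\<^sup>+t\<in>cube. hit (cball 0 r) t \<partial>lborel)"
      by (rule nn_integral_pair_mass_le) simp
    also have "\<dots> \<le> (\<integral>\<^sup>+t. hit (cball 0 r) t \<partial>lborel)"
      by (intro nn_integral_mono) (auto simp: indicator_def)
    also have "\<dots> = emeasure occ (cball 0 r)" by (simp add: emeasure_occ)
    also have "\<dots> \<le> emeasure occ ({0} \<union> (\<Union>k. A k))"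
      by (rule emeasure_mono[OF sub]) simp
    also have "\<dots> \<le> emeasure occ {0} + emeasure occ (\<Union>k. A k)"
      by (rule emeasure_subadditive) auto
    also have "\<dots> \<le> (\<Sum>k. emeasure occ (A k))"
    proof -
      have "range A \<subseteq> sets occ" using A by auto
      then show ?thesis
        unfolding emeasure_occ_0 add_0 by (rule emeasure_subadditive_countably)
    qed
    also have "\<dots> \<le> (\<Sum>k. ennreal (E * r powr \<beta> * q ^ k))"
      by (intro suminf_le occA) auto
    also have "\<dots> = ennreal (\<Sum>k. E * r powr \<beta> * q ^ k)"
      using E q by (intro suminf_ennreal2 summable_mult summable_geometric) auto
    also have "(\<Sum>k. E * r powr \<beta> * q ^ k) = E / (1 - q) * r powr \<beta>"
      using q by (subst suminf_mult) (auto simp: suminf_geometric)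
    finally show ?thesis .
  qed
  moreover have "0 \<le> E / (1 - q)" using E q by simp
  ultimately show ?thesis by blast
qed

text \<open>The expected dyadic sum is dominated by a geometric series of ratio 2^(\<gamma> -
  \<beta>), hence the sum is almost surely finite. All \<open>s\<close> share one null set, because
  the exponent later extracted from the dimension depends on the path.\<close>

lemma AE_hausdorff_premeasure_pos:
  assumes C: "0 \<le> C" "\<And>r. 0 < r \<Longrightarrow> r \<le> 1 \<Longrightarrow> (\<integral>\<^sup>+\<omega>. pair_mass (cball 0 r) \<omega> \<partial>P) \<le> ennreal (C * r powr \<beta>)"
    and \<gamma>: "0 < \<gamma>" "\<gamma> < \<beta>"
  shows "AE \<omega> in P. \<forall>s. 0 \<le> s \<longrightarrow> s \<le> \<gamma> \<longrightarrow>
    0 < hausdorff_premeasure s 1 (graph_over unit_cube (\<lambda>t. X t \<omega>))"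
proof -
  let ?F = "\<lambda>\<omega>. \<Sum>i. ennreal ((2 ^ i) powr \<gamma>) * pair_mass (cball 0 (1 / 2 ^ i)) \<omega>"
  define q where "q = (2 :: real) powr (\<gamma> - \<beta>)"
  have q: "0 \<le> q" "q < 1" using \<gamma> powr_less_mono[of "\<gamma> - \<beta>" 0 2] by (auto simp: q_def)
  have term_le: "ennreal ((2 ^ i) powr \<gamma>) * (\<integral>\<^sup>+\<omega>. pair_mass (cball 0 (1 / 2 ^ i)) \<omega> \<partial>P) \<le> ennreal (C * q ^ i)" for i :: nat
  proof -
    have "ennreal ((2 ^ i) powr \<gamma>) * (\<integral>\<^sup>+\<omega>. pair_mass (cball 0 (1 / 2 ^ i)) \<omega> \<partial>P) \<le>
        ennreal ((2 ^ i) powr \<gamma>) * ennreal (C * (1 / 2 ^ i) powr \<beta>)"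
      by (intro mult_left_mono C(2)) auto
    also have "\<dots> = ennreal ((2 ^ i) powr \<gamma> * (C * (1 / 2 ^ i) powr \<beta>))"
      using C by (intro ennreal_mult[symmetric]) auto
    also have "(2 ^ i) powr \<gamma> * (C * (1 / 2 ^ i) powr \<beta>) = C * q ^ i"
    proof -
      have "q ^ i = (2 ^ i) powr (\<gamma> - \<beta>)" unfolding q_def by (induction i) (auto simp: powr_mult)
      then show ?thesis by (simp add: powr_divide powr_diff)
    qed
    finally show ?thesis .
  qed
  have "(\<integral>\<^sup>+\<omega>. ?F \<omega> \<partial>P) = (\<Sum>i. ennreal ((2 ^ i) powr \<gamma>) * (\<integral>\<^sup>+\<omega>. pair_mass (cball 0 (1 / 2 ^ i)) \<omega> \<partial>P))"
    by (simp add: nn_integral_suminf nn_integral_cmult)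
  also have "\<dots> \<le> (\<Sum>i. ennreal (C * q ^ i))" by (intro suminf_le term_le) auto
  also have "\<dots> = ennreal (\<Sum>i. C * q ^ i)"
    using C q by (intro suminf_ennreal2 summable_mult summable_geometric) auto
  finally have "(\<integral>\<^sup>+\<omega>. ?F \<omega> \<partial>P) \<noteq> \<infinity>" by (auto simp: top_unique)
  then have "AE \<omega> in P. ?F \<omega> \<noteq> \<infinity>" by (intro nn_integral_noteq_infinite) auto
  with AE_space show ?thesis
  proof eventually_elim
    case (elim \<omega>)
    note [simp] = elim(1)
    have img: "(\<lambda>t. vec_join t (X t \<omega>)) ` space cube_measure = graph_over unit_cube (\<lambda>t. X t \<omega>)"
      by (simp add: graph_over_def space_restrict_space)
    have "0 < hausdorff_premeasure s 1 ((\<lambda>t. vec_join t (X t \<omega>)) ` space cube_measure)"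
      if s: "0 \<le> s" "s \<le> \<gamma>" for s
    proof (rule hausdorff_premeasure_pos[OF finite_measure_cube_measure])
      show "emeasure cube_measure (space (cube_measure :: (real ^ 'd) measure)) \<noteq> 0"
        by (simp add: emeasure_restrict_space space_restrict_space emeasure_unit_cube)
      show "(\<lambda>t. vec_join t (X t \<omega>)) \<in> borel_measurable cube_measure" by measurable
      show "(\<Sum>i. ennreal ((2 ^ i) powr \<gamma>) * (\<integral>\<^sup>+t. \<integral>\<^sup>+s. indicator (cball 0 (1 / 2 ^ i))
          (vec_join t (X t \<omega>) - vec_join s (X s \<omega>)) \<partial>cube_measure \<partial>cube_measure)) < \<top>"
        using elim(2) unfolding pair_mass_def by (simp add: less_top)
    qed (use s \<gamma> in auto)
    then show ?case unfolding img by blast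
  qed
qed

text \<open>Between \<delta> and the exponent fit \<alpha> < \<beta> < \<gamma>: \<gamma> bounds the
  volumes, \<beta> the mass of pairs, and \<alpha> is left for the Frostman argument.\<close>

lemma s_exponent_le:
  assumes dim: "AE \<omega> in P. hausdorff_dim (graph_over unit_cube (\<lambda>t. X t \<omega>)) = ereal \<delta>"
    and bci: "bci_condition P X W"
  shows "s_exponent W dU \<le> \<delta>"
proof (rule ccontr)
  let ?n = "real CARD('d + 'm)"
  let ?\<phi> = "\<lambda>k. singular_value_function (matrix_power W k)"
  define R where "R = {r. 0 < r \<and> r \<le> ?n \<and> (\<lambda>k. ?\<phi> k r / dU ^ k) \<longlonglongrightarrow> 0}"
  have s: "s_exponent W dU = (if R = {} then ?n else Inf R)"
    by (simp only: s_exponent_def R_def Let_def)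
  have bdd: "bdd_below R" by (rule bdd_belowI[of _ 0]) (simp add: R_def)
  assume "\<not> s_exponent W dU \<le> \<delta>"
  \<comment> \<open>This makes the chosen exponents positive. It holds because the dimension is an
    infimum over nonnegative numbers and an almost sure event is not empty.\<close>
  moreover have "0 \<le> \<delta>"
  proof (rule ccontr)
    assume "\<not> 0 \<le> \<delta>"
    have nonneg: "0 \<le> hausdorff_dim (graph_over unit_cube (\<lambda>t. X t \<omega>))" for \<omega>
      unfolding hausdorff_dim_def by (intro INF_greatest) auto
    from dim have "AE \<omega> in P. False"
    proof eventually_elim
      case (elim \<omega>)
      then have "0 \<le> ereal \<delta>" using nonneg[of \<omega>] by simp
      then show ?case using \<open>\<not> 0 \<le> \<delta>\<close> by simp
    qed
    then show False by simp
  qed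
  ultimately have \<delta>: "\<delta> < s_exponent W dU" "0 \<le> \<delta>" by auto
  obtain \<gamma> where \<gamma>: "\<delta> < \<gamma>" "\<gamma> < s_exponent W dU" using dense[OF \<delta>(1)] by blast
  obtain \<beta> where \<beta>: "\<delta> < \<beta>" "\<beta> < \<gamma>" using dense[OF \<gamma>(1)] by blast
  obtain \<alpha> where \<alpha>: "\<delta> < \<alpha>" "\<alpha> < \<beta>" using dense[OF \<beta>(1)] by blast
  have "s_exponent W dU \<le> ?n"
  proof (cases "R = {}")
    case False
    then obtain r where "r \<in> R" by blast
    then have "Inf R \<le> r" by (rule cInf_lower[OF _ bdd])
    moreover have "r \<le> ?n" using \<open>r \<in> R\<close> by (simp add: R_def)
    ultimately show ?thesis unfolding s using False by simp
  qed (simp add: s)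
  then have \<gamma>n: "0 < \<gamma>" "\<gamma> \<le> ?n" using \<gamma> \<delta> by auto
  have "\<gamma> \<notin> R"
  proof
    assume "\<gamma> \<in> R"
    then have "Inf R \<le> \<gamma>" by (intro cInf_lower bdd)
    then show False using \<gamma>(2) \<open>\<gamma> \<in> R\<close> unfolding s by (auto split: if_splits)
  qed
  then have not0: "\<not> (\<lambda>k. ?\<phi> k \<gamma> / dU ^ k) \<longlonglongrightarrow> 0" using \<gamma>n by (simp add: R_def)
  obtain C where C: "0 < C" "\<And>k r. 0 < r \<Longrightarrow> dU ^ k * flat_vol (matrix_power W k) r \<le> C * r powr \<gamma>"
    using flat_vol_powers_le[OF invertible_block_diag[OF invertible] dU_pos less_imp_le[OF dU_less_1] \<gamma>n not0] by blast
  obtain C' where C': "0 \<le> C'" "\<And>r. 0 < r \<Longrightarrow> r \<le> 1 \<Longrightarrow>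
      (\<integral>\<^sup>+\<omega>. pair_mass (cball 0 r) \<omega> \<partial>P) \<le> ennreal (C' * r powr \<beta>)"
    using nn_integral_pair_mass_le_powr[OF bci C, of \<beta>] \<beta> \<delta> by auto
  have "AE \<omega> in P. \<forall>s. 0 \<le> s \<longrightarrow> s \<le> \<alpha> \<longrightarrow>
      0 < hausdorff_premeasure s 1 (graph_over unit_cube (\<lambda>t. X t \<omega>))"
    by (rule AE_hausdorff_premeasure_pos[OF C'(1) _ _ \<alpha>(2)]) (use C'(2) \<alpha> \<delta> in auto)
  from this dim have "AE \<omega> in P. False"
  proof eventually_elim
    case (elim \<omega>)
    let ?G = "graph_over unit_cube (\<lambda>t. X t \<omega>)"
    \<comment> \<open>Dimension below \<alpha> yields some s < \<alpha> with vanishing Hausdorff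
      measure, yet the premeasure at scale 1, which is no larger, is positive.\<close>
    have "hausdorff_dim ?G < ereal \<alpha>" using elim(2) \<alpha> by simp
    then obtain s where s: "0 \<le> s" "hausdorff_measure s ?G = 0" "s < \<alpha>"
      unfolding hausdorff_dim_def INF_less_iff by auto
    have "hausdorff_premeasure s 1 ?G \<le> hausdorff_measure s ?G"
      unfolding hausdorff_measure_def by (rule SUP_upper) simp
    then show ?case using elim(1) s by (metis less_imp_le not_less)
  qed
  then show False by simp
qed

end

theorem corollary3p3:
  fixes P :: "'w measure"
    and U :: "real ^ 'd ^ 'd" and V :: "real ^ 'm ^ 'm"
    and X :: "real ^ 'd \<Rightarrow> 'w \<Rightarrow> real ^ 'm"
    and \<delta> :: real
  assumes "prob_space P"
    and "contracting U" and "invertible U"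
    and "contracting V" and "invertible V"
    and "self_affine_field P U V X"
    and "AE \<omega> in P. hausdorff_dim (graph_over unit_cube (\<lambda>t. X t \<omega>)) = ereal \<delta>"
    and "\<And>\<gamma>. 0 \<le> \<gamma> \<Longrightarrow> \<gamma> < \<delta> \<Longrightarrow>
      (\<integral>\<^sup>+ t \<in> cube. (\<integral>\<^sup>+ \<omega>. ennreal ((norm t + norm (X t \<omega>)) powr (- \<gamma>)) \<partial>P) \<partial>lborel) < \<infinity>"
    and "bci_condition P X (block_diag U V)"
  shows "AE \<omega> in P. hausdorff_dim (graph_over unit_cube (\<lambda>t. X t \<omega>)) =
    ereal (s_exponent (block_diag U V) \<bar>det U\<bar>)"
proof -
  interpret affine_field P U V X
    using assms by (intro affine_field.intro affine_field_axioms.intro)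
      (auto simp: self_affine_field_def)
  have "\<delta> = s_exponent (block_diag U V) \<bar>det U\<bar>"
    using le_s_exponent[of \<delta>, OF assms(8)[OF less_imp_le]] s_exponent_le[OF assms(7,9)] by (rule antisym)
  then show ?thesis using assms(7) by simp
qed

end
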